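(* Let $F$ be a finite field of characteristic $p$ and order $q=p^n$ (so $n=[F:\mathbb{F}_p]$), and let $d$ be a positive integer with $\gcd(d,q-1)=1$. Define $W_{F,d}(a)=\sum_{x\in F}\psi(x^d-ax)$ for $a\in F$ and $V_{F,d}=\min_{a\in F}\operatorname{val}_p(W_{F,d}(a))$. (i) If $d$ is degenerate over $F$, then $V_{F,d}=[F:\mathbb{F}_p]$. (ii) Suppose $d$ is nondegenerate over $F$ but degenerate over $\mathbb{F}_p$. (a) If $[F:\mathbb{F}_p]$ is a power of $2$, then $V_{F,d}\le \frac12[F:\mathbb{F}_p]$. (b) Otherwise $V_{F,d}\le\frac23[F:\mathbb{F}_p]$. (iii) Suppose $d$ is nondegenerate over $\mathbb{F}_p$ (so $p\ge 5$). (a) If $p\equiv 1\pmod 4$ and $[F:\mathbb{F}_p]$ is odd, then $V_{F,d}\le\frac12[F:\mathbb{F}_p]$. (b) Otherwise $V_{F,d}\le \frac{1}{p-1}\left\lceil\frac{p-1}{3}\right\rceil[F:\mathbb{F}_p]$.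
   Context: $\psi$ is the canonical additive character of $F$: $\psi(x)=e^{2\pi i\operatorname{Tr}(x)/p}$, where $\operatorname{Tr}(x)=x+x^p+\cdots+x^{p^{n-1}}$ is the absolute trace $F\to\mathbb{F}_p$. The $p$-adic valuation $\operatorname{val}_p$ is extended from $\mathbb{Q}$ to $\mathbb{Q}(e^{2\pi i/p})$ so that $\operatorname{val}_p(1-e^{2\pi i/p})=1/(p-1)$ (so $\operatorname{val}_p(p)=1$, and $\operatorname{val}_p(0)=+\infty$). For a subfield $K$ of $F$, the exponent $d$ is called degenerate over $K$ if $d$ is congruent to a power of $p$ modulo $|K|-1$, and nondegenerate over $K$ otherwise. *)

theory Defs
  imports
    Complex_Main
    "HOL-Library.Extended_Real"
    "HOL-Library.FuncSet"
    "HOL-Library.Cardinality"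
    "HOL-Computational_Algebra.Computational_Algebra"
    "HOL-Number_Theory.Cong"
begin

section \<open>The extended p-adic valuation\<close>

definition zeta :: "nat \<Rightarrow> complex" where
  "zeta p = exp (2 * of_real pi * \<i> / of_nat p)"

definition cyclotomic_field :: "nat \<Rightarrow> complex set" where
  "cyclotomic_field p =
     {poly f (zeta p) / poly g (zeta p) | f g. (\<forall>i. coeff f i \<in> \<rat>) \<and> (\<forall>i. coeff g i \<in> \<rat>)}"

definition extends_padic_val :: "nat \<Rightarrow> (complex \<Rightarrow> ereal) \<Rightarrow> bool" where
  "extends_padic_val p v \<longleftrightarrow>
     (\<forall>x\<in>cyclotomic_field p. v x \<noteq> - \<infinity>) \<and>
     (\<forall>x\<in>cyclotomic_field p. v x = \<infinity> \<longleftrightarrow> x = 0) \<and>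
     (\<forall>x\<in>cyclotomic_field p. \<forall>y\<in>cyclotomic_field p. v (x * y) = v x + v y) \<and>
     (\<forall>x\<in>cyclotomic_field p. \<forall>y\<in>cyclotomic_field p. v (x + y) \<ge> min (v x) (v y)) \<and>
     (\<forall>a b :: int. a \<noteq> 0 \<longrightarrow> b \<noteq> 0 \<longrightarrow>
        v (of_int a / of_int b) =
          ereal (real (multiplicity (int p) a) - real (multiplicity (int p) b))) \<and>
     v (1 - zeta p) = ereal (1 / (real p - 1))"

text \<open>For prime \<open>p\<close>, the description picks out exactly one function, see
  \<open>ex1_extends_padic_val\<close> below. Extensionality only fixes the irrelevant values
  outside the cyclotomic field.\<close>

definition val_p :: "nat \<Rightarrow> complex \<Rightarrow> ereal" where
  "val_p p = (THE v. v \<in> extensional (cyclotomic_field p) \<and> extends_padic_val p v)"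


section \<open>Weil sums of binomials over a finite field\<close>

text \<open>Throughout, \<open>n\<close> is the degree of the finite field over its prime field, i.e. the
  number with \<open>CARD('a) = CHAR('a) ^ n\<close>.\<close>

definition abs_trace :: "nat \<Rightarrow> 'a :: finite_field \<Rightarrow> 'a" where
  "abs_trace n x = (\<Sum>i<n. x ^ (CHAR('a) ^ i))"

text \<open>The trace is an element of the prime field inside \<open>'a\<close>; in the exponential it is
  replaced by its representative in \<open>{0..<p}\<close>, see \<open>abs_trace_representative\<close> below.\<close>

definition canonical_char :: "nat \<Rightarrow> 'a :: finite_field \<Rightarrow> complex" where
  "canonical_char n x =
     exp (2 * of_real pi * \<i> *
          of_nat (THE k. k < CHAR('a) \<and> of_nat k = abs_trace n x) / of_nat CHAR('a))"

definition weil_sum :: "nat \<Rightarrow> nat \<Rightarrow> 'a :: finite_field \<Rightarrow> complex" where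
  "weil_sum n d a = (\<Sum>x\<in>UNIV. canonical_char n (x ^ d - a * x))"

definition weil_V :: "'a :: finite_field itself \<Rightarrow> nat \<Rightarrow> nat \<Rightarrow> ereal" where
  "weil_V _ n d = Min (range (\<lambda>a :: 'a. val_p CHAR('a) (weil_sum n d a)))"

definition prime_subfield :: "'a :: finite_field set" where
  "prime_subfield = range of_nat"

definition degenerate_over :: "'a :: finite_field set \<Rightarrow> nat \<Rightarrow> bool" where
  "degenerate_over K d \<longleftrightarrow> (\<exists>k. [d = CHAR('a) ^ k] (mod (card K - 1)))"


section \<open>The definitions are well-posed\<close>

subsection \<open>Trace and prime field\<close>

lemma card_prime_subfield: "card (prime_subfield :: 'a :: finite_field set) = CHAR('a)"
proof -
  have "(prime_subfield :: 'a set) = of_nat ` {..<CHAR('a)}"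
  proof (intro equalityI subsetI)
    fix x :: 'a assume "x \<in> prime_subfield"
    then obtain k where "x = of_nat k" by (auto simp: prime_subfield_def)
    hence "x = of_nat (k mod CHAR('a))"
      by (simp add: of_nat_eq_iff_cong_CHAR cong_def)
    moreover have "k mod CHAR('a) < CHAR('a)" by simp
    ultimately show "x \<in> of_nat ` {..<CHAR('a)}" by blast
  qed (auto simp: prime_subfield_def)
  moreover have "inj_on (of_nat :: nat \<Rightarrow> 'a) {..<CHAR('a)}"
    by (auto intro!: inj_onI simp: of_nat_eq_iff_cong_CHAR cong_def)
  ultimately show ?thesis by (metis card_image card_lessThan)
qed

lemma prime_subfield_eq_frobenius_fixed:
  "(prime_subfield :: 'a :: finite_field set) = {x. x ^ CHAR('a) = x}"
proof (rule card_seteq)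
  let ?p = "CHAR('a)"
  let ?f = "monom 1 ?p - [:0, 1:] :: 'a poly"
  have p2: "?p \<ge> 2" using prime_ge_2_nat[OF CHAR_prime] .
  have "coeff ?f ?p = 1" using p2 by (cases ?p) (auto simp: coeff_pCons split: nat.splits)
  hence nz: "?f \<noteq> 0" by (metis coeff_0 one_neq_zero)
  have "degree ?f \<le> ?p"
    using p2 by (intro degree_diff_le) (auto simp: degree_monom_le)
  hence "card {x. poly ?f x = 0} \<le> ?p" using card_poly_roots_bound[OF nz] by linarith
  also have "{x. poly ?f x = 0} = {x. x ^ ?p = x}" by (auto simp: poly_monom)
  finally show "card {x :: 'a. x ^ ?p = x} \<le> card (prime_subfield :: 'a set)"
    by (simp add: card_prime_subfield)
  have "(of_nat k :: 'a) ^ ?p = of_nat k" for k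
  proof (induction k)
    case 0 thus ?case using p2 by simp
  next
    case (Suc k)
    have "(1 + of_nat k :: 'a) ^ ?p = 1 ^ ?p + of_nat k ^ ?p"
      by (rule freshmans_dream) auto
    with Suc show ?case by simp
  qed
  thus "(prime_subfield :: 'a set) \<subseteq> {x. x ^ ?p = x}" by (auto simp: prime_subfield_def)
qed auto

lemma abs_trace_representative:
  fixes x :: "'a :: finite_field"
  assumes "CARD('a) = CHAR('a) ^ n"
  shows "\<exists>!k. k < CHAR('a) \<and> of_nat k = abs_trace n x"
proof -
  let ?p = "CHAR('a)"
  have "abs_trace n x ^ ?p = (\<Sum>i<n. (x ^ (?p ^ i)) ^ ?p)"
    unfolding abs_trace_def by (rule freshmans_dream_sum) auto
  also have "\<dots> = (\<Sum>i<n. x ^ (?p ^ Suc i))"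
    by (simp add: power_mult [symmetric] mult.commute)
  also have "\<dots> + x = (\<Sum>i<Suc n. x ^ (?p ^ i))"
    by (subst sum.lessThan_Suc_shift) simp
  also have "\<dots> = abs_trace n x + x"
    using finite_field_power_card_eq_same[of x] assms by (simp add: abs_trace_def)
  finally have "abs_trace n x \<in> prime_subfield"
    by (simp add: prime_subfield_eq_frobenius_fixed)
  then obtain k where k: "abs_trace n x = of_nat k" by (auto simp: prime_subfield_def)
  show ?thesis
  proof (rule ex1I[of _ "k mod ?p"])
    show "k mod ?p < ?p \<and> of_nat (k mod ?p) = abs_trace n x"
      by (simp add: k of_nat_eq_iff_cong_CHAR cong_def)
  qed (auto simp: k of_nat_eq_iff_cong_CHAR cong_def)
qed


subsection \<open>Existence and uniqueness of the extended valuation\<close>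

context
  fixes p :: nat
  assumes p: "prime p"
begin

private definition ev :: "int poly \<Rightarrow> complex" where
  "ev f = poly (map_poly of_int f) (zeta p)"

private lemma ev_0 [simp]: "ev 0 = 0"
  by (simp add: ev_def)

private lemma ev_pCons [simp]: "ev (pCons a f) = of_int a + zeta p * ev f"
  by (simp add: ev_def map_poly_pCons)

private lemma ev_1 [simp]: "ev 1 = 1"
  by (simp add: one_pCons)

private lemma ev_add [simp]: "ev (f + g) = ev f + ev g"
  by (induction f g rule: poly_induct2) (simp_all add: algebra_simps)

private lemma ev_smult [simp]: "ev (smult c f) = of_int c * ev f"
  by (induction f) (simp_all add: algebra_simps)

private lemma ev_uminus [simp]: "ev (- f) = - ev f"
  using ev_smult[of "-1" f] by simp

private lemma ev_diff [simp]: "ev (f - g) = ev f - ev g"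
  using ev_add[of f "- g"] by simp

private lemma ev_mult [simp]: "ev (f * g) = ev f * ev g"
  by (induction f) (simp_all add: algebra_simps)

private lemma ev_power [simp]: "ev (f ^ k) = ev f ^ k"
  by (induction k) simp_all

private lemma ev_sum [simp]: "ev (sum f A) = (\<Sum>i\<in>A. ev (f i))"
  by (induction A rule: infinite_finite_induct) simp_all

private lemma ev_of_int [simp]: "ev (of_int c) = of_int c"
  by (simp add: of_int_poly)

private lemma p_ge_2: "p \<ge> 2"
  using p by (rule prime_ge_2_nat)

private lemma zeta_power: "zeta p ^ p = 1"
proof -
  have "zeta p ^ p = exp (of_nat p * (2 * of_real pi * \<i> / of_nat p))"
    by (simp only: zeta_def exp_of_nat_mult)
  also have "of_nat p * (2 * of_real pi * \<i> / of_nat p) = 2 * of_real pi * \<i>"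
    using p_ge_2 by simp
  finally show ?thesis by simp
qed

private lemma zeta_nonzero: "zeta p \<noteq> 0"
  by (simp add: zeta_def)

private lemma zeta_neq_1: "zeta p \<noteq> 1"
proof
  assume "zeta p = 1"
  hence "cis (2 * pi / real p) = 1"
    by (simp add: zeta_def cis_conv_exp mult_ac)
  hence c: "cos (2 * pi / real p) = 1" by (metis cis.simps(1) one_complex.simps(1))
  have "0 < 2 * pi / real p" "2 * pi / real p \<le> pi"
    using p_ge_2 by (auto simp: field_simps)
  hence "cos (2 * pi / real p) < cos 0"
    by (intro cos_monotone_0_pi) auto
  with c show False by simp
qed

private lemma zeta_root: "(\<Sum>i<p. zeta p ^ i) = 0"
  using zeta_neq_1 zeta_power by (simp add: geometric_sum)

private definition cycl :: "int poly" where
  "cycl = (\<Sum>i<p. monom 1 i)"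

private lemma ev_monom: "ev (monom c k) = of_int c * zeta p ^ k"
  by (simp add: ev_def map_poly_monom poly_monom)

private lemma ev_cycl: "ev cycl = 0"
  using zeta_root by (simp add: cycl_def ev_monom)

private lemma coeff_cycl: "coeff cycl k = (if k < p then 1 else 0)"
  by (simp add: cycl_def coeff_sum)

private lemma cycl_monic: "lead_coeff cycl = 1" and degree_cycl: "degree cycl = p - 1"
proof -
  have "degree cycl \<le> p - 1" by (rule degree_le) (auto simp: coeff_cycl)
  moreover have "coeff cycl (p - 1) = 1" using p_ge_2 by (simp add: coeff_cycl)
  ultimately show *: "degree cycl = p - 1"
    by (intro antisym le_degree) auto
  show "lead_coeff cycl = 1" unfolding * using p_ge_2 by (simp add: coeff_cycl)
qed

private lemma cycl_at_1: "poly cycl 1 = int p"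
  by (simp add: cycl_def poly_sum poly_monom)

private lemma ev_eq_at_1: "\<exists>g :: int poly. f = [:poly f 1:] + [:-1, 1:] * g"
proof -
  have "poly (f - [:poly f 1:]) 1 = 0" by simp
  hence "[:-1, 1:] dvd f - [:poly f 1:]" by (subst (asm) poly_eq_0_iff_dvd)
  then obtain g where "f - [:poly f 1:] = [:-1, 1:] * g" by (auto elim: dvdE)
  thus ?thesis by (metis add.commute diff_add_cancel)
qed

private lemma min_poly_exists:
  obtains g :: "int poly" where "ev g = 0" "lead_coeff g = 1" "degree g > 0"
    "\<And>f. ev f = 0 \<Longrightarrow> degree f < degree g \<Longrightarrow> f = 0"
proof -
  define P where "P = (\<lambda>g. g \<noteq> 0 \<and> ev g = 0)"
  have "P cycl" using ev_cycl cycl_monic by (auto simp: P_def)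
  then obtain g0 where g0: "P g0" "\<And>f. P f \<Longrightarrow> degree g0 \<le> degree f"
    by (metis arg_min_natI arg_min_nat_le)
  define g where "g = primitive_part g0"
  have g0_eq: "g0 = smult (content g0) g" by (simp add: g_def)
  have c0: "content g0 \<noteq> 0" using g0(1) by (simp add: P_def)
  have "of_int (content g0) * ev g = 0"
    using g0(1) g0_eq ev_smult[of "content g0" g] by (simp add: P_def)
  hence evg: "ev g = 0" using c0 by simp
  have gnz: "g \<noteq> 0" using g0(1) by (auto simp: P_def g_def)
  have deg: "degree g = degree g0" by (simp add: g_def)
  have minim: "f = 0" if "ev f = 0" "degree f < degree g" for f
    using g0(2)[of f] that deg by (force simp: P_def)
  have cont: "content g = 1" using g0(1) by (simp add: g_def P_def)
  obtain q r where qr: "pseudo_divmod cycl g = (q, r)" by force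
  define c where "c = lead_coeff g ^ (Suc (degree cycl) - degree g)"
  have eq: "smult c cycl = g * q + r" and r: "r = 0 \<or> degree r < degree g"
    using pseudo_divmod[OF gnz qr] by (auto simp: c_def)
  have "ev r = 0"
    using arg_cong[OF eq, of ev] evg ev_cycl by simp
  with r minim have "r = 0" by blast
  with eq have eq: "smult c cycl = g * q" by simp
  have "c \<noteq> 0" using gnz by (simp add: c_def)
  have "smult (content q) g * primitive_part q = smult c cycl"
    by (metis content_times_primitive_part mult_smult_left mult_smult_right eq)
  moreover have "content q = normalize c"
  proof -
    have "content cycl dvd lead_coeff cycl" by (rule content_dvd_coeff)
    hence "is_unit (content cycl)" by (simp add: cycl_monic)
    hence "content cycl = 1" using is_unit_normalize normalize_content by metis
    thus ?thesis using arg_cong[OF eq, of content] cont by (simp add: content_mult)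
  qed
  ultimately have "smult (normalize c) (g * primitive_part q) = smult c cycl" by simp
  moreover have "normalize c = c * sgn c" by (simp add: abs_sgn mult.commute)
  ultimately have "smult c (smult (sgn c) (g * primitive_part q)) = smult c cycl"
    by (simp add: mult_ac)
  hence "smult (sgn c) (g * primitive_part q) = cycl"
    using \<open>c \<noteq> 0\<close> by (simp add: smult_cancel)
  hence "lead_coeff cycl = sgn c * (lead_coeff g * lead_coeff (primitive_part q))"
    by (metis lead_coeff_mult lead_coeff_smult)
  hence "lead_coeff g dvd 1"
    unfolding cycl_monic by (metis dvd_triv_left dvd_mult mult.left_commute)
  hence lg: "\<bar>lead_coeff g\<bar> = 1" by simp
  have dpos: "degree g > 0"
  proof (rule ccontr)
    assume "\<not> degree g > 0"
    then obtain a where "g = [:a:]" by (metis degree_eq_zeroE gr0I)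
    with evg gnz show False by simp
  qed
  show ?thesis
  proof (rule that[of "smult (lead_coeff g) g"])
    show "lead_coeff (smult (lead_coeff g) g) = 1"
      using lg by (auto simp: abs_if split: if_splits)
  qed (use evg dpos minim gnz in auto)
qed

private lemma reduced_rep:
  obtains D :: nat where "D > 0" "\<And>f. \<exists>r. ev r = ev f \<and> degree r < D"
    "\<And>f. ev f = 0 \<Longrightarrow> degree f < D \<Longrightarrow> f = 0"
proof -
  obtain g where g: "ev g = 0" "lead_coeff g = 1" "degree g > 0"
    "\<And>f. ev f = 0 \<Longrightarrow> degree f < degree g \<Longrightarrow> f = 0"
    using min_poly_exists by blast
  have "\<exists>r. ev r = ev f \<and> degree r < degree g" for f
  proof -
    have gnz: "g \<noteq> 0" using g(3) by auto
    obtain q r where qr: "pseudo_divmod f g = (q, r)" by force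
    have eq: "f = g * q + r" and r: "r = 0 \<or> degree r < degree g"
      using pseudo_divmod[OF gnz qr] g(2) by auto
    have "ev r = ev f" using eq g(1) by simp
    thus ?thesis using r g(3) by (metis degree_0)
  qed
  thus ?thesis using that g by blast
qed

private lemma p_dvd_int:
  assumes "of_int m = of_nat p * ev f" shows "int p dvd m"
proof -
  obtain D where g: "D > 0" "\<And>f. \<exists>r. ev r = ev f \<and> degree r < D"
    "\<And>f. ev f = 0 \<Longrightarrow> degree f < D \<Longrightarrow> f = 0"
    using reduced_rep by blast
  obtain r where r: "ev r = ev f" "degree r < D" using g(2) by blast
  have "ev ([:m:] - smult (int p) r) = 0" using assms r by simp
  moreover have "degree ([:m:] - smult (int p) r) < D"
    using r(2) g(1) by (intro degree_diff_less) (auto simp: degree_smult_eq)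
  ultimately have "[:m:] - smult (int p) r = 0" using g(3) by blast
  hence "coeff [:m:] 0 = coeff (smult (int p) r) 0" by simp
  thus ?thesis by simp
qed

private lemma p_divisible_imp_0:
  assumes "\<And>j :: nat. \<exists>h. ev f = of_nat p ^ j * ev h" shows "ev f = 0"
proof -
  obtain D where g: "D > 0" "\<And>f. \<exists>r. ev r = ev f \<and> degree r < D"
    "\<And>f. ev f = 0 \<Longrightarrow> degree f < D \<Longrightarrow> f = 0"
    using reduced_rep by blast
  obtain r where r: "ev r = ev f" "degree r < D" using g(2) by blast
  have "coeff r i = 0" for i
  proof (rule ccontr)
    assume nz: "coeff r i \<noteq> 0"
    have "int p ^ j dvd coeff r i" for j
    proof -
      obtain h where h: "ev f = of_nat p ^ j * ev h" using assms by blast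
      obtain s where s: "ev s = ev h" "degree s < D" using g(2) by blast
      have "ev (r - smult (int p ^ j) s) = 0" using h r s by simp
      moreover have "degree (r - smult (int p ^ j) s) < D"
        using r s by (intro degree_diff_less) (auto simp: degree_smult_eq)
      ultimately have "r - smult (int p ^ j) s = 0" using g(3) by blast
      hence "r = smult (int p ^ j) s" by simp
      thus ?thesis by simp
    qed
    moreover have "\<not> is_unit (int p)" using p_ge_2 by simp
    ultimately show False
      using nz by (metis finite_divisor_powers finite_nat_set_iff_bounded mem_Collect_eq less_irrefl)
  qed
  hence "r = 0" by (simp add: poly_eq_iff)
  with r show ?thesis by simp
qed

private definition unif :: complex where "unif = 1 - zeta p"

private lemma unif_nz: "unif \<noteq> 0"
  using zeta_neq_1 by (simp add: unif_def)

private definition U :: "complex set" where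
  "U = {ev f | f. \<not> int p dvd poly f 1}"

private lemma U_mult: "a \<in> U \<Longrightarrow> b \<in> U \<Longrightarrow> a * b \<in> U"
proof -
  assume "a \<in> U" "b \<in> U"
  then obtain f g where "a = ev f" "b = ev g" "\<not> int p dvd poly f 1" "\<not> int p dvd poly g 1"
    by (auto simp: U_def)
  moreover from this have "\<not> int p dvd poly (f * g) 1"
    using p by (simp add: prime_dvd_mult_iff)
  ultimately show ?thesis unfolding U_def using ev_mult by (metis (mono_tags, lifting) mem_Collect_eq)
qed

private lemma U_1: "1 \<in> U"
  unfolding U_def using p_ge_2 by (auto intro!: exI[of _ 1])

private lemma unif_power_p: "\<exists>t\<in>U. unif ^ (p - 1) = of_nat p * t"
proof -
  define y where "y = zeta p - 1"
  define c where "c = (\<lambda>k. int ((p choose Suc k) div p))"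
  have c: "of_nat (p choose Suc k) = (of_nat p * of_int (c k) :: complex)" if "k < p - 1" for k
  proof -
    have "p dvd p choose Suc k" using that p by (intro dvd_choose_prime) auto
    thus ?thesis by (auto simp: c_def elim!: dvdE simp flip: of_nat_mult)
  qed
  have "1 = (y + 1) ^ p" by (simp add: y_def zeta_power)
  also have "\<dots> = (\<Sum>k\<le>p. of_nat (p choose k) * y ^ k)"
    by (simp add: binomial_ring)
  also have "\<dots> = 1 + (\<Sum>k<p. of_nat (p choose Suc k) * y ^ Suc k)"
    by (subst sum.atMost_shift) simp
  also have "(\<Sum>k<p. of_nat (p choose Suc k) * y ^ Suc k) =
             y * (\<Sum>k<p. of_nat (p choose Suc k) * y ^ k)"
    by (simp add: sum_distrib_left mult_ac)
  finally have "(\<Sum>k<Suc (p - 1). of_nat (p choose Suc k) * y ^ k) = 0"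
    using zeta_neq_1 p_ge_2 by (simp add: y_def)
  hence "(\<Sum>k<p - 1. of_nat (p choose Suc k) * y ^ k) + of_nat (p choose Suc (p - 1)) * y ^ (p - 1) = 0"
    by (simp only: sum.lessThan_Suc)
  moreover have "Suc (p - 1) = p" using p_ge_2 by simp
  ultimately have "y ^ (p - 1) = - (\<Sum>k<p - 1. of_nat (p choose Suc k) * y ^ k)"
    by (simp add: eq_neg_iff_add_eq_0 add.commute)
  also have "(\<Sum>k<p - 1. of_nat (p choose Suc k) * y ^ k) =
             of_nat p * (\<Sum>k<p - 1. of_int (c k) * y ^ k)"
    by (simp add: c sum_distrib_left mult_ac)
  finally have y: "y ^ (p - 1) = of_nat p * (- (\<Sum>k<p - 1. of_int (c k) * y ^ k))" by simp
  define f where "f = smult ((-1) ^ p) (\<Sum>k<p - 1. smult (c k) ([:-1, 1:] ^ k))"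
  have "poly f 1 = (-1) ^ p * (\<Sum>k<p - 1. c k * 0 ^ k)"
    by (simp add: f_def poly_sum)
  also have "(\<Sum>k<p - 1. c k * 0 ^ k) = (\<Sum>k\<in>{0}. c k * 0 ^ k)"
    using p_ge_2 by (intro sum.mono_neutral_right) auto
  also have "\<dots> = 1" using p_ge_2 by (simp add: c_def)
  finally have "\<not> int p dvd poly f 1" using p_ge_2 by (cases "even p") auto
  hence "ev f \<in> U" by (auto simp: U_def)
  moreover have "unif ^ (p - 1) = of_nat p * ev f"
  proof -
    have "unif = (-1) * y" by (simp add: unif_def y_def)
    hence "unif ^ (p - 1) = (-1) ^ (p - 1) * y ^ (p - 1)" by (simp only: power_mult_distrib)
    also have "(-1 :: complex) ^ (p - 1) = - ((-1) ^ p)" using p_ge_2 by (cases p) auto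
    finally show ?thesis unfolding y by (simp add: f_def y_def)
  qed
  ultimately show ?thesis by blast
qed

private lemma not_U_imp:
  assumes "int p dvd poly f 1" shows "\<exists>g. ev f = unif * ev g"
proof -
  obtain g where g: "f = [:poly f 1:] + [:-1, 1:] * g" using ev_eq_at_1 by blast
  obtain h where h: "cycl = [:int p:] + [:-1, 1:] * h" using ev_eq_at_1[of cycl] cycl_at_1 by auto
  obtain k where k: "poly f 1 = int p * k" using assms by (auto elim: dvdE)
  have "ev cycl = of_nat p + (zeta p - 1) * ev h" by (subst h) (simp add: algebra_simps)
  hence "of_nat p = unif * ev h" by (simp add: ev_cycl unif_def algebra_simps)
  moreover have "ev f = of_int (poly f 1) + (zeta p - 1) * ev g"
    by (subst g) (simp add: algebra_simps)
  hence "ev f = of_nat p * of_int k - unif * ev g" by (simp add: k unif_def algebra_simps)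
  ultimately have "ev f = unif * ev (smult k h - g)"
    by (simp add: algebra_simps)
  thus ?thesis by blast
qed

private lemma ev_0_imp_dvd: assumes "ev f = 0" shows "int p dvd poly f 1"
proof -
  obtain g where g: "f = [:poly f 1:] + [:-1, 1:] * g" using ev_eq_at_1 by blast
  obtain t where t: "t \<in> U" "unif ^ (p - 1) = of_nat p * t" using unif_power_p by blast
  then obtain s where s: "t = ev s" by (auto simp: U_def)
  have "ev f = of_int (poly f 1) + (zeta p - 1) * ev g"
    by (subst g) (simp add: algebra_simps)
  hence "of_int (poly f 1) = unif * ev g" using assms by (simp add: unif_def algebra_simps)
  hence "of_int (poly f 1 ^ (p - 1)) = of_nat p * ev (s * g ^ (p - 1))"
    using t s by (simp add: power_mult_distrib)
  hence "int p dvd poly f 1 ^ (p - 1)" by (rule p_dvd_int)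
  thus ?thesis using p by (meson prime_dvd_power prime_nat_int_transfer)
qed

private lemma U_nz: "0 \<notin> U"
  using ev_0_imp_dvd by (auto simp: U_def)

private lemma U_not_unif_mult: "unif * ev g \<notin> U"
proof
  assume "unif * ev g \<in> U"
  then obtain f where f: "\<not> int p dvd poly f 1" "unif * ev g = ev f" by (auto simp: U_def)
  have "ev (f - [:1, -1:] * g) = 0" using f(2) by (simp add: unif_def algebra_simps)
  hence "int p dvd poly (f - [:1, -1:] * g) 1" by (rule ev_0_imp_dvd)
  with f(1) show False by simp
qed

private lemma decomp: assumes "ev f \<noteq> 0" shows "\<exists>k. \<exists>u\<in>U. ev f = unif ^ k * u"
proof (rule ccontr)
  assume neg: "\<not> ?thesis"
  have all: "\<exists>h. ev f = unif ^ k * ev h" for k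
  proof (induction k)
    case 0 show ?case by auto
  next
    case (Suc k)
    then obtain h where h: "ev f = unif ^ k * ev h" by blast
    hence "ev h \<notin> U" using neg by blast
    hence "int p dvd poly h 1" by (auto simp: U_def)
    then obtain h' where "ev h = unif * ev h'" using not_U_imp by blast
    with h show ?case by (intro exI[of _ h']) simp
  qed
  obtain t where t: "t \<in> U" "unif ^ (p - 1) = of_nat p * t" using unif_power_p by blast
  then obtain s where s: "t = ev s" by (auto simp: U_def)
  have "\<exists>h. ev f = of_nat p ^ j * ev h" for j
  proof -
    obtain h where "ev f = unif ^ ((p - 1) * j) * ev h" using all by blast
    hence "ev f = of_nat p ^ j * ev (s ^ j * h)"
      unfolding power_mult t(2) s by (simp add: power_mult_distrib)
    thus ?thesis by blast
  qed
  hence "ev f = 0" by (rule p_divisible_imp_0)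
  with assms show False by simp
qed

private lemma ev_of_U: "u \<in> U \<Longrightarrow> \<exists>f. u = ev f"
  by (auto simp: U_def)

private lemma rat_poly_ev:
  fixes f :: "complex poly"
  assumes "\<forall>i. coeff f i \<in> \<rat>"
  shows "\<exists>m g. m \<noteq> (0 :: int) \<and> of_int m * poly f (zeta p) = ev g"
  using assms
proof (induction f)
  case 0
  show ?case by (intro exI[of _ 1] exI[of _ 0]) simp
next
  case (pCons a f)
  have a: "a \<in> \<rat>" using pCons.prems by (metis coeff_pCons_0)
  have "\<forall>i. coeff f i \<in> \<rat>" using pCons.prems by (metis coeff_pCons_Suc)
  with pCons.IH obtain m g where mg: "m \<noteq> 0" "of_int m * poly f (zeta p) = ev g" by blast
  from a obtain b c :: int where bc: "c > 0" "a = of_int b / of_int c"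
    by (auto elim: Rats_cases')
  have "of_int (m * c) * poly (pCons a f) (zeta p) = ev (pCons (m * b) (smult c g))"
    using bc mg(2)[symmetric] by (simp add: field_simps)
  moreover have "m * c \<noteq> 0" using bc mg by simp
  ultimately show ?case by blast
qed

private lemma cyclotomic_field_eq:
  "cyclotomic_field p = {ev f / ev g | f g. True}"
proof (intro equalityI subsetI)
  fix x assume "x \<in> cyclotomic_field p"
  then obtain f g where fg: "x = poly f (zeta p) / poly g (zeta p)"
    "\<forall>i. coeff f i \<in> \<rat>" "\<forall>i. coeff g i \<in> \<rat>" by (auto simp: cyclotomic_field_def)
  obtain m f' where f': "m \<noteq> 0" "of_int m * poly f (zeta p) = ev f'"
    using rat_poly_ev[OF fg(2)] by blast
  obtain l g' where g': "l \<noteq> 0" "of_int l * poly g (zeta p) = ev g'"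
    using rat_poly_ev[OF fg(3)] by blast
  have "x = ev (smult l f') / ev (smult m g')"
    unfolding fg ev_smult f'(2)[symmetric] g'(2)[symmetric] using f'(1) g'(1) by simp
  thus "x \<in> {ev f / ev g | f g. True}" by blast
next
  fix x assume "x \<in> {ev f / ev g | f g. True}"
  then obtain f g where "x = ev f / ev g" by blast
  moreover have "\<forall>i. coeff (map_poly of_int h :: complex poly) i \<in> \<rat>" for h
    by (simp add: coeff_map_poly)
  ultimately show "x \<in> cyclotomic_field p"
    unfolding cyclotomic_field_def ev_def by blast
qed

private lemma field_decomp:
  assumes "x \<in> cyclotomic_field p" "x \<noteq> 0"
  shows "\<exists>k :: int. \<exists>a\<in>U. \<exists>b\<in>U. x = unif powi k * (a / b)"
proof -
  obtain f g where fg: "x = ev f / ev g" using assms(1) by (auto simp: cyclotomic_field_eq)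
  with assms(2) have "ev f \<noteq> 0" "ev g \<noteq> 0" by auto
  then obtain k l a b where "a \<in> U" "b \<in> U" "ev f = unif ^ k * a" "ev g = unif ^ l * b"
    using decomp by meson
  moreover from this have "x = unif powi (int k - int l) * (a / b)"
    using fg unif_nz by (simp add: power_int_diff)
  ultimately show ?thesis by blast
qed

private lemma powi_in_field:
  assumes "a \<in> U" "b \<in> U" shows "unif powi k * (a / b) \<in> cyclotomic_field p"
proof -
  obtain f g where fg: "a = ev f" "b = ev g" using assms by (auto simp: U_def)
  have un: "unif = ev [:1, -1:]" by (simp add: unif_def)
  show ?thesis
  proof (cases "k \<ge> 0")
    case True
    hence "unif powi k * (a / b) = ev ([:1, -1:] ^ nat k * f) / ev g"
      by (simp add: fg un power_int_def)
    thus ?thesis unfolding cyclotomic_field_eq by blast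
  next
    case False
    hence "unif powi k * (a / b) = ev f / ev ([:1, -1:] ^ nat (-k) * g)"
      by (simp add: fg un power_int_def field_simps)
    thus ?thesis unfolding cyclotomic_field_eq by blast
  qed
qed

private lemma decomp_unique:
  assumes "a \<in> U" "b \<in> U" "c \<in> U" "d \<in> U"
    and "unif powi k * (a / b) = unif powi l * (c / d)"
  shows "k = l"
proof -
  have *: False if "k < l" "a \<in> U" "b \<in> U" "c \<in> U" "d \<in> U"
    "unif powi k * (a / b) = unif powi l * (c / d)" for k l a b c d
  proof -
    have U: "c \<in> U" "b \<in> U" by fact+
    have nz: "b \<noteq> 0" "d \<noteq> 0" using that U_nz by auto
    have "unif powi l = unif powi k * unif ^ nat (l - k)"
      using that unif_nz by (simp flip: power_int_add power_int_of_nat)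
    with that nz unif_nz have "a * d = unif ^ nat (l - k) * (c * b)"
      by (simp add: field_simps)
    also have "nat (l - k) = Suc (nat (l - k - 1))" using that by simp
    finally have eq: "a * d = unif * (unif ^ nat (l - k - 1) * (c * b))" by (simp add: mult_ac)
    obtain f g where fg: "c = ev f" "b = ev g" using ev_of_U U by blast
    have "unif ^ nat (l - k - 1) * (c * b) = ev ([:1, -1:] ^ nat (l - k - 1) * (f * g))"
      by (simp add: fg unif_def)
    with eq have "a * d = unif * ev ([:1, -1:] ^ nat (l - k - 1) * (f * g))" by simp
    with U_mult[of a d] that U_not_unif_mult show False by metis
  qed
  show ?thesis
    using *[of k l a b c d] *[of l k c d a b] assms by (metis linorder_neqE)
qed

private definition ord_unif :: "complex \<Rightarrow> int" where
  "ord_unif x = (THE k. \<exists>a\<in>U. \<exists>b\<in>U. x = unif powi k * (a / b))"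

private lemma ord_unif_eq:
  assumes "a \<in> U" "b \<in> U" "x = unif powi k * (a / b)" shows "ord_unif x = k"
  unfolding ord_unif_def by (rule the_equality) (use assms decomp_unique in blast)+

private definition v0 :: "complex \<Rightarrow> ereal" where
  "v0 = restrict (\<lambda>x. if x = 0 then \<infinity> else ereal (of_int (ord_unif x) / (real p - 1)))
     (cyclotomic_field p)"

private lemma v0_eq:
  assumes "a \<in> U" "b \<in> U" "x = unif powi k * (a / b)"
  shows "v0 x = ereal (of_int k / (real p - 1))"
proof -
  have "x \<in> cyclotomic_field p" using assms powi_in_field by simp
  moreover have "x \<noteq> 0" using assms U_nz unif_nz by auto
  ultimately show ?thesis using ord_unif_eq[OF assms] by (simp add: v0_def)
qed

private lemma zero_in_field: "0 \<in> cyclotomic_field p"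
proof -
  have "0 = ev 0 / ev 0" by simp
  thus ?thesis unfolding cyclotomic_field_eq by blast
qed

private lemma v0_0: "v0 0 = \<infinity>"
  using zero_in_field by (simp add: v0_def)

private lemma p_minus_1_pos: "real p - 1 > 0"
  using p_ge_2 by linarith

private lemma v0_mult:
  assumes "x \<in> cyclotomic_field p" "y \<in> cyclotomic_field p"
  shows "v0 (x * y) = v0 x + v0 y"
proof (cases "x = 0 \<or> y = 0")
  case True
  have "v0 z \<noteq> - \<infinity>" if "z \<in> cyclotomic_field p" for z
    using that by (auto simp: v0_def)
  thus ?thesis using True assms by (auto simp: v0_0)
next
  case False
  obtain k a b where x: "a \<in> U" "b \<in> U" "x = unif powi k * (a / b)"
    using field_decomp assms(1) False by blast
  obtain l c d where y: "c \<in> U" "d \<in> U" "y = unif powi l * (c / d)"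
    using field_decomp assms(2) False by blast
  have "x * y = unif powi (k + l) * ((a * c) / (b * d))"
    using x y unif_nz by (simp add: power_int_add)
  from v0_eq[OF _ _ this] v0_eq[OF x] v0_eq[OF y] x y U_mult show ?thesis
    by (simp add: add_divide_distrib)
qed

private lemma v0_add_aux:
  assumes "a \<in> U" "b \<in> U" "x = unif powi k * (a / b)"
    and "c \<in> U" "d \<in> U" "y = unif powi l * (c / d)" and "k \<le> l"
  shows "v0 (x + y) \<ge> v0 x"
proof (cases "x + y = 0")
  case True
  thus ?thesis by (simp add: v0_0)
next
  case False
  have nz: "b \<noteq> 0" "d \<noteq> 0" using assms U_nz by auto
  obtain fa fb fc fd where f: "a = ev fa" "b = ev fb" "c = ev fc" "d = ev fd"
    using assms ev_of_U by meson
  define h where "h = fa * fd + [:1, -1:] ^ nat (l - k) * (fc * fb)"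
  have "unif powi l = unif powi k * unif ^ nat (l - k)"
    using assms unif_nz by (simp flip: power_int_add power_int_of_nat)
  hence "x + y = unif powi k * ((a * d + unif ^ nat (l - k) * (c * b)) / (b * d))"
    using nz assms by (simp add: field_simps)
  also have "a * d + unif ^ nat (l - k) * (c * b) = ev h"
    by (simp add: h_def f unif_def)
  finally have xy: "x + y = unif powi k * (ev h / (b * d))" .
  hence "ev h \<noteq> 0" using False by auto
  then obtain m u where u: "u \<in> U" "ev h = unif ^ m * u" using decomp by blast
  have "x + y = unif powi (k + int m) * (u / (b * d))"
    using xy u unif_nz by (simp add: power_int_add)
  from v0_eq[OF u(1) _ this] have "v0 (x + y) = ereal (of_int (k + int m) / (real p - 1))"
    using assms U_mult by simp
  moreover have "v0 x = ereal (of_int k / (real p - 1))" using v0_eq assms by blast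
  ultimately show ?thesis using p_minus_1_pos by (simp add: divide_right_mono)
qed

private lemma v0_add:
  assumes "x \<in> cyclotomic_field p" "y \<in> cyclotomic_field p"
  shows "v0 (x + y) \<ge> min (v0 x) (v0 y)"
proof (cases "x = 0 \<or> y = 0")
  case True
  thus ?thesis by (auto simp: v0_0)
next
  case False
  obtain k a b where x: "a \<in> U" "b \<in> U" "x = unif powi k * (a / b)"
    using field_decomp assms(1) False by blast
  obtain l c d where y: "c \<in> U" "d \<in> U" "y = unif powi l * (c / d)"
    using field_decomp assms(2) False by blast
  show ?thesis
  proof (cases "k \<le> l")
    case True
    thus ?thesis using v0_add_aux[OF x y] by (simp add: min.coboundedI1)
  next
    case False
    thus ?thesis using v0_add_aux[OF y x] by (simp add: min.coboundedI2 add.commute)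
  qed
qed

private lemma coprime_int_U: "\<not> int p dvd c \<Longrightarrow> of_int c \<in> U"
  unfolding U_def by (auto intro!: exI[of _ "[:c:]"])

private lemma ev_in_field: "ev f \<in> cyclotomic_field p"
proof -
  have "ev f = ev f / ev 1" by simp
  thus ?thesis unfolding cyclotomic_field_eq by blast
qed

private lemma int_in_field: "of_int a \<in> cyclotomic_field p"
  using ev_in_field[of "[:a:]"] by simp

private lemma v0_int:
  assumes "a \<noteq> 0" shows "v0 (of_int a) = ereal (real (multiplicity (int p) a))"
proof -
  have np: "\<not> is_unit (int p)" using p_ge_2 by simp
  define j where "j = multiplicity (int p) a"
  obtain c where c: "a = int p ^ j * c" "\<not> int p dvd c"
    using multiplicity_decompose'[OF assms np] by (auto simp: j_def)
  obtain t where t: "t \<in> U" "unif ^ (p - 1) = of_nat p * t" using unif_power_p by blast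
  have tn: "t \<noteq> 0" using t U_nz by auto
  have tj: "t ^ j \<in> U" by (induction j) (use U_1 U_mult t in auto)
  have "of_int a = unif powi int ((p - 1) * j) * (of_int c / t ^ j)"
    unfolding power_int_of_nat power_mult t(2) using tn by (simp add: c(1) power_mult_distrib)
  from v0_eq[OF coprime_int_U[OF c(2)] tj this]
  have "v0 (of_int a) = ereal (real ((p - 1) * j) / (real p - 1))" by simp
  also have "real ((p - 1) * j) / (real p - 1) = real j"
    using p_ge_2 by (simp add: of_nat_diff)
  finally show ?thesis by (simp add: j_def)
qed

private lemma v0_rat:
  assumes "a \<noteq> 0" "b \<noteq> 0"
  shows "v0 (of_int a / of_int b) =
           ereal (real (multiplicity (int p) a) - real (multiplicity (int p) b))"
proof -
  have "of_int a / of_int b = ev [:a:] / ev [:b:]" by simp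
  hence mem: "of_int a / of_int b \<in> cyclotomic_field p" unfolding cyclotomic_field_eq by blast
  have "v0 (of_int a / of_int b * of_int b) = v0 (of_int a / of_int b) + v0 (of_int b)"
    using mem int_in_field by (rule v0_mult)
  hence "ereal (real (multiplicity (int p) a)) =
         v0 (of_int a / of_int b) + ereal (real (multiplicity (int p) b))"
    using assms v0_int by simp
  thus ?thesis by (cases "v0 (of_int a / of_int b)") auto
qed

private lemma v0_extends: "v0 \<in> extensional (cyclotomic_field p)" "extends_padic_val p v0"
proof -
  show "v0 \<in> extensional (cyclotomic_field p)" by (simp add: v0_def)
  have "v0 (1 - zeta p) = ereal (1 / (real p - 1))"
    using v0_eq[OF U_1 U_1, of "1 - zeta p" 1] by (simp add: unif_def)
  thus "extends_padic_val p v0"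
    unfolding extends_padic_val_def
    using v0_mult v0_add v0_rat by (auto simp: v0_def)
qed

private lemma ext_unique:
  assumes v: "extends_padic_val p v" and x: "x \<in> cyclotomic_field p"
  shows "v x = v0 x"
proof -
  let ?K = "cyclotomic_field p"
  have mult: "v (x * y) = v x + v y" if "x \<in> ?K" "y \<in> ?K" for x y
    using v that by (auto simp: extends_padic_val_def)
  have add: "v (x + y) \<ge> min (v x) (v y)" if "x \<in> ?K" "y \<in> ?K" for x y
    using v that by (auto simp: extends_padic_val_def)
  have fin: "\<exists>r. v x = ereal r" if "x \<in> ?K" "x \<noteq> 0" for x
    using v that unfolding extends_padic_val_def by (cases "v x") auto
  have v_0: "v 0 = \<infinity>" using v zero_in_field by (auto simp: extends_padic_val_def)
  have int: "v (of_int a) = ereal (real (multiplicity (int p) a))" if "a \<noteq> 0" for a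
  proof -
    have "v (of_int a / of_int 1) =
            ereal (real (multiplicity (int p) a) - real (multiplicity (int p) 1))"
      using v that zero_neq_one unfolding extends_padic_val_def by metis
    thus ?thesis by simp
  qed
  have v1: "v 1 = 0" using int[of 1] by (simp add: zero_ereal_def)
  have unif: "v unif = ereal (1 / (real p - 1))"
    using v by (simp add: extends_padic_val_def unif_def)
  have zK: "zeta p ^ k \<in> ?K" for k using ev_in_field[of "monom 1 k"] by (simp add: ev_monom)
  have "v (zeta p) \<ge> 0"
  proof -
    obtain r where r: "v (zeta p) = ereal r" using fin zK[of 1] zeta_nonzero by auto
    have "v (zeta p ^ k) = ereal (real k * r)" for k
    proof (induction k)
      case 0 show ?case using v1 by (simp add: zero_ereal_def)
    next
      case (Suc k)
      thus ?case using mult[of "zeta p" "zeta p ^ k"] zK[of 1] zK[of k] r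
        by (simp add: algebra_simps)
    qed
    from this[of p] have "real p * r = 0" using v1 zeta_power by (simp add: zero_ereal_def)
    hence "r = 0" using p_ge_2 by simp
    thus ?thesis by (simp add: r)
  qed
  have ev_nonneg: "v (ev f) \<ge> 0" for f
  proof (induction f)
    case 0 show ?case using v_0 by simp
  next
    case (pCons a f)
    have "v (of_int a) \<ge> 0" using int[of a] v_0 by (cases "a = 0") auto
    moreover have "v (zeta p * ev f) \<ge> 0"
      using mult[of "zeta p" "ev f"] zK[of 1] ev_in_field pCons \<open>v (zeta p) \<ge> 0\<close> by simp
    moreover have "zeta p * ev f \<in> ?K" using ev_in_field[of "pCons 0 f"] by simp
    ultimately show ?case
      using add[OF int_in_field[of a], of "zeta p * ev f"]
      by (simp add: min_def split: if_splits)
  qed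
  have v_U: "v u = 0" if u: "u \<in> U" for u
  proof (rule ccontr)
    assume "v u \<noteq> 0"
    obtain f where f: "u = ev f" "\<not> int p dvd poly f 1" using u by (auto simp: U_def)
    with \<open>v u \<noteq> 0\<close> ev_nonneg[of f] have pos: "v u > 0" by simp
    obtain g where g: "f = [:poly f 1:] + [:-1, 1:] * g" using ev_eq_at_1 by blast
    have "ev f = of_int (poly f 1) + (zeta p - 1) * ev g"
      by (subst g) (simp add: algebra_simps)
    hence m: "of_int (poly f 1) = u + unif * ev g" by (simp add: f unif_def algebra_simps)
    have un: "unif = ev [:1, -1:]" by (simp add: unif_def)
    have "v (unif * ev g) = v unif + v (ev g)" using un ev_in_field mult by metis
    moreover have "v unif > 0" using unif p_minus_1_pos by simp
    ultimately have "v (unif * ev g) > 0"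
      using ev_nonneg[of g] by (simp add: add_pos_nonneg)
    with pos have "min (v u) (v (unif * ev g)) > 0" by simp
    moreover have "u \<in> ?K" "unif * ev g \<in> ?K"
      using ev_in_field f un by (metis, metis ev_mult)
    ultimately have "v (of_int (poly f 1)) > 0" unfolding m using add by (meson less_le_trans)
    moreover have "poly f 1 \<noteq> 0" using f(2) by auto
    ultimately have "multiplicity (int p) (poly f 1) > 0" using int by simp
    thus False using f(2) by (metis not_dvd_imp_multiplicity_0 less_irrefl)
  qed
  show ?thesis
  proof (cases "x = 0")
    case True thus ?thesis by (simp add: v_0 v0_0)
  next
    case False
    obtain k a b where k: "a \<in> U" "b \<in> U" "x = unif powi k * (a / b)"
      using field_decomp x False by blast
    have nz: "a \<noteq> 0" "b \<noteq> 0" using k U_nz by auto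
    have K: "unif powi i \<in> ?K" "a \<in> ?K" "b \<in> ?K" "a / b \<in> ?K" for i
      using powi_in_field[OF U_1 U_1, of i] powi_in_field[OF k(1) U_1, of 0]
        powi_in_field[OF k(2) U_1, of 0] powi_in_field[OF k(1,2), of 0] by auto
    have "v (a / b * b) = v (a / b) + v b" using K mult by blast
    hence ab: "v (a / b) = 0" using nz v_U k by simp
    have pow: "v (unif ^ i) = ereal (real i / (real p - 1))" for i
    proof (induction i)
      case 0 show ?case using v1 by (simp add: zero_ereal_def)
    next
      case (Suc i)
      have "unif \<in> ?K" "unif ^ i \<in> ?K" using K(1)[of 1] K(1)[of "int i"] by simp_all
      thus ?case using Suc mult[of unif "unif ^ i"] unif by (simp add: add_divide_distrib)
    qed
    have "v (unif powi k) = ereal (of_int k / (real p - 1))"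
    proof (cases "k \<ge> 0")
      case True
      thus ?thesis using pow[of "nat k"] by (simp add: power_int_def)
    next
      case neg: False
      have "v (unif powi k * unif ^ nat (- k)) = v (unif powi k) + v (unif ^ nat (- k))"
        by (rule mult[OF K(1)[of k] K(1)[of "int (nat (- k))", unfolded power_int_of_nat]])
      moreover have "unif powi k * unif ^ nat (- k) = 1"
        using neg unif_nz by (simp add: power_int_def power_inverse)
      ultimately have "v (unif powi k) + ereal (of_int (- k) / (real p - 1)) = 0"
        using v1 pow[of "nat (- k)"] neg by simp
      thus ?thesis by (cases "v (unif powi k)") (auto simp: zero_ereal_def)
    qed
    hence "v x = ereal (of_int k / (real p - 1))"
      unfolding k(3) using mult[OF K(1)[of k] K(4)] ab by simp
    thus ?thesis using v0_eq[OF k] by simp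
  qed
qed

lemma ex1_extends_padic_val:
  "\<exists>!v. v \<in> extensional (cyclotomic_field p) \<and> extends_padic_val p v"
proof (rule ex1I[of _ v0])
  show "v0 \<in> extensional (cyclotomic_field p) \<and> extends_padic_val p v0"
    using v0_extends by blast
  fix v assume "v \<in> extensional (cyclotomic_field p) \<and> extends_padic_val p v"
  thus "v = v0" using v0_extends(1) ext_unique by (blast intro: extensionalityI)
qed

lemma extends_padic_val_val_p: "extends_padic_val p (val_p p)"
  using theI'[OF ex1_extends_padic_val] unfolding val_p_def by blast

end

lemma weil_sum_in_cyclotomic_field:
  fixes a :: "'a :: finite_field"
  shows "weil_sum n d a \<in> cyclotomic_field CHAR('a)"
proof -
  define t where "t = (\<lambda>x :: 'a. THE k. k < CHAR('a) \<and> of_nat k = abs_trace n (x ^ d - a * x))"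
  define f :: "complex poly" where "f = (\<Sum>x\<in>UNIV. monom 1 (t x))"
  have "canonical_char n (x ^ d - a * x) = zeta CHAR('a) ^ t x" for x
    unfolding canonical_char_def zeta_def t_def
    by (subst exp_of_nat_mult [symmetric]) (simp add: mult_ac)
  hence "weil_sum n d a = poly f (zeta CHAR('a)) / poly 1 (zeta CHAR('a))"
    by (simp add: weil_sum_def f_def poly_sum poly_monom)
  moreover have "\<forall>i. coeff f i \<in> \<rat>"
    by (auto simp: f_def coeff_sum intro!: Rats_sum)
  moreover have "\<forall>i. coeff (1 :: complex poly) i \<in> \<rat>" by (simp add: coeff_1)
  ultimately show ?thesis unfolding cyclotomic_field_def by blast
qed

end

theory Submission
  imports Defs
begin

text \<open>
  Suppose that all \<open>W(a)\<close> have valuation greater than \<open>k / (p - 1)\<close>, where \<open>k < n * (p - 1)\<close>. Expanding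
  the product of \<open>k\<close> factors \<open>\<psi>(b\<^sub>i x\<^sup>d + c\<^sub>i x) - 1\<close> and summing over \<open>x\<close> gives a combination of Weil
  sums; dividing by \<open>(1 - \<zeta>)\<^sup>k\<close> and reducing modulo \<open>1 - \<zeta>\<close> shows that the sum over \<open>x\<close> of the products
  of the traces of \<open>b\<^sub>i x\<^sup>d + c\<^sub>i x\<close> vanishes for all \<open>b\<^sub>i\<close>, \<open>c\<^sub>i\<close>. Comparing coefficients, no sum \<open>z\<close> of \<open>k\<close>
  terms of the form \<open>p\<^sup>e\<close> or \<open>d p\<^sup>e\<close> is divisible by \<open>p\<^sup>n - 1\<close>. This is the half of Stickelberger's
  theorem that bounds the valuation from above, without Gauss sums. Sums \<open>z\<close> found for a subfield of
  degree \<open>m\<close> lift to the field on multiplying by \<open>(p\<^sup>n - 1) / (p\<^sup>m - 1)\<close>.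

  If \<open>d\<close> is nondegenerate over the prime field, a short vector in a plane lattice gives \<open>z\<close> for
  \<open>m = 1\<close>; only \<open>d \<equiv> 1 + (p - 1) / 2\<close> is left over, which needs \<open>m = 2\<close>.

  If \<open>n\<close> is a power of two, the bound is proved for a quadratic extension \<open>K\<close> of \<open>L\<close> with \<open>d \<equiv> 1\<close> modulo
  \<open>|L| - 1\<close>: without a suitable \<open>z\<close>, the \<open>|L| + 1\<close> lines \<open>tr(a x) = tr(x\<^sup>d)\<close> in the affine plane \<open>K\<close> over
  \<open>L\<close> cover the plane, which forces them to be concurrent and \<open>d\<close> to be degenerate.

  The bound \<open>2 n / 3\<close> comes from the third moment: the sum over \<open>a\<close> of \<open>W(a) W(b a) W(c a)\<close> equals
  \<open>p\<^bsup>2n\<^esup> (N - 1)\<close> for \<open>b \<noteq> 1\<close>, where \<open>N\<close> counts the \<open>v\<close> with \<open>(b v + c)\<^sup>d = 1 + v\<^sup>d\<close>. If \<open>p\<close> divides all these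
  \<open>N - 1\<close>, then \<open>x \<mapsto> x\<^sup>d\<close> is additive.
\<close>

section \<open>A plane lattice\<close>

text \<open>In the lattice of all \<open>(x, y)\<close> with \<open>N dvd d * x + y\<close>, let \<open>(a, b)\<close> be the point of the closed
  positive quadrant with the smallest \<open>a + b\<close>, and among these with the smallest \<open>a\<close>. Its two
  neighbours \<open>u\<close>, \<open>w\<close> on the boundary of the convex hull of the lattice points in the quadrant satisfy
  \<open>u + w = c * (a, b)\<close> with \<open>c \<ge> 3\<close>, whence \<open>N \<ge> (c - 2) * a * b + a + b\<close>.\<close>

lemma short_lattice_vector:
  fixes N d :: int
  assumes N: "even N" "N \<ge> 4" and cop: "coprime d N" and d1: "\<not> [d = 1] (mod N)"
    and N3: "\<not> 3 dvd N + 1"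
  shows "(\<exists>a b. a \<ge> 0 \<and> b \<ge> 0 \<and> 0 < a + b \<and> 3 * (a + b) \<le> N + 2 \<and> N dvd d * a + b) \<or>
    [d = 1 + N div 2] (mod N)"
proof (rule ccontr)
  assume contr: "\<not> ?thesis"
  define \<Lambda> where "\<Lambda> = (\<lambda>x y :: int. N dvd d * x + y)"
  have odd_d: "odd d" using cop N by (auto simp: coprime_def)
  define P where "P = (\<lambda>s. \<exists>x y. x \<ge> 0 \<and> y \<ge> 0 \<and> x + y = int s \<and> s > 0 \<and> \<Lambda> x y)"
  have long: "3 * (x + y) \<ge> N + 3" if "x \<ge> 0" "y \<ge> 0" "0 < x + y" "\<Lambda> x y" for x y
    using contr that by (force simp: \<Lambda>_def)
  \<comment> \<open>The lattice point with first coordinate 1 shows that the smallest coordinate sum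
    is below \<open>N\<close>, because \<open>d\<close> is not 1 modulo \<open>N\<close>.\<close>
  define y1 where "y1 = (- d) mod N"
  have y1: "0 \<le> y1" "y1 < N" "\<Lambda> 1 y1"
    using N by (auto simp: y1_def \<Lambda>_def) (metis ab_left_minus dvd_minus_mod minus_diff_eq
      dvd_minus_iff diff_minus_eq_add add.commute)
  have "y1 \<noteq> N - 1"
  proof
    assume "y1 = N - 1"
    hence "N dvd d - 1 + N" using y1(3) by (simp add: \<Lambda>_def add_diff_eq diff_add_eq)
    hence "N dvd d - 1" by simp
    with d1 show False by (simp add: cong_iff_dvd_diff)
  qed
  hence y1': "1 + y1 < N" using y1 by simp
  have P1: "P (nat (1 + y1))" unfolding P_def using y1 by (intro exI[of _ 1] exI[of _ y1]) auto
  define S where "S = (LEAST s. P s)"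
  have PS: "P S" unfolding S_def using P1 by (rule LeastI)
  have Smin: "int S \<le> x + y" if "x \<ge> 0" "y \<ge> 0" "0 < x + y" "\<Lambda> x y" for x y
  proof -
    have "P (nat (x + y))" unfolding P_def using that by (intro exI[of _ x] exI[of _ y]) auto
    hence "S \<le> nat (x + y)" unfolding S_def by (rule Least_le)
    thus ?thesis using that by linarith
  qed
  have SN: "int S < N" using Smin[of 1 y1] y1 y1' by linarith
  define A where "A = (\<lambda>k. \<Lambda> (int k) (int S - int k) \<and> int k \<le> int S)"
  have "\<exists>k. A k" using PS unfolding P_def A_def
    by (metis add_diff_cancel_left' le_add_same_cancel1 nonneg_int_cases)
  define a0 where "a0 = (LEAST k. A k)"
  have Aa: "A a0" unfolding a0_def using \<open>\<exists>k. A k\<close> by (rule LeastI_ex)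
  define a where "a = int a0"
  define b where "b = int S - a"
  have v: "\<Lambda> a b" "a \<ge> 0" "b \<ge> 0" "a + b = int S" "S > 0"
    using Aa PS unfolding A_def a_def b_def P_def by auto
  have amin: "a \<le> x" if "x \<ge> 0" "y \<ge> 0" "x + y = int S" "\<Lambda> x y" for x y
  proof -
    have "A (nat x)" using that unfolding A_def by (auto simp flip: that(3))
    thus ?thesis unfolding a_def a0_def using that Least_le[of A "nat x"] by linarith
  qed
  have zero1: "N \<le> x" if "\<Lambda> x 0" "x > 0" for x
  proof -
    have "N dvd x * d" using that by (simp add: \<Lambda>_def mult.commute)
    hence "N dvd x" using cop by (simp add: coprime_dvd_mult_left_iff coprime_commute)
    thus ?thesis using that zdvd_imp_le by blast
  qed
  have zero2: "N \<le> y" if "\<Lambda> 0 y" "y > 0" for y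
    using that zdvd_imp_le by (simp add: \<Lambda>_def)
  have a1: "a \<ge> 1" using zero2[of b] v SN by (cases "a = 0") auto
  have b1: "b \<ge> 1" using zero1[of a] v SN by (cases "b = 0") auto
  have lin: "\<Lambda> (k * x - l * x') (k * y - l * y')" if "\<Lambda> x y" "\<Lambda> x' y'" for k l x y x' y'
  proof -
    have "d * (k * x - l * x') + (k * y - l * y') = k * (d * x + y) - l * (d * x' + y')"
      by (simp add: algebra_simps)
    thus ?thesis using that unfolding \<Lambda>_def by (metis dvd_diff dvd_mult)
  qed
  obtain b' where b': "d * a + b = N * b'" using v(1) unfolding \<Lambda>_def by (auto elim: dvdE)
  \<comment> \<open>A common factor of \<open>a\<close> and \<open>b'\<close> also divides
    \<open>b\<close>; cancelling it would give a lattice point with smaller coordinate sum.\<close>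
  have cop_ab: "coprime a b'"
  proof -
    define g where "g = gcd a b'"
    have g0: "g > 0" using a1 by (simp add: g_def)
    obtain a1' b1' where ab: "a = g * a1'" "b' = g * b1'" unfolding g_def
      by (metis dvdE gcd_dvd1 gcd_dvd2)
    define y where "y = N * b1' - d * a1'"
    have bgy: "b = g * y" using b' unfolding ab y_def by (simp add: algebra_simps)
    have "a1' > 0" using ab a1 g0 by (smt (verit) zero_less_mult_pos)
    moreover have "y > 0" using bgy b1 g0 by (smt (verit) zero_less_mult_pos)
    moreover have "\<Lambda> a1' y" by (simp add: \<Lambda>_def y_def)
    ultimately have "int S \<le> a1' + y" using Smin[of a1' y] by simp
    moreover have "int S = g * (a1' + y)" using v ab bgy by (simp add: algebra_simps)
    ultimately have "g * (a1' + y) \<le> 1 * (a1' + y)" by simp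
    hence "g \<le> 1" using \<open>a1' > 0\<close> \<open>y > 0\<close> by (simp add: mult_le_cancel_right)
    hence "g = 1" using g0 by simp
    thus ?thesis by (simp add: g_def coprime_iff_gcd_eq_1)
  qed
  \<comment> \<open>Bezout completes \<open>(a, b)\<close> to a lattice basis: the vector
    \<open>w = (w1, w2)\<close> has determinant \<open>N\<close> with it, and \<open>w1\<close> is
    reduced modulo \<open>a\<close>.\<close>
  obtain x0 where x0: "[b' * x0 = 1] (mod a)"
    using cong_solve_coprime_int[of b' a] cop_ab by (auto simp: coprime_commute)
  define w1 where "w1 = (- x0) mod a"
  have w1: "0 \<le> w1" "w1 \<le> a - 1" using a1 by (auto simp: w1_def)
  have "[b' * w1 = - 1] (mod a)"
  proof -
    have "[b' * w1 = b' * (- x0)] (mod a)" unfolding w1_def by (simp add: cong_def mod_mult_right_eq)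
    also have "[b' * (- x0) = - 1] (mod a)" using x0 by (simp add: cong_minus_minus_iff)
    finally show ?thesis .
  qed
  hence "a dvd b' * w1 + 1" by (simp add: cong_iff_dvd_diff)
  then obtain w' where w': "b' * w1 + 1 = a * w'" by (auto elim: dvdE)
  define w2 where "w2 = N * w' - d * w1"
  have w\<Lambda>: "\<Lambda> w1 w2" by (simp add: \<Lambda>_def w2_def)
  have det: "a * w2 - b * w1 = N"
  proof -
    have "a * w2 - b * w1 = N * (a * w') - (d * a + b) * w1" by (simp add: w2_def algebra_simps)
    also have "\<dots> = N * (a * w' - b' * w1)" unfolding b' by (simp add: algebra_simps)
    also have "\<dots> = N" by (simp flip: w')
    finally show ?thesis .
  qed
  have w2: "w2 > 0"
  proof -
    have "b * w1 \<ge> 0" using b1 w1 by simp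
    hence "a * w2 > 0" using det N by linarith
    thus ?thesis using a1 by (simp add: zero_less_mult_iff)
  qed
  have wS: "w1 + w2 \<ge> int S + 1"
  proof -
    have "int S \<le> w1 + w2" using Smin[of w1 w2] w1 w2 w\<Lambda> by simp
    \<comment> \<open>Equality would contradict the minimality of \<open>a\<close>, because
      \<open>w1 < a\<close>.\<close>
    moreover have "w1 + w2 \<noteq> int S" using amin[of w1 w2] w1 w2 w\<Lambda> by auto
    ultimately show ?thesis by simp
  qed
  \<comment> \<open>\<open>c\<close> is \<open>w2 / b\<close> rounded up, so that
    \<open>u = c * (a, b) - w\<close> has its second coordinate between 0 and
    \<open>b - 1\<close>.\<close>
  define c where "c = - ((- w2) div b)"
  define u2 where "u2 = (- w2) mod b"
  have u2: "0 \<le> u2" "u2 \<le> b - 1" "u2 = c * b - w2"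
    using b1 minus_mult_div_eq_mod[of "- w2" b] pos_mod_bound[of b "- w2"]
    by (simp_all add: u2_def c_def mult.commute)
  define u1 where "u1 = c * a - w1"
  have u\<Lambda>: "\<Lambda> u1 u2" using lin[OF v(1) w\<Lambda>, of c 1] by (simp add: u1_def u2(3))
  have det': "u1 * b - a * u2 = N" using det by (simp add: u1_def u2(3) algebra_simps)
  have u1: "u1 > 0"
  proof -
    have "a * u2 \<ge> 0" using a1 u2 by simp
    hence "u1 * b > 0" using det' N by linarith
    thus ?thesis using b1 by (simp add: zero_less_mult_iff)
  qed
  have uS: "u1 + u2 \<ge> int S" using Smin[of u1 u2] u1 u2 u\<Lambda> by simp
  have "c * int S = (u1 + u2) + (w1 + w2)" by (simp add: u1_def u2(3) flip: v(4)) (simp add: algebra_simps)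
  hence "c * int S > 2 * int S" using uS wS by linarith
  hence c3: "c \<ge> 3" using v(5) by (simp add: mult_less_cancel_right)
  define t where "t = a * b"
  have tS: "t \<ge> a + b - 1"
  proof -
    have "(a - 1) * (b - 1) \<ge> 0" using a1 b1 by simp
    thus ?thesis by (simp add: t_def algebra_simps)
  qed
  have Nge: "N \<ge> (c - 2) * t + a + b"
  proof -
    have "N = c * t - a * u2 - b * w1" using det unfolding t_def by (simp add: u2(3) algebra_simps)
    moreover have "a * u2 \<le> a * (b - 1)" using u2 a1 by (intro mult_left_mono) auto
    moreover have "b * w1 \<le> b * (a - 1)" using w1 b1 by (intro mult_left_mono) auto
    ultimately show ?thesis by (simp add: t_def algebra_simps)
  qed
  have Nle: "N \<le> 3 * (a + b) - 3" using long[of a b] v by simp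
  have ev: "even (a + b)"
  proof -
    have "even (d * a + b)" using v(1) N unfolding \<Lambda>_def using dvd_trans by blast
    thus ?thesis using odd_d by simp
  qed
  have c: "c = 3"
  proof (rule ccontr)
    assume "c \<noteq> 3"
    hence "c - 2 \<ge> 2" using c3 by simp
    hence "(c - 2) * t \<ge> 2 * t" using tS a1 b1 by (intro mult_right_mono) auto
    hence "2 * t + (a + b) \<le> (c - 2) * t + (a + b)" by simp
    also have "\<dots> \<le> N" using Nge by simp
    finally show False using Nle tS by presburger
  qed
  have Nt: "N \<ge> t + a + b" using Nge by (simp add: c)
  have u2c: "u2 = 3 * b - w2" and u1c: "u1 = 3 * a - w1" using u2(3) u1_def by (simp_all add: c)
  \<comment> \<open>The bounds \<open>t + a + b \<le> N \<le> 3 * (a + b) - 3\<close> leave few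
    shapes: \<open>a = 1\<close> yields the exceptional \<open>d\<close>, a coordinate 2 forces
    \<open>3 dvd N + 1\<close>, and the others make \<open>N\<close> odd.\<close>
  consider "a = 1" | "a \<ge> 2" "b = 1" | "a = 2" "b \<ge> 2" | "a \<ge> 3" "b = 2" | "a \<ge> 3" "b \<ge> 3"
    using a1 b1 by linarith
  thus False
  proof cases
    case 1
    have "w1 = 0" using w1 1 by simp
    hence "w2 = N" using det 1 by simp
    hence "2 * b + 2 \<ge> N" using uS u1c u2c \<open>w1 = 0\<close> 1 v(4) by simp
    moreover have "N \<ge> 2 * b + 1" using Nt by (simp add: t_def 1)
    ultimately have Nb: "N = 2 * b + 2" using N(1) by presburger
    have "N dvd d + b" using v(1) by (simp add: \<Lambda>_def 1)
    hence "N dvd d + b - N" by simp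
    moreover have "d + b - N = d - (1 + N div 2)" using Nb by simp
    ultimately show False using contr by (simp add: cong_iff_dvd_diff)
  next
    case 2
    have "u2 = 0" using u2 2 by simp
    hence "u1 = N" "w2 = 3" using det' 2 u2c by simp_all
    hence "2 * a + 1 \<ge> N" using wS u1c v(4) 2 by simp
    moreover have "N \<ge> 2 * a + 1" using Nt by (simp add: t_def 2)
    ultimately show False using N(1) by presburger
  next
    case 3
    have "w1 \<noteq> 0"
    proof
      assume "w1 = 0"
      hence "N \<le> w2" "2 * w2 = N" using zero2[of w2] w\<Lambda> w2 det 3 by simp_all
      thus False using w2 by simp
    qed
    hence "w1 = 1" using w1 3 by simp
    hence "N = 2 * w2 - b" using det 3 by simp
    moreover have "w2 \<ge> 2 * b + 1" using u2 u2c by simp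
    ultimately have "N = 3 * b + 2" using Nle N(1) 3 by presburger
    hence "N + 1 = 3 * (b + 1)" by simp
    thus False using N3 by simp
  next
    case 4
    have "u2 \<noteq> 0"
    proof
      assume "u2 = 0"
      hence "N \<le> u1" "2 * u1 = N" using zero1[of u1] u\<Lambda> u1 det' 4 by simp_all
      thus False using u1 by simp
    qed
    hence "u2 = 1" using u2 4 by simp
    hence "N = 2 * u1 - a" using det' 4 by simp
    moreover have "u1 \<ge> 2 * a + 1" using w1 u1c by simp
    ultimately have "N = 3 * a + 2" using Nle N(1) 4 by presburger
    hence "N + 1 = 3 * (a + 1)" by simp
    thus False using N3 by simp
  next
    case 5
    have "t \<le> 2 * a + 2 * b - 3" using Nt Nle by presburger
    hence le1: "(a - 2) * (b - 2) \<le> 1" by (simp add: t_def algebra_simps)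
    have "(a - 2) * 1 \<le> (a - 2) * (b - 2)" "1 * (b - 2) \<le> (a - 2) * (b - 2)"
      using 5 by (intro mult_left_mono mult_right_mono; simp)+
    hence "a = 3" "b = 3" using le1 5 by presburger+
    thus False using Nt Nle N(1) by (simp add: t_def)
  qed
qed

section \<open>Integers of the cyclotomic field\<close>

text \<open>This is the ring \<open>Z[zeta p]\<close>; generating it inductively makes
  \<open>val_p_nonneg\<close> an induction on its elements.\<close>

inductive_set cyc_int :: "nat \<Rightarrow> complex set" for p where
  one: "1 \<in> cyc_int p"
| zeta: "zeta p \<in> cyc_int p"
| uminus: "x \<in> cyc_int p \<Longrightarrow> - x \<in> cyc_int p"
| add: "x \<in> cyc_int p \<Longrightarrow> y \<in> cyc_int p \<Longrightarrow> x + y \<in> cyc_int p"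
| mult: "x \<in> cyc_int p \<Longrightarrow> y \<in> cyc_int p \<Longrightarrow> x * y \<in> cyc_int p"

lemma cyc_int_zero: "0 \<in> cyc_int p"
  using cyc_int.add[OF cyc_int.one cyc_int.uminus[OF cyc_int.one]] by simp

lemma cyc_int_diff: "x \<in> cyc_int p \<Longrightarrow> y \<in> cyc_int p \<Longrightarrow> x - y \<in> cyc_int p"
  using cyc_int.add[of x p "- y"] cyc_int.uminus[of y p] by simp

lemma cyc_int_power: "x \<in> cyc_int p \<Longrightarrow> x ^ k \<in> cyc_int p"
  by (induction k) (auto intro: cyc_int.intros)

lemma cyc_int_sum: "(\<And>i. i \<in> A \<Longrightarrow> f i \<in> cyc_int p) \<Longrightarrow> sum f A \<in> cyc_int p"
  by (induction A rule: infinite_finite_induct) (auto intro: cyc_int.intros cyc_int_zero)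

lemma cyc_int_of_nat: "of_nat k \<in> cyc_int p"
  by (induction k) (auto intro: cyc_int.intros cyc_int_zero)

lemma cyc_int_of_int: "of_int k \<in> cyc_int p"
  by (cases k rule: int_cases2) (auto intro: cyc_int_of_nat cyc_int.intros)

lemma cyc_int_subset_cyclotomic_field: "cyc_int p \<subseteq> cyclotomic_field p"
proof
  fix x assume "x \<in> cyc_int p"
  hence "\<exists>f. x = poly f (zeta p) \<and> (\<forall>i. coeff f i \<in> \<rat>)"
  proof induction
    case one
    show ?case by (intro exI[of _ 1]) (auto simp: coeff_1)
  next
    case zeta
    show ?case by (intro exI[of _ "[:0, 1:]"]) (auto simp: coeff_pCons split: nat.splits)
  next
    case (uminus x)
    then obtain f where "x = poly f (zeta p)" "\<forall>i. coeff f i \<in> \<rat>" by blast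
    thus ?case by (intro exI[of _ "- f"]) auto
  next
    case (add x y)
    then obtain f g where "x = poly f (zeta p)" "\<forall>i. coeff f i \<in> \<rat>"
      "y = poly g (zeta p)" "\<forall>i. coeff g i \<in> \<rat>" by blast
    thus ?case by (intro exI[of _ "f + g"]) auto
  next
    case (mult x y)
    then obtain f g where "x = poly f (zeta p)" "\<forall>i. coeff f i \<in> \<rat>"
      "y = poly g (zeta p)" "\<forall>i. coeff g i \<in> \<rat>" by blast
    thus ?case by (intro exI[of _ "f * g"]) (auto simp: coeff_mult intro!: Rats_sum Rats_mult)
  qed
  then obtain f where f: "x = poly f (zeta p)" "\<forall>i. coeff f i \<in> \<rat>" by blast
  have "\<forall>i. coeff (1 :: complex poly) i \<in> \<rat>" by (simp add: coeff_1)
  thus "x \<in> cyclotomic_field p" unfolding cyclotomic_field_def using f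
    by (intro CollectI exI[of _ f] exI[of _ 1]) auto
qed

context
  fixes p :: nat
  assumes p: "prime p"
begin

lemma val_p_zero: "val_p p 0 = \<infinity>"
  using extends_padic_val_val_p[OF p] cyc_int_zero cyc_int_subset_cyclotomic_field
  unfolding extends_padic_val_def by blast

lemma val_p_mult:
  "x \<in> cyc_int p \<Longrightarrow> y \<in> cyc_int p \<Longrightarrow> val_p p (x * y) = val_p p x + val_p p y"
  using extends_padic_val_val_p[OF p] cyc_int_subset_cyclotomic_field
  unfolding extends_padic_val_def by blast

lemma val_p_add:
  "x \<in> cyc_int p \<Longrightarrow> y \<in> cyc_int p \<Longrightarrow> val_p p (x + y) \<ge> min (val_p p x) (val_p p y)"
  using extends_padic_val_val_p[OF p] cyc_int_subset_cyclotomic_field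
  unfolding extends_padic_val_def by blast

lemma val_p_of_int:
  assumes "c \<noteq> 0" shows "val_p p (of_int c) = ereal (real (multiplicity (int p) c))"
proof -
  have "val_p p (of_int c / of_int 1) =
          ereal (real (multiplicity (int p) c) - real (multiplicity (int p) 1))"
    using extends_padic_val_val_p[OF p] assms unfolding extends_padic_val_def
    by (metis zero_neq_one)
  thus ?thesis by simp
qed

lemma val_p_of_int_pos_iff: "val_p p (of_int c) > 0 \<longleftrightarrow> int p dvd c"
proof (cases "c = 0")
  case False
  have "prime (int p)" using p by simp
  hence "multiplicity (int p) c > 0 \<longleftrightarrow> int p dvd c"
    using False by (simp add: prime_multiplicity_gt_zero_iff prime_imp_prime_elem)
  thus ?thesis using False by (simp add: val_p_of_int)
qed (use val_p_zero in simp)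

lemma val_p_one: "val_p p 1 = 0"
  using val_p_of_int[of 1] by (simp add: zero_ereal_def)

lemma val_p_uminus:
  assumes "x \<in> cyc_int p" shows "val_p p (- x) = val_p p x"
proof -
  have "val_p p (-1) = 0" using val_p_of_int[of "-1"] by (simp add: zero_ereal_def)
  thus ?thesis using val_p_mult[OF cyc_int.uminus[OF cyc_int.one] assms] by simp
qed

lemma val_p_unif: "val_p p (1 - zeta p) = ereal (1 / (real p - 1))"
  using extends_padic_val_val_p[OF p] unfolding extends_padic_val_def by blast

lemma val_p_unif_power: "val_p p ((1 - zeta p) ^ k) = ereal (real k / (real p - 1))"
proof (induction k)
  case (Suc k)
  have u: "1 - zeta p \<in> cyc_int p" by (intro cyc_int_diff cyc_int.intros)
  show ?case using val_p_mult[OF u cyc_int_power[OF u, of k]] Suc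
    by (simp add: val_p_unif add_divide_distrib)
qed (simp add: val_p_one)

text \<open>The generator \<open>zeta p\<close> is handled as \<open>1 - (1 - zeta p)\<close>, with
  summands of valuation 0 and \<open>1 / (p - 1)\<close>.\<close>

lemma val_p_nonneg: "x \<in> cyc_int p \<Longrightarrow> val_p p x \<ge> 0"
proof (induction rule: cyc_int.induct)
  case zeta
  have p1: "real p - 1 > 0" using prime_gt_1_nat[OF p] by simp
  have "1 - zeta p \<in> cyc_int p" by (intro cyc_int_diff cyc_int.intros)
  hence "val_p p (- (1 - zeta p)) = ereal (1 / (real p - 1))"
    by (simp only: val_p_uminus val_p_unif)
  moreover have "val_p p (1 + - (1 - zeta p)) \<ge> min (val_p p 1) (val_p p (- (1 - zeta p)))"
    using \<open>1 - zeta p \<in> cyc_int p\<close> by (intro val_p_add cyc_int.intros)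
  ultimately show ?case using p1 by (simp add: val_p_one min_def split: if_splits)
next
  case (add x y)
  thus ?case using val_p_add[of x y] by (meson min.boundedI order_trans)
qed (auto simp: val_p_one val_p_uminus val_p_mult)

lemma val_p_add_gt:
  assumes "x \<in> cyc_int p" "y \<in> cyc_int p" "val_p p x > k" "val_p p y > k"
  shows "val_p p (x + y) > k"
  using val_p_add[OF assms(1,2)] assms(3,4) by (meson min_less_iff_conj less_le_trans)

lemma val_p_diff_gt:
  assumes "x \<in> cyc_int p" "y \<in> cyc_int p" "val_p p x > k" "val_p p y > k"
  shows "val_p p (x - y) > k"
  using val_p_add_gt[OF assms(1) cyc_int.uminus[OF assms(2)]] assms val_p_uminus by simp

lemma val_p_sum_gt:
  assumes "\<And>i. i \<in> A \<Longrightarrow> f i \<in> cyc_int p" "\<And>i. i \<in> A \<Longrightarrow> val_p p (f i) > k" "k < \<infinity>"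
  shows "val_p p (sum f A) > k"
  using assms(1,2)
proof (induction A rule: infinite_finite_induct)
  case (insert i A)
  thus ?case by (auto intro!: val_p_add_gt cyc_int_sum)
qed (use val_p_zero assms(3) in auto)

section \<open>Congruences modulo \<open>1 - zeta p\<close>\<close>

definition cyc_residue :: "complex \<Rightarrow> int \<Rightarrow> bool" where
  "cyc_residue x c \<longleftrightarrow> (\<exists>w\<in>cyc_int p. x = of_int c + (1 - zeta p) * w)"

lemma cyc_residue_imp_cyc_int: "cyc_residue x c \<Longrightarrow> x \<in> cyc_int p"
  unfolding cyc_residue_def by (auto intro!: cyc_int.intros cyc_int_of_int cyc_int_diff)

lemma cyc_residue_of_int: "cyc_residue (of_int c) c"
  unfolding cyc_residue_def using cyc_int_zero by (intro bexI[of _ 0]) auto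

lemma cyc_residue_add:
  assumes "cyc_residue x c" "cyc_residue y e" shows "cyc_residue (x + y) (c + e)"
proof -
  obtain w z where "w \<in> cyc_int p" "x = of_int c + (1 - zeta p) * w"
    "z \<in> cyc_int p" "y = of_int e + (1 - zeta p) * z"
    using assms by (auto simp: cyc_residue_def)
  thus ?thesis unfolding cyc_residue_def
    by (intro bexI[of _ "w + z"] cyc_int.add) (simp_all add: distrib_left)
qed

lemma cyc_residue_mult:
  assumes "cyc_residue x c" "cyc_residue y e" shows "cyc_residue (x * y) (c * e)"
proof -
  obtain w z where w: "w \<in> cyc_int p" "x = of_int c + (1 - zeta p) * w"
    and z: "z \<in> cyc_int p" "y = of_int e + (1 - zeta p) * z"
    using assms by (auto simp: cyc_residue_def)
  let ?u = "w * y + of_int c * z"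
  have "?u \<in> cyc_int p"
    using w z cyc_residue_imp_cyc_int[OF assms(2)] by (auto intro!: cyc_int.intros cyc_int_of_int)
  moreover have "x * y = of_int (c * e) + (1 - zeta p) * ?u"
    unfolding w(2) by (simp add: z(2) algebra_simps)
  ultimately show ?thesis unfolding cyc_residue_def by blast
qed

lemma cyc_residue_sum: "(\<And>i. i \<in> A \<Longrightarrow> cyc_residue (f i) (g i)) \<Longrightarrow> cyc_residue (sum f A) (sum g A)"
proof (induction A rule: infinite_finite_induct)
  case (insert i A)
  thus ?case by (auto intro: cyc_residue_add)
qed (use cyc_residue_of_int[of 0] in auto)

lemma cyc_residue_prod_list:
  "(\<And>i. i \<in> set L \<Longrightarrow> cyc_residue (f i) (g i)) \<Longrightarrow>
    cyc_residue (prod_list (map f L)) (prod_list (map g L))"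
  by (induction L) (use cyc_residue_of_int[of 1] in \<open>auto intro: cyc_residue_mult\<close>)

text \<open>The integer \<open>c\<close> is then a difference of two elements of positive
  valuation.\<close>

lemma cyc_residue_pos_val:
  assumes "cyc_residue x c" "val_p p x > 0" shows "int p dvd c"
proof -
  obtain w where w: "w \<in> cyc_int p" "x = of_int c + (1 - zeta p) * w"
    using assms by (auto simp: cyc_residue_def)
  have u: "1 - zeta p \<in> cyc_int p" by (intro cyc_int_diff cyc_int.intros)
  have "val_p p (1 - zeta p) > 0" using val_p_unif prime_gt_1_nat[OF p] by simp
  hence "val_p p ((1 - zeta p) * w) > 0"
    using u w val_p_nonneg[OF w(1)] by (simp add: val_p_mult add_pos_nonneg)
  hence "val_p p (x - (1 - zeta p) * w) > 0"
    using assms u w cyc_residue_imp_cyc_int by (intro val_p_diff_gt cyc_int.mult)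
  thus ?thesis using val_p_of_int_pos_iff w(2) by simp
qed

text \<open>The quotient is minus a sum of \<open>t\<close> powers of \<open>zeta p\<close>, each of
  them 1 modulo \<open>1 - zeta p\<close>.\<close>

lemma zeta_power_minus_one:
  "\<exists>u. cyc_residue u (- int t) \<and> zeta p ^ t - 1 = (1 - zeta p) * u"
proof (induction t)
  case 0
  show ?case using cyc_residue_of_int[of 0] by (intro exI[of _ 0]) auto
next
  case (Suc t)
  then obtain u where u: "cyc_residue u (- int t)" "zeta p ^ t - 1 = (1 - zeta p) * u" by blast
  have "cyc_residue (zeta p) 1"
    unfolding cyc_residue_def by (intro bexI[of _ "-1"]) (auto intro: cyc_int.intros)
  hence "cyc_residue (zeta p * u + of_int (- 1)) (1 * (- int t) + (- 1))"
    (is "cyc_residue ?u ?c") by (intro cyc_residue_add cyc_residue_mult u cyc_residue_of_int)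
  also have "?c = - int (Suc t)" by simp
  finally have "cyc_residue ?u (- int (Suc t))" .
  moreover have "zeta p ^ Suc t - 1 = zeta p * (zeta p ^ t - 1) - (1 - zeta p)"
    by (simp add: algebra_simps)
  hence "zeta p ^ Suc t - 1 = (1 - zeta p) * (zeta p * u + of_int (- 1))"
    by (simp add: u(2) algebra_simps)
  ultimately show ?case by blast
qed
end

section \<open>Finite fields and the canonical character\<close>

lemma power_minus_one_dvd:
  fixes a :: nat shows "a - 1 dvd a ^ r - 1"
proof (cases "a = 0")
  case False
  thus ?thesis
  proof (induction r)
    case (Suc r)
    have "a ^ Suc r - 1 = a * (a ^ r - 1) + (a - 1)"
      using Suc.prems by (simp add: diff_mult_distrib2)
    thus ?case using Suc by (metis dvd_add dvd_mult dvd_refl)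
  qed simp
qed (cases r; simp)

lemma power_cong_order:
  fixes z :: "'b :: monoid_mult"
  assumes "z ^ N = 1" "[a = b] (mod N)" shows "z ^ a = z ^ b"
proof -
  have "z ^ i = z ^ (i mod N)" for i
  proof -
    have "z ^ i = z ^ (N * (i div N) + i mod N)" by simp
    thus ?thesis unfolding power_add power_mult assms(1) by simp
  qed
  thus ?thesis using assms(2) by (metis cong_def)
qed

lemma card_power_eq_le:
  fixes c :: "'a :: idom"
  assumes "k > 0" shows "card {x. x ^ k = c} \<le> k"
proof -
  let ?f = "monom 1 k - [:c:]"
  have "coeff ?f k = 1" using assms by (auto simp: coeff_pCons split: nat.splits)
  hence nz: "?f \<noteq> 0" by (metis coeff_0 one_neq_zero)
  have "{x. x ^ k = c} = {x. poly ?f x = 0}" by (auto simp: poly_monom)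
  also have "card \<dots> \<le> degree ?f" by (rule card_poly_roots_bound[OF nz])
  also have "\<dots> \<le> k" by (intro degree_diff_le) (auto simp: degree_monom_le)
  finally show ?thesis .
qed

lemma finite_field_power_card_minus_one:
  fixes x :: "'a :: finite_field"
  assumes "x \<noteq> 0" shows "x ^ (CARD('a) - 1) = 1"
proof -
  have "x ^ (CARD('a) - 1) * x = 1 * x"
    using finite_field_power_card_eq_same[of x] finite_UNIV_card_ge_0[where 'a = 'a]
    by (simp flip: power_Suc2)
  thus ?thesis using assms by simp
qed

lemma freshmans_dream_power:
  fixes x y :: "'a :: comm_ring_1"
  assumes "prime CHAR('a)"
  shows "(x + y) ^ (CHAR('a) ^ k) = x ^ (CHAR('a) ^ k) + y ^ (CHAR('a) ^ k)"
  by (induction k) (simp_all add: power_mult freshmans_dream[OF assms refl] power_Suc2 del: power_Suc)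

text \<open>The exponent is a parameter, so that the locale can be entered again with a twisted
  exponent \<open>d * p ^ x\<close>.\<close>

locale weil_field =
  fixes ty :: "'a :: finite_field itself" and p n d :: nat
  assumes char: "CHAR('a) = p"
    and card_field: "CARD('a) = p ^ n"
    and d_pos: "d > 0"
    and coprime_d: "coprime d (p ^ n - 1)"
begin

definition subfield_of_degree :: "nat \<Rightarrow> 'a set" where
  "subfield_of_degree m = {x. x ^ (p ^ m) = x}"

lemma p_prime: "prime p"
  using CHAR_prime[where 'a = 'a] by (simp add: char)

lemma p_ge_2: "p \<ge> 2"
  using p_prime by (rule prime_ge_2_nat)

lemma frobenius_add: "(x + y :: 'a) ^ (p ^ k) = x ^ (p ^ k) + y ^ (p ^ k)"
  using freshmans_dream_power[of x y k] p_prime by (simp add: char)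

lemma n_pos: "n > 0"
proof (rule ccontr)
  assume "\<not> n > 0"
  hence "CARD('a) = 1" using card_field by simp
  thus False by (metis card_1_singletonE UNIV_I singletonD zero_neq_one)
qed

lemma power_p_gt_1: "m > 0 \<Longrightarrow> p ^ m > 1"
  using p_ge_2 by (intro one_less_power) auto

lemma frobenius_diff: "(x - y :: 'a) ^ (p ^ k) = x ^ (p ^ k) - y ^ (p ^ k)"
  using frobenius_add[of "x - y" y k] by (simp add: algebra_simps)

lemma frobenius_period: "(x :: 'a) ^ (p ^ (n * k)) = x"
  using finite_field_power_card_power_eq_same[OF refl, of x k] by (simp add: card_field power_mult)

lemma inj_frobenius: "(x :: 'a) ^ (p ^ k) = y ^ (p ^ k) \<Longrightarrow> x = y"
  using frobenius_diff[of x y k] by simp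

text \<open>A quotient \<open>z\<close> of two nonzero points with equal images has
  \<open>z ^ d = 1\<close> and \<open>z ^ (p ^ n - 1) = 1\<close> with coprime exponents.\<close>

lemma bij_power_d: "bij (\<lambda>x :: 'a. x ^ d)"
proof -
  have "x = y" if xy: "x ^ d = y ^ d" for x y :: 'a
  proof (cases "y = 0")
    case True
    thus ?thesis using xy d_pos by (simp add: power_0_left)
  next
    case False
    hence x0: "x \<noteq> 0" using xy d_pos by (metis power_eq_0_iff)
    define z where "z = x / y"
    have z0: "z \<noteq> 0" using False x0 by (simp add: z_def)
    have z1: "z ^ d = 1" using xy False by (simp add: z_def power_divide)
    have z2: "z ^ (p ^ n - 1) = 1"
      using finite_field_power_card_minus_one[OF z0] by (simp add: card_field)
    obtain i where "[d * i = 1] (mod (p ^ n - 1))"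
      using cong_solve_coprime_nat[OF coprime_d] by auto
    hence "z ^ (d * i) = z ^ 1" by (rule power_cong_order[OF z2])
    hence "z = 1" using z1 by (simp add: power_mult)
    thus ?thesis using False by (simp add: z_def)
  qed
  thus ?thesis by (intro finite_UNIV_inj_surj[THEN bijI[rotated]] injI) (auto intro: injI)
qed

lemma minus_power_d: "(- x :: 'a) ^ d = - (x ^ d)"
proof (cases "p = 2")
  case True
  have "- y = y" for y :: 'a using True by (intro uminus_CHAR_2) (simp add: char)
  thus ?thesis by metis
next
  case False
  hence "odd p" using p_prime p_ge_2 by (metis prime_odd_nat le_neq_implies_less)
  hence "even (p ^ n - 1)" by simp
  hence "odd d" using coprime_d by (auto simp: coprime_def)
  thus ?thesis by (rule power_minus_odd)
qed

lemma card_subfield_of_degree: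
  assumes "m > 0" "m dvd n"
  shows "card (subfield_of_degree m :: 'a set) = p ^ m"
proof (rule antisym)
  let ?K = "subfield_of_degree m :: 'a set" and ?Q = "p ^ m"
  have Q: "?Q > 1" using assms by (intro power_p_gt_1)
  let ?f = "monom 1 ?Q - [:0, 1:] :: 'a poly"
  have "coeff ?f ?Q = 1" using Q assms(1) by (auto simp: coeff_pCons split: nat.splits)
  hence nz: "?f \<noteq> 0" by (metis coeff_0 one_neq_zero)
  have "?K = {x. poly ?f x = 0}" by (auto simp: poly_monom subfield_of_degree_def)
  also have "card \<dots> \<le> degree ?f" by (rule card_poly_roots_bound[OF nz])
  also have "\<dots> \<le> ?Q" using Q by (intro degree_diff_le degree_monom_le) (simp del: power_strict_increasing_iff)
  finally show "card ?K \<le> ?Q" .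
  obtain r where r: "n = m * r" using assms by auto
  hence "?Q - 1 dvd p ^ n - 1" using power_minus_one_dvd[of ?Q r] by (simp add: power_mult)
  then obtain k where k: "p ^ n - 1 = (?Q - 1) * k" by (auto elim: dvdE)
  have k0: "k > 0" using k power_p_gt_1[OF n_pos] by (cases k) auto
  \<comment> \<open>For the lower bound: raising to the power \<open>k\<close> maps the nonzero
    elements into \<open>?K - {0}\<close>, with fibres of size at most \<open>k\<close>.\<close>
  have "x ^ k \<in> ?K - {0}" if "x \<noteq> 0" for x :: 'a
  proof -
    have "(x ^ k) ^ (?Q - 1) = 1"
      using finite_field_power_card_minus_one[OF that] k
      by (simp add: card_field mult.commute flip: power_mult)
    moreover have "(x ^ k) ^ ?Q = (x ^ k) ^ (?Q - 1) * x ^ k" 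
      using Q by (intro power_minus_mult[symmetric]) linarith
    ultimately show ?thesis using that by (simp add: subfield_of_degree_def)
  qed
  hence "UNIV - {0 :: 'a} \<subseteq> (\<Union>c\<in>?K - {0}. {x. x ^ k = c})" by blast
  hence "card (UNIV - {0 :: 'a}) \<le> card (\<Union>c\<in>?K - {0}. {x :: 'a. x ^ k = c})"
    by (intro card_mono) auto
  also have "\<dots> \<le> (\<Sum>c\<in>?K - {0}. card {x :: 'a. x ^ k = c})" by (intro card_UN_le) auto
  also have "\<dots> \<le> (\<Sum>c\<in>?K - {0}. k)" by (intro sum_mono card_power_eq_le k0)
  also have "\<dots> = card (?K - {0}) * k" by simp
  finally have "(?Q - 1) * k \<le> card (?K - {0}) * k" using k by (simp add: card_field)
  hence "?Q - 1 \<le> card (?K - {0})" using k0 by simp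
  also have "0 \<in> ?K" using p_ge_2 by (simp add: subfield_of_degree_def)
  hence "card (?K - {0}) = card ?K - 1" by simp
  finally show "?Q \<le> card ?K" using Q by linarith
qed

lemma of_nat_power_p: "m > 0 \<Longrightarrow> of_nat (p ^ m) = (0 :: 'a)"
  using of_nat_CHAR[where 'a = 'a] by (simp add: char)

lemma subfield_power_minus_one:
  assumes "x \<in> subfield_of_degree m" "x \<noteq> 0"
  shows "(x :: 'a) ^ (p ^ m - 1) = 1"
proof -
  have "x ^ (p ^ m - 1) * x = 1 * x"
    using assms p_prime by (simp add: subfield_of_degree_def prime_gt_0_nat flip: power_Suc2)
  thus ?thesis using assms by simp
qed

lemma subfield_of_degree_mult:
  "x \<in> subfield_of_degree m \<Longrightarrow> y \<in> subfield_of_degree m \<Longrightarrow>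
    (x * y :: 'a) \<in> subfield_of_degree m"
  by (simp add: subfield_of_degree_def power_mult_distrib)

text \<open>Scaling the variable by a nonzero \<open>g\<close> multiplies the sum by
  \<open>g ^ z\<close>, and some \<open>g\<close> has \<open>g ^ z \<noteq> 1\<close> unless
  \<open>p ^ m - 1 dvd z\<close>. As \<open>z > 0\<close>, the term at 0 vanishes.\<close>

lemma sum_power_subfield:
  assumes m: "m > 0" "m dvd n" and z: "z > 0"
  shows "(\<Sum>x\<in>subfield_of_degree m. (x :: 'a) ^ z) = (if p ^ m - 1 dvd z then - 1 else 0)"
proof -
  let ?K = "subfield_of_degree m :: 'a set" and ?Q = "p ^ m"
  have Q: "?Q > 1" using m by (intro power_p_gt_1)
  have zK: "0 \<in> ?K" using p_ge_2 by (simp add: subfield_of_degree_def)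
  have cK: "card (?K - {0}) = ?Q - 1" using card_subfield_of_degree[OF m] zK by simp
  have split: "(\<Sum>x\<in>?K. x ^ z) = (\<Sum>x\<in>?K - {0}. x ^ z)"
    using z by (intro sum.mono_neutral_right) auto
  show ?thesis
  proof (cases "?Q - 1 dvd z")
    case True
    then obtain k where k: "z = (?Q - 1) * k" by (auto elim: dvdE)
    have "(\<Sum>x\<in>?K - {0}. x ^ z) = (\<Sum>x\<in>?K - {0}. 1)"
      using subfield_power_minus_one[of _ m] by (intro sum.cong) (auto simp: k power_mult)
    also have "\<dots> = of_nat (?Q - 1)" by (simp add: cK)
    also have "\<dots> = of_nat ?Q - 1" using Q by (subst of_nat_diff) auto
    also have "\<dots> = - 1" using of_nat_power_p[OF m(1)] by simp
    finally show ?thesis using split True by simp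
  next
    case False
    define r where "r = z mod (?Q - 1)"
    have r: "r > 0" "r < ?Q - 1" using False Q by (simp_all add: r_def mod_greater_zero_iff_not_dvd)
    have red: "x ^ z = x ^ r" if "x \<in> ?K - {0}" for x
    proof -
      have "x ^ z = x ^ ((?Q - 1) * (z div (?Q - 1)) + r)" by (simp add: r_def)
      thus ?thesis using subfield_power_minus_one[of x m] that by (simp add: power_add power_mult)
    qed
    have "\<exists>g\<in>?K - {0}. g ^ z \<noteq> 1"
    proof (rule ccontr)
      assume "\<not> ?thesis"
      hence "?K - {0} \<subseteq> {x. x ^ r = 1}" using red by auto
      hence "?Q - 1 \<le> card {x :: 'a. x ^ r = 1}" unfolding cK[symmetric]
        by (intro card_mono) auto
      also have "\<dots> \<le> r" using r by (intro card_power_eq_le)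
      finally show False using r by simp
    qed
    then obtain g where g: "g \<in> ?K" "g \<noteq> 0" "g ^ z \<noteq> 1" by auto
    have "bij_betw (\<lambda>x. g * x) ?K ?K"
    proof (rule bij_betwI')
      fix y assume y: "y \<in> ?K"
      have "inverse g \<in> ?K" using g by (simp add: subfield_of_degree_def power_inverse)
      hence "inverse g * y \<in> ?K" using y by (rule subfield_of_degree_mult)
      moreover have "y = g * (inverse g * y)" using g by simp
      ultimately show "\<exists>x\<in>?K. y = g * x" by blast
    qed (use g in \<open>auto intro: subfield_of_degree_mult\<close>)
    hence "(\<Sum>x\<in>?K. x ^ z) = (\<Sum>x\<in>?K. (g * x) ^ z)"
      by (rule sum.reindex_bij_betw[symmetric])
    also have "\<dots> = g ^ z * (\<Sum>x\<in>?K. x ^ z)" by (simp add: power_mult_distrib sum_distrib_left)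
    finally have "(1 - g ^ z) * (\<Sum>x\<in>?K. x ^ z) = 0" by (simp add: algebra_simps)
    thus ?thesis using g False by simp
  qed
qed

lemma subfield_of_degree_n: "subfield_of_degree n = (UNIV :: 'a set)"
  using frobenius_period[of _ 1] by (simp add: subfield_of_degree_def)

text \<open>The polynomial with terms \<open>C e * X ^ (p ^ e)\<close> has degree at most
  \<open>p ^ (n - 1)\<close>, fewer than its roots.\<close>

lemma linearised_coeff_zero:
  assumes "\<And>b :: 'a. (\<Sum>e<n. C e * b ^ (p ^ e)) = 0" "e < n"
  shows "C e = 0"
proof -
  define f where "f = (\<Sum>e<n. monom (C e) (p ^ e))"
  have "degree f \<le> p ^ (n - 1)" unfolding f_def
  proof (rule degree_sum_le)
    fix i assume "i \<in> {..<n}"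
    hence "p ^ i \<le> p ^ (n - 1)" using p_ge_2 by (intro power_increasing) auto
    thus "degree (monom (C i) (p ^ i)) \<le> p ^ (n - 1)" using degree_monom_le order_trans by blast
  qed simp
  also have "p ^ (n - 1) < CARD('a)" unfolding card_field
    using p_ge_2 n_pos by (intro power_strict_increasing) auto
  finally have deg: "degree f < CARD('a)" .
  have roots: "{x. poly f x = 0} = UNIV" using assms(1) by (auto simp: f_def poly_sum poly_monom)
  have "f = 0"
  proof (rule ccontr)
    assume "f \<noteq> 0"
    from card_poly_roots_bound[OF this] show False using deg roots by simp
  qed
  hence "coeff f (p ^ e) = 0" by simp
  moreover have "coeff f (p ^ e) = (\<Sum>i<n. if i = e then C i else 0)"
    unfolding f_def coeff_sum using p_ge_2 by (intro sum.cong) (auto simp: power_inject_exp)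
  ultimately show ?thesis using assms(2) by simp
qed

section \<open>Trace and canonical character\<close>

definition tr :: "'a \<Rightarrow> 'a" where "tr = abs_trace n"
definition tr_rep :: "'a \<Rightarrow> nat" where "tr_rep x = (THE k. k < p \<and> of_nat k = tr x)"
definition psi :: "'a \<Rightarrow> complex" where "psi = canonical_char n"

lemma tr_eq: "tr x = (\<Sum>i<n. x ^ (p ^ i))"
  by (simp add: tr_def abs_trace_def char)

lemma of_nat_tr_rep: "of_nat (tr_rep x) = tr x"
  using theI'[OF abs_trace_representative[where 'a = 'a, unfolded char, OF card_field], of x]
  unfolding tr_rep_def tr_def by blast

lemma tr_add: "tr (x + y) = tr x + tr y"
  by (simp add: tr_eq frobenius_add sum.distrib)

lemma tr_frobenius: "tr (x ^ (p ^ k)) = tr x"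
proof (induction k)
  case (Suc k)
  have "tr (y ^ p) = tr y" for y
  proof -
    have "tr (y ^ p) + y = (\<Sum>i<Suc n. y ^ (p ^ i))"
      unfolding tr_eq by (subst sum.lessThan_Suc_shift) (simp flip: power_mult power_Suc)
    also have "\<dots> = tr y + y" using frobenius_period[of y 1] by (simp add: tr_eq)
    finally show ?thesis by simp
  qed
  from this[of "x ^ (p ^ k)"] show ?case using Suc by (simp flip: power_mult power_Suc2)
qed simp

lemma zeta_power_p: "zeta p ^ p = 1"
proof -
  have "zeta p ^ p = exp (of_nat p * (2 * of_real pi * \<i> / of_nat p))"
    by (simp only: zeta_def exp_of_nat_mult)
  also have "of_nat p * (2 * of_real pi * \<i> / of_nat p) = 2 * of_real pi * \<i>"
    using p_ge_2 by simp
  finally show ?thesis by simp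
qed

lemma psi_eq_zeta_power:
  assumes "of_nat k = tr x" shows "psi x = zeta p ^ k"
proof -
  have "psi x = zeta p ^ tr_rep x"
    unfolding psi_def canonical_char_def zeta_def tr_rep_def tr_def char
    by (subst exp_of_nat_mult [symmetric]) (simp add: mult_ac)
  moreover have "[tr_rep x = k] (mod p)"
    using assms of_nat_tr_rep[of x] by (metis char of_nat_eq_iff_cong_CHAR)
  ultimately show ?thesis using power_cong_order[OF zeta_power_p] by metis
qed

lemma psi_zero: "psi 0 = 1"
  using psi_eq_zeta_power[of 0 0] p_prime by (simp add: tr_eq power_0_left prime_gt_0_nat)

lemma psi_add: "psi (x + y) = psi x * psi y"
proof -
  have "psi (x + y) = zeta p ^ (tr_rep x + tr_rep y)"
    by (rule psi_eq_zeta_power) (simp add: of_nat_tr_rep tr_add)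
  thus ?thesis using psi_eq_zeta_power[OF of_nat_tr_rep] by (simp add: power_add)
qed

lemma psi_frobenius: "psi (x ^ (p ^ k)) = psi x"
  using psi_eq_zeta_power[of "tr_rep x"] of_nat_tr_rep[of x] tr_frobenius[of x k] by metis

lemma zeta_power_eq_one:
  assumes "zeta p ^ k = 1" shows "p dvd k"
proof (rule ccontr)
  assume "\<not> p dvd k"
  hence "coprime k p" using p_prime by (metis coprime_commute prime_imp_coprime_nat)
  then obtain i where "[k * i = 1] (mod p)" using cong_solve_coprime_nat by auto
  hence "zeta p ^ (k * i) = zeta p ^ 1" by (rule power_cong_order[OF zeta_power_p])
  hence "zeta p = 1" using assms by (simp add: power_mult)
  hence "val_p p (1 - zeta p) = \<infinity>" using val_p_zero[OF p_prime] by simp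
  thus False using val_p_unif[OF p_prime] by simp
qed

lemma ex_psi_neq_one: "\<exists>x. psi x \<noteq> 1"
proof (rule ccontr)
  assume *: "\<nexists>x. psi x \<noteq> 1"
  have "tr x = 0" for x
  proof -
    have "zeta p ^ tr_rep x = 1" using psi_eq_zeta_power[OF of_nat_tr_rep, of x] * by simp
    hence "p dvd tr_rep x" by (rule zeta_power_eq_one)
    thus ?thesis by (metis char of_nat_eq_0_iff_char_dvd of_nat_tr_rep)
  qed
  hence "(1 :: 'a) = 0"
    using linearised_coeff_zero[of "\<lambda>_. 1" 0] n_pos by (simp add: tr_eq)
  thus False by simp
qed

lemma psi_sum: "(\<Sum>x\<in>UNIV. psi (c * x)) = (if c = 0 then of_nat (p ^ n) else 0)"
proof (cases "c = 0")
  case True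
  thus ?thesis by (simp add: psi_zero card_field)
next
  case False
  obtain y where y: "psi y \<noteq> 1" using ex_psi_neq_one by blast
  have "(\<Sum>x\<in>UNIV. psi (c * x)) = (\<Sum>x\<in>UNIV. psi (c * (y / c + x)))"
    by (rule sum.reindex_bij_betw[symmetric])
       (rule bijI, auto intro!: injI surjI[of _ "\<lambda>x. x - y / c"])
  also have "\<dots> = psi y * (\<Sum>x\<in>UNIV. psi (c * x))"
    using False by (simp add: distrib_left psi_add sum_distrib_left)
  finally have "(1 - psi y) * (\<Sum>x\<in>UNIV. psi (c * x)) = 0" by (simp add: algebra_simps)
  thus ?thesis using False y by simp
qed

lemma psi_cyc_int: "psi x \<in> cyc_int p"
  using psi_eq_zeta_power[OF of_nat_tr_rep] by (metis cyc_int_power cyc_int.zeta)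

end

section \<open>Sums of powers bound the valuation\<close>

text \<open>\<open>psum p d k z\<close> says that \<open>z\<close> is a sum of \<open>k\<close> terms, each a power of \<open>p\<close> or \<open>d\<close> times a power
  of \<open>p\<close>. In the language of Stickelberger's theorem, \<open>z = J' + d * J\<close> where the \<open>p\<close>-adic digit sums
  of \<open>J\<close> and \<open>J'\<close> add up to at most \<open>k\<close>.\<close>

inductive psum :: "nat \<Rightarrow> nat \<Rightarrow> nat \<Rightarrow> nat \<Rightarrow> bool" for p d where
  zero: "psum p d 0 0"
| one: "psum p d k z \<Longrightarrow> psum p d (Suc k) (z + p ^ e)"
| exponent: "psum p d k z \<Longrightarrow> psum p d (Suc k) (z + d * p ^ e)"

lemma psum_add: "psum p d k z \<Longrightarrow> psum p d l y \<Longrightarrow> psum p d (k + l) (z + y)"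
proof (induction rule: psum.induct)
  case (one k z e)
  thus ?case using psum.one[of p d "k + l" "z + y" e] by (simp add: ac_simps)
next
  case (exponent k z e)
  thus ?case using psum.exponent[of p d "k + l" "z + y" e] by (simp add: ac_simps)
qed simp

lemma psum_times: "psum p d k z \<Longrightarrow> psum p d (i * k) (i * z)"
  by (induction i) (auto intro: psum.zero psum_add)

lemma psum_shift: "psum p d k z \<Longrightarrow> psum p d k (z * p ^ i)"
proof (induction rule: psum.induct)
  case (one k z e)
  thus ?case using psum.one[of p d k "z * p ^ i" "e + i"] by (simp add: algebra_simps power_add)
next
  case (exponent k z e)
  thus ?case using psum.exponent[of p d k "z * p ^ i" "e + i"]
    by (simp add: algebra_simps power_add)
qed (auto intro: psum.zero)

lemma psum_digit: "psum p d i (i * p ^ e)"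
  using psum_times[OF psum.one[OF psum.zero, of p d e], of i] by simp

lemma psum_exponent_digit: "psum p d i (i * (d * p ^ e))"
  using psum_times[OF psum.exponent[OF psum.zero, of p d e], of i] by simp

lemma psum_exponent_shift: "psum p (d * p ^ x) k z \<Longrightarrow> psum p d k z"
proof (induction rule: psum.induct)
  case (exponent k z e)
  thus ?case using psum.exponent[of p d k z "x + e"] by (simp add: power_add mult_ac)
qed (auto intro: psum.intros)

lemma psum_pos:
  assumes "psum p d k z" "k > 0" "p > 0" "d > 0" shows "z > 0"
  using assms by (induction rule: psum.induct) auto

text \<open>Multiplying by the quotient of \<open>p ^ (m * r) - 1\<close> and
  \<open>p ^ m - 1\<close>, which is the sum of all \<open>p ^ (m * j)\<close> with
  \<open>j < r\<close>, turns \<open>z\<close> into \<open>r\<close> shifted copies.\<close>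

lemma psum_lift:
  assumes "psum p d k z" "p ^ m - 1 dvd z" "p > 0"
  obtains y where "psum p d (r * k) y" "p ^ (m * r) - 1 dvd y"
proof -
  have "psum p d (i * k) (z * (\<Sum>j<i. p ^ (m * j)))" for i
  proof (induction i)
    case (Suc i)
    thus ?case using psum_add[OF Suc psum_shift[OF assms(1), of "m * i"]]
      by (simp add: algebra_simps)
  qed (simp add: psum.zero)
  moreover have "p ^ (m * r) - 1 dvd z * (\<Sum>j<r. p ^ (m * j))"
  proof -
    have "int p ^ (m * r) - 1 = (int p ^ m - 1) * (\<Sum>j<r. int p ^ (m * j))"
      by (simp add: power_mult power_diff_1_eq)
    moreover have "int p ^ m - 1 dvd int z"
      using assms(2,3) by (metis of_nat_1 of_nat_diff of_nat_dvd_iff of_nat_power one_le_power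
        Suc_leI One_nat_def)
    ultimately have "int p ^ (m * r) - 1 dvd int z * (\<Sum>j<r. int p ^ (m * j))"
      by (simp add: mult_dvd_mono)
    hence "int (p ^ (m * r) - 1) dvd int (z * (\<Sum>j<r. p ^ (m * j)))"
      using assms(3) by (simp add: of_nat_diff)
    thus ?thesis by (simp only: of_nat_dvd_iff)
  qed
  ultimately show ?thesis using that by blast
qed

context weil_field
begin

text \<open>A free coefficient of \<open>x ^ d\<close> is needed because expanding products of
  characters adds up the coefficients.\<close>

definition wsum :: "'a \<Rightarrow> 'a \<Rightarrow> complex" where
  "wsum b c = (\<Sum>x\<in>UNIV. psi (b * x ^ d + c * x))"

lemma weil_sum_eq: "weil_sum n d a = wsum 1 (- a)"
  by (simp add: weil_sum_def wsum_def psi_def)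

lemma wsum_cyc_int: "wsum b c \<in> cyc_int p"
  unfolding wsum_def by (intro cyc_int_sum psi_cyc_int)

text \<open>Scaling \<open>x\<close> by a \<open>d\<close>-th root of \<open>b\<close> normalises
  the leading coefficient.\<close>

lemma wsum_eq_weil_sum:
  assumes "b \<noteq> 0" shows "\<exists>a :: 'a. wsum b c = weil_sum n d a"
proof -
  obtain \<beta> where \<beta>: "b = \<beta> ^ d" using bij_power_d by (metis bij_pointE)
  hence \<beta>0: "\<beta> \<noteq> 0" using assms d_pos by (auto simp: power_0_left)
  have "wsum b c = (\<Sum>x\<in>UNIV. psi (1 * (\<beta> * x) ^ d + (c / \<beta>) * (\<beta> * x)))"
    unfolding wsum_def using \<beta>0 by (simp add: \<beta> power_mult_distrib)
  also have "\<dots> = wsum 1 (c / \<beta>)" unfolding wsum_def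
    by (rule sum.reindex_bij_betw) (rule bijI, use \<beta>0 in
        \<open>auto intro!: injI surjI[of _ "\<lambda>x. x / \<beta>"]\<close>)
  also have "\<dots> = weil_sum n d (- (c / \<beta>))" by (simp add: weil_sum_eq)
  finally show ?thesis by blast
qed

lemma wsum_zero: "wsum 0 c = (if c = 0 then of_nat (p ^ n) else 0)"
  by (simp add: wsum_def psi_sum)

lemma val_p_of_nat_power: "val_p p (of_nat (p ^ k)) = ereal (real k)"
proof -
  have pp: "prime (int p)" using p_prime by simp
  have "val_p p (of_int (int (p ^ k))) = ereal (real (multiplicity (int p) (int p ^ k)))"
    using val_p_of_int[OF p_prime, of "int (p ^ k)"] p_prime by (simp add: prime_gt_0_nat)
  also have "multiplicity (int p) (int p ^ k) = k"
    using pp by (intro multiplicity_same_power) (auto simp: prime_gt_0_int)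
  finally show ?thesis by simp
qed

lemma weil_V_le_iff: "weil_V TYPE('a) n d \<le> r \<longleftrightarrow> (\<exists>a :: 'a. val_p p (weil_sum n d a) \<le> r)"
  unfolding weil_V_def by (subst Min_le_iff) (auto simp: char)

text \<open>For \<open>b = 0\<close> the sum is \<open>p ^ n\<close> or 0, so its valuation is at
  least \<open>n\<close>; this case is why \<open>r < n\<close> is assumed.\<close>

lemma val_p_wsum_gt:
  assumes "\<not> weil_V TYPE('a) n d \<le> ereal r" "r < real n"
  shows "val_p p (wsum b c) > ereal r"
proof (cases "b = 0")
  case True
  thus ?thesis using assms(2) val_p_of_nat_power[of n] val_p_zero[OF p_prime]
    by (simp add: wsum_zero)
next
  case False
  thus ?thesis using wsum_eq_weil_sum[of b c] assms(1) by (auto simp: weil_V_le_iff not_le)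
qed

text \<open>Each factor \<open>psi y - 1\<close> splits the sum into a difference of two with fewer
  factors; the leading character is left arbitrary to absorb the shift of
  \<open>(b, c)\<close>.\<close>

lemma val_p_product_sum_gt:
  assumes "\<not> weil_V TYPE('a) n d \<le> ereal r" "r < real n"
  shows "val_p p (\<Sum>x\<in>UNIV. psi (b * x ^ d + c * x) *
    (\<Prod>(b', c')\<leftarrow>L. psi (b' * x ^ d + c' * x) - 1)) > ereal r \<and>
    (\<Sum>x\<in>UNIV. psi (b * x ^ d + c * x) *
    (\<Prod>(b', c')\<leftarrow>L. psi (b' * x ^ d + c' * x) - 1)) \<in> cyc_int p"
proof (induction L arbitrary: b c)
  case Nil
  thus ?case using val_p_wsum_gt[OF assms, of b c] wsum_cyc_int[of b c] by (simp add: wsum_def)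
next
  case (Cons l L)
  obtain b' c' where l: "l = (b', c')" by (cases l)
  let ?P = "\<lambda>x. \<Prod>(b', c')\<leftarrow>L. psi (b' * x ^ d + c' * x) - 1"
  let ?S = "\<lambda>b c. \<Sum>x\<in>UNIV. psi (b * x ^ d + c * x) * ?P x"
  have "psi (b * x ^ d + c * x) * (\<Prod>(b', c')\<leftarrow>l # L. psi (b' * x ^ d + c' * x) - 1) =
    psi ((b + b') * x ^ d + (c + c') * x) * ?P x - psi (b * x ^ d + c * x) * ?P x" for x
  proof -
    have "(b + b') * x ^ d + (c + c') * x = (b * x ^ d + c * x) + (b' * x ^ d + c' * x)"
      by (simp add: algebra_simps)
    thus ?thesis by (simp only: psi_add l) (simp add: algebra_simps)
  qed
  hence eq: "(\<Sum>x\<in>UNIV. psi (b * x ^ d + c * x) *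
      (\<Prod>(b', c')\<leftarrow>l # L. psi (b' * x ^ d + c' * x) - 1)) = ?S (b + b') (c + c') - ?S b c"
    by (simp only: sum_subtractf)
  show ?case unfolding eq using Cons.IH
    by (intro conjI val_p_diff_gt[OF p_prime] cyc_int_diff) blast+
qed

lemma prod_list_uminus:
  "(\<Prod>x\<leftarrow>L. - f x) = (- 1) ^ length L * (\<Prod>x\<leftarrow>L. f x :: 'b :: comm_ring_1)"
  by (induction L) auto

text \<open>Each factor \<open>psi y - 1\<close> is \<open>(1 - zeta p) * u\<close> with \<open>u\<close> congruent to \<open>- tr y\<close>, so the product
  sum can be divided by a power of \<open>1 - zeta p\<close> and reduced.\<close>

lemma trace_product_sum_zero:
  assumes V: "\<not> weil_V TYPE('a) n d \<le> ereal (real (length L) / (real p - 1))"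
    and k: "length L < n * (p - 1)"
  shows "(\<Sum>x\<in>UNIV. \<Prod>(b, c)\<leftarrow>L. tr (b * x ^ d + c * x)) = 0"
proof -
  let ?k = "length L"
  have p1: "real p - 1 > 0" using p_ge_2 by simp
  have "real ?k < real (n * (p - 1))" using k by (simp only: of_nat_less_iff)
  hence kn: "real ?k / (real p - 1) < real n" using p1 p_ge_2 by (simp add: field_simps of_nat_diff)
  have "\<exists>u. cyc_residue p u (- int (tr_rep y)) \<and> psi y - 1 = (1 - zeta p) * u" for y
    using zeta_power_minus_one[OF p_prime, of "tr_rep y"] psi_eq_zeta_power[OF of_nat_tr_rep, of y]
    by simp
  then obtain u where u: "\<And>y. cyc_residue p (u y) (- int (tr_rep y))"
    "\<And>y. psi y - 1 = (1 - zeta p) * u y" by metis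
  let ?l = "\<lambda>x (b, c). b * x ^ d + c * x"
  define Z where "Z = (\<Sum>x\<in>UNIV. \<Prod>l\<leftarrow>L. u (?l x l))"
  define N where "N = (\<Sum>x\<in>UNIV. \<Prod>l\<leftarrow>L. - int (tr_rep (?l x l)))"
  have ZN: "cyc_residue p Z N"
    unfolding Z_def N_def by (intro cyc_residue_sum[OF p_prime] cyc_residue_prod_list[OF p_prime] u)
  have "(\<Prod>l\<leftarrow>L. psi (?l x l) - 1) = (1 - zeta p) ^ ?k * (\<Prod>l\<leftarrow>L. u (?l x l))" for x
    by (induction L) (simp_all add: u(2))
  hence "(\<Sum>x\<in>UNIV. \<Prod>l\<leftarrow>L. psi (?l x l) - 1) = (1 - zeta p) ^ ?k * Z"
    by (simp add: Z_def sum_distrib_left)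
  moreover have "(\<Sum>x\<in>UNIV. \<Prod>l\<leftarrow>L. psi (?l x l) - 1) =
      (\<Sum>x\<in>UNIV. psi (0 * x ^ d + 0 * x) * (\<Prod>(b', c')\<leftarrow>L. psi (b' * x ^ d + c' * x) - 1))"
    by (simp add: psi_zero case_prod_unfold)
  ultimately have "val_p p ((1 - zeta p) ^ ?k * Z) > ereal (real ?k / (real p - 1))"
    using val_p_product_sum_gt[OF V kn, of 0 0 L] by simp
  hence "ereal (real ?k / (real p - 1)) + val_p p Z > ereal (real ?k / (real p - 1))"
    using val_p_mult[OF p_prime cyc_int_power[OF cyc_int_diff[OF cyc_int.one cyc_int.zeta]]
        cyc_residue_imp_cyc_int[OF p_prime ZN]] val_p_unif_power[OF p_prime] by simp
  hence "val_p p Z > 0" by (cases "val_p p Z") auto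
  hence "int p dvd N" using cyc_residue_pos_val[OF p_prime ZN] by blast
  hence "of_int N = (0 :: 'a)" by (metis char of_int_eq_0_iff_char_dvd)
  moreover have "of_int N = (\<Sum>x\<in>UNIV. \<Prod>l\<leftarrow>L. - tr (?l x l))"
  proof -
    have "of_int (\<Prod>l\<leftarrow>L. - int (f l)) = (\<Prod>l\<leftarrow>L. - (of_nat (f l) :: 'a))" for f
      by (induction L) simp_all
    thus ?thesis by (simp add: N_def of_nat_tr_rep)
  qed
  ultimately have "(- 1) ^ ?k * (\<Sum>x\<in>UNIV. \<Prod>l\<leftarrow>L. tr (?l x l)) = 0"
    by (simp add: prod_list_uminus sum_distrib_left)
  thus ?thesis by (simp add: case_prod_unfold)
qed

text \<open>The assumption says that a polynomial in the \<open>b ^ (p ^ i)\<close> vanishes for all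
  \<open>b\<close>; its coefficients are the wanted sums for \<open>i < n\<close>, and Frobenius has
  period \<open>n\<close>.\<close>

lemma frobenius_coeff_sum_zero:
  assumes "\<And>b. (\<Sum>x\<in>UNIV. tr (b * f x) * G x) = 0"
  shows "(\<Sum>x\<in>UNIV. f x ^ (p ^ e) * G x :: 'a) = 0"
proof -
  define e' where "e' = e mod n"
  have "(\<Sum>i<n. (\<Sum>x\<in>UNIV. f x ^ (p ^ i) * G x) * b ^ (p ^ i)) = 0" for b
  proof -
    have "(\<Sum>i<n. (\<Sum>x\<in>UNIV. f x ^ (p ^ i) * G x) * b ^ (p ^ i)) =
        (\<Sum>x\<in>UNIV. \<Sum>i<n. f x ^ (p ^ i) * G x * b ^ (p ^ i))"
      by (subst sum.swap) (simp add: sum_distrib_right)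
    also have "\<dots> = (\<Sum>x\<in>UNIV. tr (b * f x) * G x)"
      by (simp add: tr_eq sum_distrib_left sum_distrib_right power_mult_distrib mult_ac)
    finally show ?thesis using assms by simp
  qed
  from linearised_coeff_zero[OF this, of e'] have "(\<Sum>x\<in>UNIV. f x ^ (p ^ e') * G x) = 0"
    using n_pos by (simp add: e'_def)
  moreover have "y ^ (p ^ e) = y ^ (p ^ e')" for y :: 'a
  proof -
    have "y ^ (p ^ e) = (y ^ (p ^ (n * (e div n)))) ^ (p ^ e')"
      by (simp add: e'_def flip: power_mult power_add)
    thus ?thesis by (simp only: frobenius_period)
  qed
  ultimately show ?thesis by simp
qed

text \<open>The induction trades one term of \<open>z\<close> for a trace factor, keeping
  \<open>k + length L\<close> fixed; \<open>frobenius_coeff_sum_zero\<close> turns that factor back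
  into a power of \<open>x\<close>.\<close>

lemma monomial_trace_sum_zero:
  assumes "psum p d k z"
    and "\<not> weil_V TYPE('a) n d \<le> ereal (real (k + length L) / (real p - 1))"
    and "k + length L < n * (p - 1)"
  shows "(\<Sum>x\<in>UNIV. x ^ z * (\<Prod>(b, c)\<leftarrow>L. tr (b * x ^ d + c * x))) = 0"
  using assms
proof (induction arbitrary: L rule: psum.induct)
  case zero
  thus ?case using trace_product_sum_zero[of L] by simp
next
  case (one k z e)
  let ?G = "\<lambda>x. x ^ z * (\<Prod>(b, c)\<leftarrow>L. tr (b * x ^ d + c * x))"
  have "(\<Sum>x\<in>UNIV. tr (b * x) * ?G x) = 0" for b
    using one.IH[of "(0, b) # L"] one.prems by (simp add: mult_ac)
  from frobenius_coeff_sum_zero[OF this, of e] show ?case by (simp add: power_add mult_ac)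
next
  case (exponent k z e)
  let ?G = "\<lambda>x. x ^ z * (\<Prod>(b, c)\<leftarrow>L. tr (b * x ^ d + c * x))"
  have "(\<Sum>x\<in>UNIV. tr (b * x ^ d) * ?G x) = 0" for b
    using exponent.IH[of "(b, 0) # L"] exponent.prems by (simp add: mult_ac)
  from frobenius_coeff_sum_zero[OF this, of e] show ?case
    by (simp add: power_add mult_ac flip: power_mult)
qed

text \<open>If \<open>p ^ n - 1 dvd z\<close>, the sum of all \<open>x ^ z\<close> is -1, against
  \<open>monomial_trace_sum_zero\<close>.\<close>

theorem weil_V_le_of_psum:
  assumes "psum p d k z" "0 < k" "k < n * (p - 1)" "p ^ n - 1 dvd z"
  shows "weil_V TYPE('a) n d \<le> ereal (real k / (real p - 1))"
proof (rule ccontr)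
  assume "\<not> ?thesis"
  hence "(\<Sum>x\<in>UNIV. x ^ z :: 'a) = 0"
    using monomial_trace_sum_zero[OF assms(1), of "[]"] assms(3) by simp
  moreover have "z > 0" using psum_pos[OF assms(1,2)] d_pos p_prime by (simp add: prime_gt_0_nat)
  ultimately show False using sum_power_subfield[OF n_pos dvd_refl, of z] assms(4)
    by (simp add: subfield_of_degree_n)
qed

corollary weil_V_le_of_psum_subfield:
  assumes "psum p d k z" "0 < k" "k < m * (p - 1)" "p ^ m - 1 dvd z" "n = m * r"
  shows "weil_V TYPE('a) n d \<le> ereal (real (r * k) / (real p - 1))"
proof -
  obtain y where y: "psum p d (r * k) y" "p ^ (m * r) - 1 dvd y"
    using psum_lift[OF assms(1,4)] p_prime prime_gt_0_nat by blast
  have "r > 0" using n_pos assms(5) by (cases r) auto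
  thus ?thesis using y assms by (intro weil_V_le_of_psum) (auto simp: mult_ac)
qed

end

section \<open>Degenerate exponents and the third moment\<close>

context weil_field
begin

text \<open>Since \<open>psi\<close> is invariant under Frobenius, \<open>x ^ d\<close> may be
  replaced by \<open>x\<close>.\<close>

lemma weil_sum_degenerate:
  assumes "[d = p ^ k] (mod (p ^ n - 1))"
  shows "weil_sum n d (a :: 'a) = (if a = 1 then of_nat (p ^ n) else 0)"
proof -
  have "x ^ d = x ^ (p ^ k)" for x :: 'a
  proof (cases "x = 0")
    case False
    have "x ^ (p ^ n - 1) = 1"
      using finite_field_power_card_minus_one[OF False] by (simp add: card_field)
    thus ?thesis using assms by (rule power_cong_order)
  qed (use d_pos p_ge_2 in \<open>auto simp: power_0_left\<close>)
  hence "psi (x ^ d - a * x) = psi ((1 - a) * x)" for x :: 'a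
    using psi_add[of "x ^ (p ^ k)" "- (a * x)"] psi_add[of x "- (a * x)"] psi_frobenius[of x k]
    by (simp add: algebra_simps)
  hence "weil_sum n d a = (\<Sum>x\<in>UNIV. psi ((1 - a) * x))" by (simp add: weil_sum_def psi_def)
  thus ?thesis by (auto simp: psi_sum)
qed

lemma weil_V_degenerate:
  assumes "[d = p ^ k] (mod (p ^ n - 1))"
  shows "weil_V TYPE('a) n d = ereal (real n)"
  unfolding weil_V_def char
proof (rule Min_eqI)
  show "ereal (real n) \<le> y" if "y \<in> range (\<lambda>a :: 'a. val_p p (weil_sum n d a))" for y
    using that val_p_zero[OF p_prime] val_p_of_nat_power[of n]
    by (auto simp: weil_sum_degenerate[OF assms])
  show "ereal (real n) \<in> range (\<lambda>a :: 'a. val_p p (weil_sum n d a))"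
    using weil_sum_degenerate[OF assms, of 1] val_p_of_nat_power[of n] by (intro image_eqI[of _ _ 1]) auto
qed simp

lemma psi_sum_power_d: "(\<Sum>x\<in>UNIV. psi (c * x ^ d)) = (if c = 0 then of_nat (p ^ n) else 0)"
  using sum.reindex_bij_betw[OF bij_power_d, of "\<lambda>x. psi (c * x)"] psi_sum[of c] by simp

text \<open>Summing over \<open>a\<close> forces \<open>x = - (b * y + c * z)\<close>. The part
  \<open>z = 0\<close> gives 0 as \<open>b ^ d \<noteq> 1\<close>; elsewhere
  \<open>y = v * z\<close>, and the missing \<open>z = 0\<close> accounts for the -1.\<close>

lemma third_moment:
  assumes b: "b \<noteq> 1" and c: "c \<noteq> 0"
  shows "(\<Sum>a\<in>UNIV. weil_sum n d a * weil_sum n d (b * a) * weil_sum n d (c * a)) =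
    of_nat (p ^ n) * of_nat (p ^ n) *
      of_int (int (card {v :: 'a. (b * v + c) ^ d = 1 + v ^ d}) - 1)"
proof -
  let ?q = "of_nat (p ^ n) :: complex"
  let ?f = "\<lambda>x y z. psi (x ^ d + y ^ d + z ^ d)"
  let ?S = "\<lambda>y z. psi (y ^ d + z ^ d - (b * y + c * z) ^ d)"
  have "weil_sum n d a * weil_sum n d (b * a) * weil_sum n d (c * a) =
      (\<Sum>y\<in>UNIV. \<Sum>z\<in>UNIV. \<Sum>x\<in>UNIV. ?f x y z * psi ((- (x + b * y + c * z)) * a))" for a
  proof -
    have eq: "?f x y z * psi ((- (x + b * y + c * z)) * a) =
        psi (x ^ d - a * x) * psi (y ^ d - (b * a) * y) * psi (z ^ d - (c * a) * z)" for x y z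
      by (simp add: algebra_simps flip: psi_add)
    show ?thesis unfolding eq weil_sum_def psi_def[symmetric]
      by (simp add: sum_product sum_distrib_left sum_distrib_right mult_ac)
         (rule sum.cong[OF refl], rule sum.swap)
  qed
  hence "(\<Sum>a\<in>UNIV. weil_sum n d a * weil_sum n d (b * a) * weil_sum n d (c * a)) =
      (\<Sum>a\<in>UNIV. \<Sum>y\<in>UNIV. \<Sum>z\<in>UNIV. \<Sum>x\<in>UNIV. ?f x y z * psi ((- (x + b * y + c * z)) * a))"
    by simp
  also have "\<dots> = (\<Sum>y\<in>UNIV. \<Sum>z\<in>UNIV. \<Sum>x\<in>UNIV. \<Sum>a\<in>UNIV. ?f x y z * psi ((- (x + b * y + c * z)) * a))"
    by (subst sum.swap, rule sum.cong[OF refl], subst sum.swap, rule sum.cong[OF refl], rule sum.swap)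
  also have "\<dots> = (\<Sum>y\<in>UNIV. \<Sum>z\<in>UNIV. ?q * ?S y z)"
  proof (intro sum.cong refl)
    fix y z :: 'a
    have "(\<Sum>a\<in>UNIV. ?f x y z * psi ((- (x + b * y + c * z)) * a)) =
        (if x = - (b * y + c * z) then ?q * ?S y z else 0)" for x
    proof -
      have "- (x + b * y + c * z) = 0 \<longleftrightarrow> x = - (b * y + c * z)"
        by (metis add.assoc add_eq_0_iff2 neg_equal_0_iff_equal)
      moreover have "?f (- (b * y + c * z)) y z = ?S y z"
        by (subst minus_power_d) (simp add: algebra_simps)
      ultimately show ?thesis unfolding sum_distrib_left[symmetric] psi_sum
        by (cases "x = - (b * y + c * z)") (simp_all only: simp_thms if_True if_False mult.commute mult_zero_left)
    qed
    thus "(\<Sum>x\<in>UNIV. \<Sum>a\<in>UNIV. ?f x y z * psi ((- (x + b * y + c * z)) * a)) = ?q * ?S y z"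
      by simp
  qed
  also have "\<dots> = ?q * (\<Sum>z\<in>UNIV. \<Sum>y\<in>UNIV. ?S y z)"
    by (subst sum.swap) (simp add: sum_distrib_left)
  also have "(\<Sum>z\<in>UNIV. \<Sum>y\<in>UNIV. ?S y z) =
      (\<Sum>y\<in>UNIV. ?S y 0) + (\<Sum>z\<in>UNIV - {0}. \<Sum>y\<in>UNIV. ?S y z)"
    by (subst sum.remove[of _ 0]) auto
  also have "(\<Sum>y\<in>UNIV. ?S y 0) = 0"
  proof -
    have "b ^ d \<noteq> 1" using b bij_power_d by (metis bij_def injD power_one)
    moreover have "?S y 0 = psi ((1 - b ^ d) * y ^ d)" for y
      using d_pos by (simp add: power_mult_distrib algebra_simps power_0_left)
    ultimately show ?thesis using psi_sum_power_d[of "1 - b ^ d"] by simp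
  qed
  also have "(\<Sum>z\<in>UNIV - {0}. \<Sum>y\<in>UNIV. ?S y z) =
      (\<Sum>z\<in>UNIV - {0}. \<Sum>v\<in>UNIV. psi ((1 + v ^ d - (b * v + c) ^ d) * z ^ d))"
  proof (rule sum.cong[OF refl])
    fix z :: 'a assume "z \<in> UNIV - {0}"
    hence "bij (\<lambda>v. v * z)"
      by (intro bijI) (auto intro!: injI surjI[of _ "\<lambda>x. x / z"])
    hence "(\<Sum>y\<in>UNIV. ?S y z) = (\<Sum>v\<in>UNIV. ?S (v * z) z)"
      by (rule sum.reindex_bij_betw[symmetric])
    also have "\<dots> = (\<Sum>v\<in>UNIV. psi ((1 + v ^ d - (b * v + c) ^ d) * z ^ d))"
    proof (intro sum.cong refl)
      fix v :: 'a
      have "b * (v * z) + c * z = (b * v + c) * z" by (simp add: algebra_simps)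
      thus "?S (v * z) z = psi ((1 + v ^ d - (b * v + c) ^ d) * z ^ d)"
        by (simp only: power_mult_distrib) (simp add: algebra_simps)
    qed
    finally show "(\<Sum>y\<in>UNIV. ?S y z) =
      (\<Sum>v\<in>UNIV. psi ((1 + v ^ d - (b * v + c) ^ d) * z ^ d))" .
  qed
  also have "\<dots> = (\<Sum>v\<in>UNIV. (if (b * v + c) ^ d = 1 + v ^ d then ?q else 0) - 1)"
  proof (subst sum.swap, intro sum.cong refl)
    fix v :: 'a
    let ?h = "1 + v ^ d - (b * v + c) ^ d"
    have "(\<Sum>z\<in>UNIV. psi (?h * z ^ d)) = 1 + (\<Sum>z\<in>UNIV - {0}. psi (?h * z ^ d))"
      using d_pos by (subst sum.remove[of _ 0]) (auto simp: power_0_left psi_zero)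
    hence "(\<Sum>z\<in>UNIV - {0}. psi (?h * z ^ d)) = (\<Sum>z\<in>UNIV. psi (?h * z ^ d)) - 1" by simp
    thus "(\<Sum>z\<in>UNIV - {0}. psi (?h * z ^ d)) =
        (if (b * v + c) ^ d = 1 + v ^ d then ?q else 0) - 1"
      unfolding psi_sum_power_d by auto
  qed
  also have "\<dots> = ?q * of_nat (card {v :: 'a. (b * v + c) ^ d = 1 + v ^ d}) - ?q"
    by (simp add: sum_subtractf card_field sum.If_cases Int_def)
  finally show ?thesis by (simp add: algebra_simps)
qed

text \<open>Three factors of valuation above \<open>2 / 3 * n\<close> give the moment a valuation
  above \<open>2 * n\<close>, so \<open>p\<close> divides the count minus 1 and the count is not
  0.\<close>

lemma ex_solution_if_weil_V_large:
  assumes V: "\<not> weil_V TYPE('a) n d \<le> ereal (2 / 3 * real n)" and b: "b \<noteq> 1" and c: "c \<noteq> 0"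
  shows "\<exists>v :: 'a. (b * v + c) ^ d = 1 + v ^ d"
proof -
  define N where "N = int (card {v :: 'a. (b * v + c) ^ d = 1 + v ^ d}) - 1"
  have W: "val_p p (weil_sum n d a) > ereal (2 / 3 * real n)" for a :: 'a
    using V by (auto simp: weil_V_le_iff not_le)
  have cyc: "weil_sum n d a \<in> cyc_int p" for a :: 'a by (simp add: weil_sum_eq wsum_cyc_int)
  let ?t = "\<lambda>a. weil_sum n d a * weil_sum n d (b * a) * weil_sum n d (c * a)"
  have "val_p p (?t a) > ereal (real (n + n))" for a :: 'a
  proof -
    have "val_p p (?t a) = val_p p (weil_sum n d a) + val_p p (weil_sum n d (b * a)) +
        val_p p (weil_sum n d (c * a))"
      using cyc by (simp add: val_p_mult[OF p_prime] cyc_int.mult)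
    thus ?thesis using W[of a] W[of "b * a"] W[of "c * a"]
      by (cases "val_p p (weil_sum n d a)"; cases "val_p p (weil_sum n d (b * a))";
          cases "val_p p (weil_sum n d (c * a))") auto
  qed
  hence "val_p p (\<Sum>a\<in>UNIV. ?t a) > ereal (real (n + n))"
    using cyc by (intro val_p_sum_gt[OF p_prime] cyc_int.mult) auto
  hence "val_p p (of_nat (p ^ (n + n)) * of_int N) > ereal (real (n + n))"
    unfolding third_moment[OF b c] N_def by (simp add: power_add)
  hence "ereal (real (n + n)) + val_p p (of_int N) > ereal (real (n + n))"
    using val_p_mult[OF p_prime cyc_int_of_nat cyc_int_of_int] val_p_of_nat_power[of "n + n"] by metis
  hence "val_p p (of_int N) > 0" by (cases "val_p p (of_int N)") auto
  hence "int p dvd N" using val_p_of_int_pos_iff[OF p_prime] by blast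
  hence "N \<noteq> - 1" using p_ge_2 by auto
  hence "card {v :: 'a. (b * v + c) ^ d = 1 + v ^ d} \<noteq> 0" by (simp add: N_def)
  thus ?thesis by (metis (mono_tags, lifting) card.empty empty_Collect_eq)
qed

text \<open>With \<open>r v\<close> the \<open>d\<close>-th root of \<open>1 + v ^ d\<close>, each map \<open>v \<mapsto> r v - b * v\<close> with \<open>b \<notin> {0, 1}\<close> is onto,
  hence injective; so no difference quotient of \<open>r\<close> can differ from \<open>1\<close>.\<close>

lemma additive_if_weil_V_large:
  assumes V: "\<not> weil_V TYPE('a) n d \<le> ereal (2 / 3 * real n)"
  shows "(v + 1 :: 'a) ^ d = v ^ d + 1"
proof -
  define r where "r = (\<lambda>v :: 'a. inv (\<lambda>x. x ^ d) (1 + v ^ d))"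
  have r: "r v ^ d = 1 + v ^ d" for v
    using surj_f_inv_f[OF bij_is_surj[OF bij_power_d], of "1 + v ^ d"] by (simp add: r_def)
  have injd: "x = y" if "x ^ d = y ^ d" for x y :: 'a
    using bij_power_d that by (metis bij_def injD)
  have "r v - r w = v - w" for v w
  proof (rule ccontr)
    assume neq: "r v - r w \<noteq> v - w"
    have vw: "v \<noteq> w" using neq by auto
    have "r v \<noteq> r w" using r[of v] r[of w] vw injd by (metis add_left_cancel)
    define b where "b = (r v - r w) / (v - w)"
    have b: "b \<noteq> 0" "b \<noteq> 1" using \<open>r v \<noteq> r w\<close> vw neq by (auto simp: b_def)
    have "surj (\<lambda>v. r v - b * v)"
      unfolding surj_def
    proof
      fix c :: 'a
      show "\<exists>v. c = r v - b * v"
      proof (cases "c = 0")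
        case False
        then obtain u where "(b * u + c) ^ d = 1 + u ^ d"
          using ex_solution_if_weil_V_large[OF V b(2)] by blast
        hence "b * u + c = r u" using r injd by metis
        thus ?thesis by (metis add_diff_cancel_left')
      next
        case True
        have "b ^ d \<noteq> 1" using b injd[of b 1] by auto
        \<comment> \<open>The case \<open>c = 0\<close> lies outside
          \<open>ex_solution_if_weil_V_large\<close>; here the equation is solved directly.\<close>
        obtain u where u: "u ^ d = 1 / (b ^ d - 1)" using bij_power_d by (metis bij_pointE)
        have "u ^ d * (b ^ d - 1) = 1" using u \<open>b ^ d \<noteq> 1\<close> by simp
        hence "(b * u) ^ d = 1 + u ^ d" by (simp add: power_mult_distrib algebra_simps)
        hence "b * u = r u" using r injd by metis
        thus ?thesis using True by (metis diff_self)
      qed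
    qed
    hence "inj (\<lambda>v. r v - b * v)" by (simp add: finite_UNIV_surj_inj)
    moreover have "b * (v - w) = r v - r w" using vw by (simp add: b_def)
    hence "r v - b * v = r w - b * w" by (simp add: algebra_simps)
    ultimately show False using vw by (auto dest: injD)
  qed
  from this[of v 0] have "r v = v + r 0" by (simp add: algebra_simps)
  moreover have "r 0 = 1" using r[of 0] injd[of "r 0" 1] d_pos by (simp add: power_0_left)
  ultimately show ?thesis using r[of v] by (simp add: add.commute)
qed

text \<open>Modulo \<open>p ^ n - 1\<close> write \<open>d\<close> as \<open>p ^ e * u\<close> with
  \<open>u\<close> prime to \<open>p\<close> and cancel Frobenius. For \<open>u \<ge> 2\<close>,
  \<open>(X + 1) ^ u - X ^ u - 1\<close> would vanish on the field although its degree is too small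
  and its coefficient at \<open>X ^ (u - 1)\<close> is \<open>u\<close>.\<close>

lemma additive_power_imp_power_of_p:
  assumes "\<And>v :: 'a. (v + 1) ^ d = v ^ d + 1"
  shows "\<exists>k. [d = p ^ k] (mod (p ^ n - 1))"
proof (cases "p ^ n - 1 = 1")
  case True
  thus ?thesis by (intro exI[of _ 0]) (simp add: cong_def)
next
  case False
  hence q: "p ^ n - 1 > 1" using power_p_gt_1[OF n_pos] by linarith
  define d1 where "d1 = d mod (p ^ n - 1)"
  have d1: "d1 < p ^ n - 1" using q by (simp add: d1_def)
  have "d1 \<noteq> 0"
  proof
    assume "d1 = 0"
    hence "p ^ n - 1 dvd d" by (auto simp: d1_def)
    hence "p ^ n - 1 dvd 1" using coprime_d by (meson coprime_common_divisor dvd_refl)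
    thus False using False by simp
  qed
  have red: "x ^ d = x ^ d1" for x :: 'a
  proof (cases "x = 0")
    case False
    have "x ^ (p ^ n - 1) = 1"
      using finite_field_power_card_minus_one[OF False] by (simp add: card_field)
    thus ?thesis by (rule power_cong_order) (simp add: d1_def cong_def)
  qed (use d_pos \<open>d1 \<noteq> 0\<close> in \<open>auto simp: power_0_left\<close>)
  obtain e u where u: "d1 = p ^ e * u" "\<not> p dvd u"
    using multiplicity_decompose'[of d1 p] \<open>d1 \<noteq> 0\<close> p_prime not_prime_unit by blast
  have "(v + 1 :: 'a) ^ u = v ^ u + 1" for v
  proof (rule inj_frobenius[of _ e])
    have "((v + 1) ^ u) ^ (p ^ e) = (v + 1) ^ d1" by (simp add: u(1) mult.commute flip: power_mult)
    also have "\<dots> = v ^ d1 + 1" using assms[of v] by (simp add: red)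
    also have "\<dots> = (v ^ u + 1) ^ (p ^ e)"
      by (simp add: u(1) frobenius_add mult.commute flip: power_mult)
    finally show "((v + 1) ^ u) ^ (p ^ e) = (v ^ u + 1) ^ (p ^ e)" .
  qed
  note add_u = this
  have u0: "u \<noteq> 0" using u by (metis dvd_0_right)
  have "u = 1"
  proof (rule ccontr)
    assume "u \<noteq> 1"
    with u0 have u2: "u \<ge> 2" by simp
    define f where "f = [:1, 1:] ^ u - monom 1 u - (1 :: 'a poly)"
    have "degree f \<le> u" unfolding f_def
      using degree_linear_power[of 1 u]
      by (intro degree_diff_le) (auto simp: degree_monom_le degree_power_eq)
    also have "u \<le> d1" using u(1) p_ge_2 by (cases "p ^ e") auto
    also have "d1 < CARD('a)" using d1 card_field by simp
    finally have deg: "degree f < CARD('a)" .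
    have roots: "{x. poly f x = 0} = UNIV"
      using add_u by (auto simp: f_def poly_monom poly_power add.commute)
    have "f = 0"
    proof (rule ccontr)
      assume "f \<noteq> 0"
      from card_poly_roots_bound[OF this] show False using deg roots by simp
    qed
    hence "coeff f (u - 1) = 0" by simp
    moreover have "coeff f (u - 1) = of_nat u"
      using u2 binomial_symmetric[of 1 u] by (simp add: f_def coeff_linear_poly_power)
    ultimately have "p dvd u" by (metis char of_nat_eq_0_iff_char_dvd)
    thus False using u(2) by blast
  qed
  hence "p ^ e = d mod (p ^ n - 1)" using u(1) by (simp add: d1_def)
  thus ?thesis by (intro exI[of _ e]) (simp add: cong_def)
qed

theorem weil_V_le_two_thirds:
  assumes "\<nexists>k. [d = p ^ k] (mod (p ^ n - 1))"
  shows "weil_V TYPE('a) n d \<le> ereal (2 / 3 * real n)"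
  using assms additive_if_weil_V_large additive_power_imp_power_of_p by blast

end

section \<open>Quadratic extensions\<close>

text \<open>All \<open>m\<close> digits of \<open>p ^ m - 1\<close> in base \<open>p\<close> are
  \<open>p - 1\<close>; \<open>es\<close> lists each position that often.\<close>

lemma ex_digit_list:
  fixes p :: nat
  assumes "p > 0"
  shows "\<exists>es. length es = m * (p - 1) \<and> (\<Sum>e\<leftarrow>es. p ^ e) = p ^ m - 1"
proof (induction m)
  case (Suc m)
  then obtain es where es: "length es = m * (p - 1)" "(\<Sum>e\<leftarrow>es. p ^ e) = p ^ m - 1" by blast
  have "p ^ m - 1 + (p - 1) * p ^ m = p ^ Suc m - 1"
    using assms by (simp add: diff_mult_distrib)
  thus ?case using es
    by (intro exI[of _ "es @ replicate (p - 1) m"]) (simp add: sum_list_replicate)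
qed simp

context weil_field
begin

lemma subfield_of_degree_closed:
  shows "0 \<in> subfield_of_degree m"
    and "x \<in> subfield_of_degree m \<Longrightarrow> y \<in> subfield_of_degree m \<Longrightarrow> x + y \<in> subfield_of_degree m"
    and "x \<in> subfield_of_degree m \<Longrightarrow> y \<in> subfield_of_degree m \<Longrightarrow> x - y \<in> subfield_of_degree m"
    and "x \<in> subfield_of_degree m \<Longrightarrow> x ^ k \<in> subfield_of_degree m"
    and "x \<in> subfield_of_degree m \<Longrightarrow> y \<in> subfield_of_degree m \<Longrightarrow> x / y \<in> subfield_of_degree m"
  using p_ge_2
  by (simp_all add: subfield_of_degree_def frobenius_add frobenius_diff power_divide)
     (metis mult.commute power_mult)

lemma subfield_of_degree_mono:
  assumes "m dvd k" shows "subfield_of_degree m \<subseteq> subfield_of_degree k"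
proof
  fix x assume x: "x \<in> subfield_of_degree m"
  obtain r where r: "k = m * r" using assms by auto
  have "x ^ (p ^ (m * i)) = x" for i
  proof (induction i)
    case (Suc i)
    have "x ^ (p ^ (m * Suc i)) = (x ^ (p ^ (m * i))) ^ (p ^ m)"
      by (simp add: power_add mult.commute flip: power_mult)
    thus ?case using Suc x by (simp add: subfield_of_degree_def)
  qed simp
  thus "x \<in> subfield_of_degree k" by (simp add: subfield_of_degree_def r)
qed

section \<open>Lines in a quadratic extension, seen as an affine plane\<close>

context
  fixes m :: nat
  assumes m: "m > 0" "2 * m dvd n"
    and d_cong: "[d = 1] (mod (p ^ m - 1))"
begin

private abbreviation (input) "R \<equiv> p ^ m"
private abbreviation (input) "Q \<equiv> p ^ (2 * m)"
private abbreviation (input) "L \<equiv> subfield_of_degree m"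
private abbreviation (input) "K \<equiv> subfield_of_degree (2 * m)"

text \<open>On \<open>K\<close> this is the relative trace to \<open>L\<close>.\<close>

definition rel_tr :: "'a \<Rightarrow> 'a" where "rel_tr y = y + y ^ R"

lemma R_gt_1: "R > 1" using m by (intro power_p_gt_1) simp

lemma Q_eq: "Q = R * R" by (simp add: power_add mult_2)

lemma R_less_Q: "R < Q"
proof -
  have "R * 1 < R * R" using R_gt_1 by (intro mult_strict_left_mono) linarith+
  thus ?thesis unfolding Q_eq mult_1_right .
qed

lemma card_K: "card K = Q" and card_L: "card L = R"
  using m by (auto intro!: card_subfield_of_degree dvd_trans[OF _ m(2)])

lemma L_subset_K: "L \<subseteq> K" by (rule subfield_of_degree_mono) simp

lemma rel_tr_in_L:
  assumes "y \<in> K" shows "rel_tr y \<in> L"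
proof -
  have "(y ^ R) ^ R = y" using assms unfolding subfield_of_degree_def Q_eq
    by (simp add: power_mult)
  thus ?thesis by (simp add: rel_tr_def subfield_of_degree_def frobenius_add add.commute)
qed

lemma rel_tr_diff: "rel_tr (x - y) = rel_tr x - rel_tr y"
  by (simp add: rel_tr_def frobenius_diff)

lemma rel_tr_scale: "c \<in> L \<Longrightarrow> rel_tr (c * y) = c * rel_tr y"
  by (simp add: rel_tr_def subfield_of_degree_def power_mult_distrib distrib_left)

lemma power_d_L: "c \<in> L \<Longrightarrow> c ^ d = c"
proof (cases "c = 0")
  case False
  assume "c \<in> L"
  hence "c ^ (R - 1) = 1" using False by (rule subfield_power_minus_one)
  from power_cong_order[OF this d_cong] show ?thesis by simp
qed (use d_pos in \<open>auto simp: power_0_left\<close>)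

text \<open>A fibre consists of roots of \<open>X ^ R + X - s\<close>, and \<open>R\<close> such
  fibres must exhaust the \<open>R * R\<close> elements of \<open>K\<close>.\<close>

lemma card_rel_tr_fibre:
  assumes "t \<in> L" shows "card {y \<in> K. rel_tr y = t} = R"
proof -
  have le: "card {y \<in> K. rel_tr y = s} \<le> R" for s
  proof -
    let ?f = "monom 1 R + [:- s, 1:] :: 'a poly"
    have "coeff ?f R = 1" using R_gt_1 m p_ge_2 by (auto simp: coeff_pCons split: nat.splits)
    hence nz: "?f \<noteq> 0" by (metis coeff_0 one_neq_zero)
    have "{y \<in> K. rel_tr y = s} \<subseteq> {y. poly ?f y = 0}"
      by (auto simp: poly_monom rel_tr_def algebra_simps)
    hence "card {y \<in> K. rel_tr y = s} \<le> card {y. poly ?f y = 0}" by (intro card_mono) auto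
    also have "\<dots> \<le> degree ?f" by (rule card_poly_roots_bound[OF nz])
    also have "\<dots> \<le> R" using R_gt_1 by (intro degree_add_le degree_monom_le) simp
    finally show ?thesis .
  qed
  have "K = (\<Union>s\<in>L. {y \<in> K. rel_tr y = s})" using rel_tr_in_L by auto
  hence "Q = card (\<Union>s\<in>L. {y \<in> K. rel_tr y = s})" using card_K by simp
  also have "\<dots> = (\<Sum>s\<in>L. card {y \<in> K. rel_tr y = s})" by (intro card_UN_disjoint) auto
  also have "\<dots> = card {y \<in> K. rel_tr y = t} + (\<Sum>s\<in>L - {t}. card {y \<in> K. rel_tr y = s})"
    using assms by (intro sum.remove) auto
  also have "\<dots> \<le> card {y \<in> K. rel_tr y = t} + (\<Sum>s\<in>L - {t}. R)"
    by (intro add_left_mono sum_mono le)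
  also have "(\<Sum>s\<in>L - {t}. R) = (R - 1) * R" using assms card_L by simp
  finally have "R * R \<le> card {y \<in> K. rel_tr y = t} + (R - 1) * R" by (simp add: Q_eq)
  moreover have "(R - 1) * R = R * R - R" by (simp add: diff_mult_distrib)
  ultimately have "R \<le> card {y \<in> K. rel_tr y = t}" using le_square[of R] by linarith
  thus ?thesis using le[of t] by simp
qed

lemma card_line:
  assumes "x \<in> K" "x \<noteq> 0" "t \<in> L"
  shows "card {a \<in> K. rel_tr (a * x) = t} = R"
proof -
  have "{a \<in> K. rel_tr (a * x) = t} = (\<lambda>y. y / x) ` {y \<in> K. rel_tr y = t}"
  proof (intro equalityI subsetI)
    fix a assume "a \<in> {a \<in> K. rel_tr (a * x) = t}"
    thus "a \<in> (\<lambda>y. y / x) ` {y \<in> K. rel_tr y = t}"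
      using assms by (intro image_eqI[of _ _ "a * x"]) (auto intro: subfield_of_degree_mult)
  qed (use assms in \<open>auto intro: subfield_of_degree_closed(5)\<close>)
  moreover have "inj_on (\<lambda>y. y / x) {y \<in> K. rel_tr y = t}" using assms by (intro inj_onI) simp
  ultimately show ?thesis using card_rel_tr_fibre[OF assms(3)] by (simp add: card_image)
qed

text \<open>If two points had the same pair of traces, their difference \<open>c\<close> would make
  the \<open>R\<close>-th power negate both \<open>c * x\<close> and \<open>c * y\<close>, putting
  \<open>y / x\<close> into \<open>L\<close>. Counting then gives a bijection of \<open>K\<close>
  with \<open>L \<times> L\<close>.\<close>

lemma card_line_inter:
  assumes x: "x \<in> K" "x \<noteq> 0" and y: "y \<in> K" "y \<noteq> 0" "y / x \<notin> L" and st: "s \<in> L" "t \<in> L"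
  shows "card {a \<in> K. rel_tr (a * x) = s \<and> rel_tr (a * y) = t} = 1"
proof -
  let ?g = "\<lambda>a. (rel_tr (a * x), rel_tr (a * y))"
  have inj: "inj_on ?g K"
  proof (rule inj_onI, rule ccontr)
    fix a b assume ab: "a \<in> K" "b \<in> K" "?g a = ?g b" "a \<noteq> b"
    define c where "c = a - b"
    have c: "c \<noteq> 0" "c \<in> K" using ab subfield_of_degree_closed(3) by (auto simp: c_def)
    have "rel_tr (c * x) = 0" "rel_tr (c * y) = 0"
      using ab(3) by (simp_all add: c_def left_diff_distrib rel_tr_diff)
    hence "(c * x) ^ R = - (c * x)" "(c * y) ^ R = - (c * y)"
      by (simp_all add: rel_tr_def add_eq_0_iff)
    hence "((c * y) / (c * x)) ^ R = (c * y) / (c * x)"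
      by (simp only: power_divide) simp
    moreover have "(c * y) / (c * x) = y / x" using c by simp
    ultimately show False using y(3) by (simp add: subfield_of_degree_def)
  qed
  have "?g ` K = L \<times> L"
  proof (rule card_seteq)
    show "?g ` K \<subseteq> L \<times> L" using x y rel_tr_in_L by (auto intro: subfield_of_degree_mult)
    show "card (L \<times> L) \<le> card (?g ` K)"
      by (simp add: card_image[OF inj] card_cartesian_product card_K card_L Q_eq)
  qed simp
  then obtain a where a: "a \<in> K" "?g a = (s, t)" using st by (metis (no_types, lifting) SigmaI imageE)
  have "{a \<in> K. rel_tr (a * x) = s \<and> rel_tr (a * y) = t} = {a}"
    using a inj by (auto dest: inj_onD)
  thus ?thesis by simp
qed

definition T :: "'a \<Rightarrow> 'a \<Rightarrow> 'a" where "T a x = rel_tr (x ^ d - a * x)"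

lemma T_eq_0_iff: "T a x = 0 \<longleftrightarrow> rel_tr (a * x) = rel_tr (x ^ d)"
  by (auto simp: T_def rel_tr_diff)

lemma T_in_L: "a \<in> K \<Longrightarrow> x \<in> K \<Longrightarrow> T a x \<in> L"
  unfolding T_def by (intro rel_tr_in_L subfield_of_degree_closed subfield_of_degree_mult)

lemma T_scale: "c \<in> L \<Longrightarrow> T a (c * x) = c * T a x"
  using rel_tr_scale[of c "x ^ d - a * x"] power_d_L[of c]
  by (simp add: T_def power_mult_distrib algebra_simps)

text \<open>Nonzero \<open>L\<close>-multiples of \<open>x\<close> give the same line, so
  \<open>sols a\<close> has 0 and \<open>R - 1\<close> elements per line through \<open>a\<close>;
  \<open>card (sols a) \<ge> R\<close> means that \<open>a\<close> is covered.\<close>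

definition sols :: "'a \<Rightarrow> 'a set" where "sols a = {x \<in> K. T a x = 0}"

text \<open>For fixed \<open>x \<noteq> 0\<close> the set \<open>{a \<in> K. T a x = 0}\<close> is an affine line over \<open>L\<close>. These \<open>R + 1\<close>
  lines have pairwise different directions, so each of them carries the whole excess
  \<open>\<Sum>a\<in>K. (card (sols a) - R)\<close> once every point is covered.\<close>

lemma concurrent:
  assumes covered: "\<And>a. a \<in> K \<Longrightarrow> card (sols a) \<ge> R"
  shows "\<exists>a\<in>K. \<forall>x\<in>K. T a x = 0"
proof -
  have TK: "rel_tr (x ^ d) \<in> L" if "x \<in> K" for x
    using that by (intro rel_tr_in_L subfield_of_degree_closed)
  have zero: "T a 0 = 0" for a
    using d_pos p_ge_2 by (simp add: T_def rel_tr_def power_0_left)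
  have swap: "(\<Sum>a\<in>A. card (sols a)) = (\<Sum>x\<in>K. card {a \<in> A. T a x = 0})" if "A \<subseteq> K" for A
  proof -
    have "(\<Sum>a\<in>A. card (sols a)) = (\<Sum>a\<in>A. \<Sum>x\<in>K. if T a x = 0 then 1 else 0)"
      by (simp add: sols_def sum.If_cases Int_def)
    also have "\<dots> = (\<Sum>x\<in>K. \<Sum>a\<in>A. if T a x = 0 then 1 else 0)" by (rule sum.swap)
    finally show ?thesis by (simp add: sum.If_cases Int_def)
  qed
  have line: "card {a \<in> K. T a x = 0} = R" if "x \<in> K" "x \<noteq> 0" for x
    using card_line[OF that TK[OF that(1)]] by (simp add: T_eq_0_iff)
  have zK: "0 \<in> K" and zL: "0 \<in> L" by (simp_all add: subfield_of_degree_closed)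
  have total: "(\<Sum>a\<in>K. card (sols a)) = Q * R + (Q - R)"
  proof -
    have "(\<Sum>a\<in>K. card (sols a)) = card {a \<in> K. T a 0 = 0} + (\<Sum>x\<in>K - {0}. card {a \<in> K. T a x = 0})"
      using zK by (subst swap) (auto intro: sum.remove)
    also have "(\<Sum>x\<in>K - {0}. card {a \<in> K. T a x = 0}) = (Q - 1) * R"
      using zK by (simp add: line card_K)
    also have "card {a \<in> K. T a 0 = 0} = Q" by (simp add: zero card_K)
    finally show ?thesis using R_gt_1 by (simp add: Q_eq diff_mult_distrib)
  qed
  \<comment> \<open>All \<open>R\<close> points count for each \<open>L\<close>-multiple of
    \<open>x\<close>, and one point for every other \<open>y\<close>. The excess over
    \<open>R\<close> per point is \<open>Q - R\<close>, the same as in \<open>total\<close>.\<close>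
  have line_total: "(\<Sum>a | a \<in> K \<and> T a x = 0. card (sols a)) = Q + (Q - R)"
    if x: "x \<in> K" "x \<noteq> 0" for x
  proof -
    let ?A = "{a \<in> K. T a x = 0}" and ?Lx = "(\<lambda>c. c * x) ` L"
    have injx: "inj_on (\<lambda>c. c * x) L" using x by (auto intro: inj_onI)
    have LxK: "?Lx \<subseteq> K" using L_subset_K x by (auto intro: subfield_of_degree_mult)
    have "(\<Sum>a\<in>?A. card (sols a)) = (\<Sum>y\<in>K. card {a \<in> ?A. T a y = 0})" by (rule swap) auto
    also have "\<dots> = (\<Sum>y\<in>?Lx. card {a \<in> ?A. T a y = 0}) + (\<Sum>y\<in>K - ?Lx. card {a \<in> ?A. T a y = 0})"
      using sum.subset_diff[OF LxK] by (simp add: add.commute)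
    also have "(\<Sum>y\<in>?Lx. card {a \<in> ?A. T a y = 0}) = (\<Sum>y\<in>?Lx. R)"
    proof (intro sum.cong refl)
      fix y assume "y \<in> ?Lx"
      then obtain c where "c \<in> L" "y = c * x" by auto
      hence "{a \<in> ?A. T a y = 0} = ?A" by (auto simp: T_scale)
      thus "card {a \<in> ?A. T a y = 0} = R" using line[OF x] by simp
    qed
    also have "\<dots> = Q" by (simp add: card_image[OF injx] card_L Q_eq)
    also have "(\<Sum>y\<in>K - ?Lx. card {a \<in> ?A. T a y = 0}) = (\<Sum>y\<in>K - ?Lx. 1)"
    proof (intro sum.cong refl)
      fix y assume y: "y \<in> K - ?Lx"
      have "y \<noteq> 0" using y zL by force
      moreover have "y / x \<notin> L" using y x by force
      moreover have "{a \<in> ?A. T a y = 0} =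
          {a \<in> K. rel_tr (a * x) = rel_tr (x ^ d) \<and> rel_tr (a * y) = rel_tr (y ^ d)}"
        by (auto simp: T_eq_0_iff)
      ultimately show "card {a \<in> ?A. T a y = 0} = 1"
        using card_line_inter[OF x, of y] TK x y by simp
    qed
    also have "\<dots> = Q - R" using LxK by (simp add: card_Diff_subset card_K card_image[OF injx] card_L)
    finally show ?thesis .
  qed
  have "\<exists>a\<in>K. card (sols a) > R"
  proof (rule ccontr)
    assume "\<not> ?thesis"
    hence "(\<Sum>a\<in>K. card (sols a)) \<le> (\<Sum>a\<in>K. R)" by (intro sum_mono) (simp add: not_less)
    thus False using total R_less_Q by (simp add: card_K)
  qed
  then obtain a where a: "a \<in> K" "card (sols a) > R" by blast
  \<comment> \<open>A line missing \<open>a\<close> would carry the whole excess, although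
    \<open>a\<close> has a positive excess of its own.\<close>
  have "T a x = 0" if x: "x \<in> K" for x
  proof (rule ccontr)
    assume Tx: "T a x \<noteq> 0"
    hence x0: "x \<noteq> 0" using zero by auto
    let ?A = "{a \<in> K. T a x = 0}"
    have cardB: "card (K - ?A) = Q - R"
      using line[OF x x0] by (simp add: card_Diff_subset card_K)
    have "(Q - R) * R = (\<Sum>b\<in>K - ?A. R)" by (simp add: cardB)
    also have "\<dots> < (\<Sum>b\<in>K - ?A. card (sols b))"
      using a Tx covered by (intro sum_strict_mono_ex1) auto
    finally have "Q + (Q - R) + (Q - R) * R < (\<Sum>b\<in>?A. card (sols b)) + (\<Sum>b\<in>K - ?A. card (sols b))"
      using line_total[OF x x0] by simp
    also have "\<dots> = (\<Sum>b\<in>K. card (sols b))" by (subst sum.subset_diff[of ?A K]) auto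
    also have "\<dots> = Q * R + (Q - R)" by (rule total)
    finally show False using R_less_Q by (simp add: Q_eq diff_mult_distrib)
  qed
  thus ?thesis using a by blast
qed

text \<open>A Frobenius power of \<open>T a x\<close> combines four monomials with exponents
  \<open>p ^ j\<close> or \<open>d * p ^ j\<close>, so expanding it adds one term to the
  \<open>psum\<close>; with \<open>N\<close> terms \<open>sum_power_subfield\<close>
  applies.\<close>

lemma power_sum_T_zero:
  assumes no: "\<And>z. psum p d N z \<Longrightarrow> \<not> Q - 1 dvd z" and N: "N > 0"
    and "psum p d k z" "k + length es = N"
  shows "(\<Sum>x\<in>K. x ^ z * (\<Prod>e\<leftarrow>es. T a x ^ (p ^ e))) = 0"
  using assms(3,4)
proof (induction es arbitrary: k z)
  case Nil
  hence "z > 0" using psum_pos N d_pos p_prime prime_gt_0_nat by auto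
  thus ?case using sum_power_subfield[of "2 * m" z] m no Nil by simp
next
  case (Cons e es)
  let ?P = "\<lambda>x. \<Prod>e\<leftarrow>es. T a x ^ (p ^ e)"
  let ?S = "\<lambda>z. \<Sum>x\<in>K. x ^ z * ?P x"
  have IH: "?S (z + y) = 0" if "psum p d (Suc k) (z + y)" for y
    using Cons.IH[OF that] Cons.prems by simp
  have T: "T a x ^ (p ^ e) = x ^ (d * p ^ e) - a ^ (p ^ e) * x ^ (p ^ e) +
      (x ^ (d * p ^ (m + e)) - a ^ (p ^ (m + e)) * x ^ (p ^ (m + e)))" for x
    by (simp add: T_def rel_tr_def frobenius_add frobenius_diff power_mult_distrib power_add mult_ac
        flip: power_mult)
  have "x ^ z * (\<Prod>e\<leftarrow>e # es. T a x ^ (p ^ e)) =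
      x ^ (z + d * p ^ e) * ?P x - a ^ (p ^ e) * (x ^ (z + p ^ e) * ?P x) +
      (x ^ (z + d * p ^ (m + e)) * ?P x - a ^ (p ^ (m + e)) * (x ^ (z + p ^ (m + e)) * ?P x))" for x
    by (simp add: T power_add[of x] algebra_simps)
  hence "(\<Sum>x\<in>K. x ^ z * (\<Prod>e\<leftarrow>e # es. T a x ^ (p ^ e))) =
      ?S (z + d * p ^ e) - a ^ (p ^ e) * ?S (z + p ^ e) +
      (?S (z + d * p ^ (m + e)) - a ^ (p ^ (m + e)) * ?S (z + p ^ (m + e)))"
    by (simp add: sum.distrib sum_subtractf sum_distrib_left)
  thus ?case using Cons.prems(1) by (simp add: IH psum.one psum.exponent del: power_Suc)
qed

text \<open>Expanding \<open>T a x ^ (R - 1)\<close> shows that \<open>p\<close> divides \<open>card (sols a)\<close>. As \<open>0\<close> is a solution, there is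
  a nonzero one, hence a whole \<open>L\<close>-line of them.\<close>

lemma quadratic_step:
  assumes no: "\<And>z. psum p d (m * (p - 1)) z \<Longrightarrow> \<not> Q - 1 dvd z"
  shows "[d = 1] (mod (Q - 1)) \<or> [d = R] (mod (Q - 1))"
proof -
  have p0: "p > 0" using p_ge_2 by simp
  have pos: "m * (p - 1) > 0" using m p_ge_2 by simp
  have zK: "0 \<in> K" by (simp add: subfield_of_degree_closed)
  have covered: "card (sols a) \<ge> R" if a: "a \<in> K" for a
  proof -
    obtain es where es: "length es = m * (p - 1)" "(\<Sum>e\<leftarrow>es. p ^ e) = R - 1"
      using ex_digit_list[OF p0] by blast
    have "(\<Prod>e\<leftarrow>es. y ^ (p ^ e)) = y ^ (\<Sum>e\<leftarrow>es. p ^ e)" for y :: 'a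
      by (induction es) (simp_all add: power_add)
    hence "(\<Sum>x\<in>K. T a x ^ (R - 1)) = 0"
      using power_sum_T_zero[OF no pos psum.zero, of es a] es by simp
    \<comment> \<open>Nonzero values in \<open>L\<close> have \<open>(R - 1)\<close>-st power 1, so
      the sum counts the non-solutions.\<close>
    moreover have "(\<Sum>x\<in>K. T a x ^ (R - 1)) = (\<Sum>x\<in>K. 1 - (if T a x = 0 then 1 else 0))"
      using subfield_power_minus_one[of _ m] T_in_L[OF a] R_gt_1
      by (intro sum.cong) (auto simp: power_0_left)
    moreover have "\<dots> = of_nat (card K) - of_nat (card (sols a))"
      by (simp add: sum_subtractf sum.If_cases sols_def Int_def)
    ultimately have "of_nat (card (sols a)) = (0 :: 'a)"
      using of_nat_power_p[of "2 * m"] m by (simp add: card_K)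
    hence dvd: "p dvd card (sols a)" by (metis char of_nat_eq_0_iff_char_dvd)
    have "0 \<in> sols a" using zK d_pos p_ge_2 by (simp add: sols_def T_def rel_tr_def power_0_left)
    hence "card (sols a) \<noteq> 1 \<and> card (sols a) > 0" using dvd p_ge_2 by (auto simp: card_gt_0_iff)
    hence "sols a \<noteq> {0}" by auto
    then obtain x where x: "x \<in> sols a" "x \<noteq> 0" using \<open>0 \<in> sols a\<close> by blast
    have "(\<lambda>c. c * x) ` L \<subseteq> sols a"
      using x L_subset_K by (auto simp: sols_def T_scale intro: subfield_of_degree_mult)
    hence "card ((\<lambda>c. c * x) ` L) \<le> card (sols a)" by (intro card_mono) auto
    moreover have "card ((\<lambda>c. c * x) ` L) = R"
      using x card_L by (subst card_image) (auto intro: inj_onI)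
    ultimately show ?thesis by simp
  qed
  obtain a where a: "a \<in> K" "\<forall>x\<in>K. T a x = 0" using concurrent[OF covered] by blast
  show ?thesis
  proof (rule ccontr)
    assume neg: "\<not> ?thesis"
    have Q2: "Q - 1 > 1"
    proof -
      have "R * R \<ge> 2 * 2" using R_gt_1 by (intro mult_mono) auto
      thus ?thesis by (simp add: Q_eq)
    qed
    have "Q - 1 dvd p ^ n - 1"
      using m(2) power_minus_one_dvd[of Q] by (auto simp: power_mult elim!: dvdE)
    hence cop: "coprime d (Q - 1)" using coprime_d by (meson coprime_divisors dvd_refl)
    \<comment> \<open>\<open>w\<close> represents \<open>- d\<close> modulo \<open>Q - 1\<close>.
      Multiplying \<open>T a x = 0\<close> by \<open>x ^ w\<close> and summing isolates the term
      \<open>x ^ d\<close>; the others drop out if \<open>d\<close> is neither 1 nor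
      \<open>R\<close>.\<close>
    define w where "w = d * (Q - 2)"
    have w0: "w > 0" using d_pos Q2 by (simp add: w_def)
    have wd: "w + d = d * (Q - 1)" 
    proof -
      have "Q - 1 = Suc (Q - 2)" using Q2 by linarith
      thus ?thesis by (simp only: w_def mult_Suc_right add.commute)
    qed
    have ndvd: "\<not> Q - 1 dvd w + c" if "\<not> [d = c] (mod (Q - 1))" for c
    proof
      assume "Q - 1 dvd w + c"
      hence "[w + c = w + d] (mod (Q - 1))" unfolding wd by (simp add: cong_def mod_eq_0_iff_dvd)
      hence "[c = d] (mod (Q - 1))" by (simp add: cong_add_lcancel_nat)
      thus False using that by (simp add: cong_sym_eq)
    qed
    have ndR: "\<not> [d = d * R] (mod (Q - 1))"
    proof
      assume "[d = d * R] (mod (Q - 1))"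
      hence "[1 = R] (mod (Q - 1))" using cop
        by (metis cong_mult_lcancel_nat coprime_commute mult.right_neutral)
      hence "Q - 1 dvd R - 1" using R_gt_1
        by (metis cong_altdef_nat cong_sym less_imp_le)
      hence "Q - 1 \<le> R - 1" using R_gt_1 by (intro dvd_imp_le) auto
      thus False using R_gt_1 R_less_Q by linarith
    qed
    have "(\<Sum>x\<in>K. x ^ w * T a x) = 0" using a by simp
    moreover have "x ^ w * T a x =
        x ^ (w + d) + x ^ (w + d * R) - a * x ^ (w + 1) - a ^ R * x ^ (w + R)" for x
      by (simp add: T_def rel_tr_def frobenius_diff power_mult_distrib power_add algebra_simps
          flip: power_mult)
    ultimately have "(\<Sum>x\<in>K. x ^ (w + d)) + (\<Sum>x\<in>K. x ^ (w + d * R)) -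
        a * (\<Sum>x\<in>K. x ^ (w + 1)) - a ^ R * (\<Sum>x\<in>K. x ^ (w + R)) = 0"
      by (simp add: sum.distrib sum_subtractf sum_distrib_left)
    moreover have S: "(\<Sum>x\<in>K. x ^ (w + c)) = (if Q - 1 dvd w + c then - 1 else 0)" for c
      using m w0 by (intro sum_power_subfield) auto
    have "(\<Sum>x\<in>K. x ^ (w + d)) = - 1" by (subst S) (simp only: wd dvd_triv_right if_True)
    moreover have "(\<Sum>x\<in>K. x ^ (w + d * R)) = 0"
      using S[of "d * R"] ndvd[OF ndR] by (simp only: if_False)
    moreover have "(\<Sum>x\<in>K. x ^ (w + 1)) = 0" "(\<Sum>x\<in>K. x ^ (w + R)) = 0"
      using S[of 1] S[of R] ndvd[of 1] ndvd[of R] neg by presburger+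
    ultimately show False
      by (simp only: mult_zero_right diff_zero add_0_right neg_equal_0_iff_equal one_neq_zero)
  qed
qed

end
end

section \<open>The exceptional exponent\<close>

text \<open>The least absolute residue of \<open>d\<close> works with \<open>c = 1\<close> unless it
  is near half the modulus. Coprimality excludes the half itself, and tripling moves
  \<open>2 * \<nu> - 1\<close> and \<open>2 * \<nu> + 3\<close> away from it.\<close>

lemma ex_small_residue:
  fixes \<nu> d :: int
  assumes \<nu>: "\<nu> \<ge> 3" and d: "odd d" "coprime d (2 * \<nu> + 1)"
  shows "\<exists>c r. (c = 1 \<or> c = 3) \<and> odd r \<and> 4 * \<nu> + 2 dvd c * d - r \<and> c + \<bar>r\<bar> \<le> 2 * \<nu> - 2"
proof -
  define M where "M = 4 * \<nu> + 2"
  define \<rho> where "\<rho> = d mod M"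
  define k where "k = d div M"
  have dk: "d = M * k + \<rho>" by (simp add: \<rho>_def k_def)
  have \<rho>: "0 \<le> \<rho>" "\<rho> < M" using \<nu> by (simp_all add: \<rho>_def M_def)
  have evM: "even M" by (simp add: M_def)
  have odd_\<rho>: "odd \<rho>" using d(1) evM by (simp add: dk)
  have ne: "\<rho> \<noteq> 2 * \<nu> + 1"
  proof
    assume "\<rho> = 2 * \<nu> + 1"
    hence "d = (2 * \<nu> + 1) * (2 * k + 1)" by (simp add: dk M_def algebra_simps)
    hence "is_unit (2 * \<nu> + 1)" using d(2) by (metis coprime_common_divisor dvd_refl dvd_triv_left)
    thus False using \<nu> by simp
  qed
  have "\<rho> \<le> 2 * \<nu> - 3 \<or> \<rho> \<ge> 2 * \<nu> + 5 \<or> \<rho> = 2 * \<nu> - 1 \<or> \<rho> = 2 * \<nu> + 3"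
    using odd_\<rho> ne by presburger
  then consider "\<rho> \<le> 2 * \<nu> - 3" | "\<rho> \<ge> 2 * \<nu> + 5" | "\<rho> = 2 * \<nu> - 1" | "\<rho> = 2 * \<nu> + 3"
    by blast
  thus ?thesis
  proof cases
    case 1
    hence "odd \<rho> \<and> M dvd 1 * d - \<rho> \<and> 1 + \<bar>\<rho>\<bar> \<le> 2 * \<nu> - 2" using odd_\<rho> \<rho> by (simp add: dk)
    thus ?thesis unfolding M_def by blast
  next
    case 2
    have "1 * d - (\<rho> - M) = M * (k + 1)" by (simp add: dk algebra_simps)
    hence "odd (\<rho> - M) \<and> M dvd 1 * d - (\<rho> - M) \<and> 1 + \<bar>\<rho> - M\<bar> \<le> 2 * \<nu> - 2"
      using 2 odd_\<rho> evM \<rho> by (simp add: M_def)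
    thus ?thesis unfolding M_def by blast
  next
    case 3
    have "3 * d - (2 * \<nu> - 5) = M * (3 * k + 1)" by (simp add: dk 3 M_def algebra_simps)
    hence "odd (2 * \<nu> - 5) \<and> M dvd 3 * d - (2 * \<nu> - 5) \<and> 3 + \<bar>2 * \<nu> - 5\<bar> \<le> 2 * \<nu> - 2"
      using \<nu> by simp
    thus ?thesis unfolding M_def by blast
  next
    case 4
    have "3 * d - (5 - 2 * \<nu>) = M * (3 * k + 2)" by (simp add: dk 4 M_def algebra_simps)
    hence "odd (5 - 2 * \<nu>) \<and> M dvd 3 * d - (5 - 2 * \<nu>) \<and> 3 + \<bar>5 - 2 * \<nu>\<bar> \<le> 2 * \<nu> - 2"
      using \<nu> by simp
    thus ?thesis unfolding M_def by blast
  qed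
qed

lemma psum_two_digits:
  "psum p d (x0 + x1 + y0 + y1) (d * (x0 + x1 * p) + (y0 + y1 * p))"
proof -
  have "psum p d (x0 + x1 + y0 + y1)
      (x0 * (d * p ^ 0) + x1 * (d * p ^ 1) + y0 * p ^ 0 + y1 * p ^ 1)"
    by (intro psum_add psum_digit psum_exponent_digit)
  thus ?thesis by (simp add: algebra_simps)
qed

text \<open>The sum is sought with digits \<open>(c, 0)\<close> for \<open>J\<close> and \<open>(y0, y1)\<close> for \<open>J'\<close>, where \<open>y0 + y1 = 2 * \<nu> - c\<close>
  and \<open>y0 - y1 = - r\<close>. It is then a multiple of \<open>(p\<^sup>2 - 1) / 2\<close>; moving \<open>(1, 1)\<close> from \<open>J'\<close> to \<open>J\<close> changes the
  parity of the cofactor.\<close>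

lemma ex_psum_exceptional:
  fixes p d \<nu> :: nat
  assumes p: "p = 4 * \<nu> + 1" and \<nu>: "\<nu> \<ge> 3" and d: "[d = 1 + 2 * \<nu>] (mod (4 * \<nu>))"
    and cop: "coprime d (2 * \<nu> + 1)"
  shows "\<exists>z. psum p d (2 * \<nu>) z \<and> p ^ 2 - 1 dvd z"
proof -
  let ?\<nu> = "int \<nu>"
  have "[int d = 1 + 2 * ?\<nu>] (mod (4 * ?\<nu>))" using iffD2[OF cong_int_iff d] by simp
  hence "4 * ?\<nu> dvd int d - (1 + 2 * ?\<nu>)" by (simp add: cong_iff_dvd_diff)
  then obtain h where "int d - (1 + 2 * ?\<nu>) = 4 * ?\<nu> * h" by (auto elim: dvdE)
  hence h: "int d = 1 + 2 * ?\<nu> + 4 * ?\<nu> * h" by simp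
  have "odd (int d)" by (simp add: h)
  moreover have "coprime (int d) (2 * ?\<nu> + 1)"
    using iffD2[OF coprime_int_iff cop] by (simp add: add.commute)
  ultimately obtain c r where c: "c = 1 \<or> c = 3" "odd r" "4 * ?\<nu> + 2 dvd c * int d - r"
    "c + \<bar>r\<bar> \<le> 2 * ?\<nu> - 2"
    using ex_small_residue[of ?\<nu> "int d"] \<nu> by auto
  have odd_c: "odd c" using c(1) by auto
  define y0 where "y0 = (2 * ?\<nu> - c - r) div 2"
  define y1 where "y1 = (2 * ?\<nu> - c + r) div 2"
  have y: "2 * y0 = 2 * ?\<nu> - c - r" "2 * y1 = 2 * ?\<nu> - c + r"
    unfolding y0_def y1_def using odd_c c(2) by auto
  have y1: "y0 \<ge> 1" "y1 \<ge> 1" using y c(4) by linarith+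
  define A where "A = 4 * ?\<nu> * (2 * ?\<nu> + 1)"
  have p2: "int (p ^ 2 - 1) = 2 * A"
    by (simp add: p A_def power2_eq_square of_nat_diff algebra_simps)
  define z where "z = int d * c + (y0 + y1 * int p)"
  \<comment> \<open>Modulo \<open>p - 1\<close> the part \<open>y0 + y1 * p\<close> counts as
    \<open>y0 + y1\<close>; modulo \<open>(p + 1) / 2\<close>, below, as
    \<open>y0 - y1\<close>.\<close>
  have "4 * ?\<nu> dvd z"
  proof -
    obtain e where e: "c = 2 * e + 1" using odd_c by (auto elim: oddE)
    have "z = int d * c + (y0 + y1) + 4 * ?\<nu> * y1" by (simp add: z_def p algebra_simps)
    also have "y0 + y1 = 2 * ?\<nu> - c" using y by linarith
    also have "int d * c + (2 * ?\<nu> - c) + 4 * ?\<nu> * y1 = 4 * ?\<nu> * (e + 1 + h * c + y1)"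
      by (simp add: h e algebra_simps)
    finally show ?thesis by simp
  qed
  moreover have "2 * ?\<nu> + 1 dvd z"
  proof -
    have "z = int d * c + (y0 - y1) + (4 * ?\<nu> + 2) * y1" by (simp add: z_def p algebra_simps)
    also have "y0 - y1 = - r" using y by linarith
    finally have "z = (c * int d - r) + (4 * ?\<nu> + 2) * y1" by (simp add: mult.commute)
    hence "4 * ?\<nu> + 2 dvd z" using c(3) by simp
    moreover have "4 * ?\<nu> + 2 = (2 * ?\<nu> + 1) * 2" by simp
    ultimately show ?thesis by (metis dvd_mult_left)
  qed
  moreover have "coprime (4 * ?\<nu>) (2 * ?\<nu> + 1)"
  proof -
    have "coprime (2 * ?\<nu>) (2 * ?\<nu> + 1)" by (rule coprime_add_one_right)
    moreover have "coprime 2 (2 * ?\<nu> + 1)" by simp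
    moreover have "4 * ?\<nu> = 2 * (2 * ?\<nu>)" by simp
    ultimately show ?thesis by (simp only: coprime_mult_left_iff)
  qed
  ultimately have "A dvd z" unfolding A_def by (rule divides_mult)
  then obtain s where s: "z = A * s" by (auto elim: dvdE)
  show ?thesis
  proof (cases "even s")
    case True
    then obtain s' where "s = 2 * s'" by (auto elim: evenE)
    hence "int (p ^ 2 - 1) dvd z" by (simp only: p2 s) simp
    moreover have "z = int (d * (nat c + 0 * p) + (nat y0 + nat y1 * p))"
      using y1 c(1) by (auto simp: z_def)
    ultimately have "p ^ 2 - 1 dvd d * (nat c + 0 * p) + (nat y0 + nat y1 * p)"
      by (simp only: of_nat_dvd_iff)
    moreover have "nat c + 0 + nat y0 + nat y1 = 2 * \<nu>" using y y1 c(1) by auto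
    ultimately show ?thesis using psum_two_digits[of p d "nat c" 0 "nat y0" "nat y1"] by metis
  next
    case False
    then obtain s' where s': "s = 2 * s' + 1" by (auto elim: oddE)
    \<comment> \<open>The added term is \<open>A * (2 * h + 1)\<close>, an odd multiple of
      \<open>A\<close>; the digits \<open>y0\<close> and \<open>y1\<close> are positive and can give
      up 1 each.\<close>
    define z' where "z' = z + (int d - 1) * (int p + 1)"
    have "z' = 2 * A * (s' + 1 + h)" by (simp add: z'_def s s' h p A_def algebra_simps)
    hence "int (p ^ 2 - 1) dvd z'" by (simp only: p2) simp
    moreover have "z' = int (d * (nat (c + 1) + 1 * p) + (nat (y0 - 1) + nat (y1 - 1) * p))"
      using y1 c(1) by (auto simp: z'_def z_def algebra_simps)
    ultimately have "p ^ 2 - 1 dvd d * (nat (c + 1) + 1 * p) + (nat (y0 - 1) + nat (y1 - 1) * p)"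
      by (simp only: of_nat_dvd_iff)
    moreover have "nat (c + 1) + 1 + nat (y0 - 1) + nat (y1 - 1) = 2 * \<nu>" using y y1 c(1) by auto
    ultimately show ?thesis
      using psum_two_digits[of p d "nat (c + 1)" 1 "nat (y0 - 1)" "nat (y1 - 1)"] by metis
  qed
qed

section \<open>The upper bounds\<close>

context weil_field
begin

text \<open>In the tower of subfields of degree \<open>2 ^ i\<close>, at some step \<open>d\<close>
  turns nondegenerate. A twist by a power of \<open>p\<close> makes it 1 on the smaller field, and
  \<open>quadratic_step\<close> applies there.\<close>

lemma weil_V_le_half:
  assumes nondeg: "\<nexists>l. [d = p ^ l] (mod (p ^ n - 1))" and deg: "[d = p ^ l] (mod (p - 1))"
    and n: "n = 2 ^ k"
  shows "weil_V TYPE('a) n d \<le> ereal (1 / 2 * real n)"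
proof (rule ccontr)
  assume V: "\<not> ?thesis"
  define D where "D = (\<lambda>i. \<exists>l. [d = p ^ l] (mod (p ^ (2 ^ i) - 1)))"
  have "D 0" using deg by (auto simp: D_def)
  moreover have "\<not> D k" using nondeg by (simp add: D_def n)
  ultimately obtain i where i: "i < k" "D i" "\<not> D (Suc i)"
    using dec_induct[of 0 k D] by (metis le0)
  define m r :: nat where "m = 2 ^ i" and "r = 2 ^ (k - Suc i)"
  have m0: "m > 0" by (simp add: m_def)
  have nmr: "n = 2 * m * r"
  proof -
    have "k = Suc i + (k - Suc i)" using i(1) by simp
    hence "n = 2 ^ (Suc i + (k - Suc i))" using n by simp
    thus ?thesis by (simp only: power_add m_def r_def power_Suc)
  qed
  obtain l where l: "[d = p ^ l] (mod (p ^ m - 1))" using i(2) by (auto simp: D_def m_def)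
  have one: "[(p ^ j) ^ s = 1] (mod (p ^ j - 1))" for j s
  proof -
    have "p ^ j \<ge> 1" using p_ge_2 by simp
    hence "[p ^ j = 1] (mod (p ^ j - 1))" by (simp add: cong_altdef_nat)
    from cong_pow[OF this, of s] show ?thesis by simp
  qed
  \<comment> \<open>Chosen so that \<open>p ^ l * p ^ x\<close> is a power of \<open>p ^ m\<close>,
    hence 1 modulo \<open>p ^ m - 1\<close>.\<close>
  define x where "x = l * (m - 1)"
  define d0 where "d0 = d * p ^ x"
  have "[d0 = p ^ l * p ^ x] (mod (p ^ m - 1))" unfolding d0_def using l by (rule cong_mult) simp
  also have "p ^ l * p ^ x = (p ^ m) ^ l"
    using m0 by (simp add: x_def mult.commute flip: power_add power_mult) (cases m; simp)
  finally have d0: "[d0 = 1] (mod (p ^ m - 1))" using one cong_trans by blast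
  have "coprime p (p ^ n - 1)"
  proof -
    have "coprime (p ^ n) (p ^ n - 1)" using p_ge_2 by (intro coprime_diff_one_right_nat) auto
    thus ?thesis using n_pos by simp
  qed
  then interpret D0: weil_field ty p n d0
    using char card_field d_pos coprime_d p_ge_2
    by unfold_locales (auto simp: d0_def)
  have "\<not> p ^ (2 * m) - 1 dvd z" if z: "psum p d0 (m * (p - 1)) z" for z
  proof
    assume dvd: "p ^ (2 * m) - 1 dvd z"
    have "psum p d (m * (p - 1)) z" using z psum_exponent_shift unfolding d0_def by blast
    moreover have "0 < m * (p - 1)" using m0 p_ge_2 by simp
    ultimately have "weil_V TYPE('a) n d \<le> ereal (real (r * (m * (p - 1))) / (real p - 1))"
      using dvd nmr by (intro weil_V_le_of_psum_subfield) auto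
    also have "real (r * (m * (p - 1))) / (real p - 1) = 1 / 2 * real n"
      using p_ge_2 by (simp add: nmr of_nat_diff field_simps)
    finally show False using V by simp
  qed
  from D0.quadratic_step[OF m0 _ d0 this]
  have "[d0 = p ^ 0] (mod (p ^ (2 * m) - 1)) \<or> [d0 = p ^ m] (mod (p ^ (2 * m) - 1))"
    by (simp add: nmr)
  then obtain j where j: "[d0 = p ^ j] (mod (p ^ (2 * m) - 1))" by blast
  \<comment> \<open>The twist is undone: a further \<open>p ^ ((2 * m - 1) * x)\<close> completes
    \<open>p ^ x\<close> to a power of \<open>p ^ (2 * m)\<close>.\<close>
  have "[d * (p ^ (2 * m)) ^ x = d * 1] (mod (p ^ (2 * m) - 1))" by (intro cong_mult one) simp
  moreover have "d * (p ^ (2 * m)) ^ x = d0 * p ^ ((2 * m - 1) * x)"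
    using m0 by (simp add: d0_def mult.commute flip: power_add power_mult) (cases m; simp)
  moreover have "[d0 * p ^ ((2 * m - 1) * x) = p ^ j * p ^ ((2 * m - 1) * x)] (mod (p ^ (2 * m) - 1))"
    using j by (rule cong_mult) simp
  ultimately have "[d = p ^ (j + (2 * m - 1) * x)] (mod (p ^ (2 * m) - 1))"
    by (metis cong_sym cong_trans mult.right_neutral power_add)
  hence "D (Suc i)" by (auto simp: D_def m_def)
  thus False using i(3) by blast
qed

section \<open>Exponents nondegenerate over the prime field\<close>

lemma coprime_d_sub:
  assumes "m dvd n" shows "coprime d (p ^ m - 1)"
proof -
  obtain r where "n = m * r" using assms by auto
  hence "p ^ m - 1 dvd p ^ n - 1" using power_minus_one_dvd[of "p ^ m" r] by (simp only: power_mult)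
  thus ?thesis using coprime_d coprime_divisors dvd_refl by blast
qed

lemma p_ge_5_if_nondegenerate:
  assumes "\<not> [d = 1] (mod (p - 1))" shows "p \<ge> 5"
proof -
  have "coprime d (p - 1)" using coprime_d_sub[of 1] by simp
  have "p \<noteq> 2" using assms by (auto simp: cong_def)
  moreover have "p \<noteq> 3"
  proof
    assume "p = 3"
    hence "odd d" using \<open>coprime d (p - 1)\<close> by simp
    thus False using assms \<open>p = 3\<close> by (simp add: cong_def odd_iff_mod_2_eq_one)
  qed
  moreover have "p \<noteq> 4" using p_prime by (auto simp: prime_nat_iff dest: spec[of _ 2])
  ultimately show ?thesis using p_ge_2 by linarith
qed

lemma weil_V_le_prime_field:
  assumes "p - 1 dvd d * a + b" "0 < a + b" "a + b < p - 1"
  shows "weil_V TYPE('a) n d \<le> ereal (1 / (real p - 1) * real (a + b) * real n)"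
proof -
  have "psum p d (a + b) (d * a + b)" using psum_two_digits[of p d a 0 b 0] by simp
  hence "weil_V TYPE('a) n d \<le> ereal (real (n * (a + b)) / (real p - 1))"
    using assms by (intro weil_V_le_of_psum_subfield[where m = 1]) auto
  thus ?thesis by (simp add: mult.commute)
qed

text \<open>\<open>short_lattice_vector\<close> is applied with \<open>N = p - 1\<close>, where
  \<open>N + 1\<close> is a prime above 3; integrality turns \<open>3 * (a + b) \<le> p + 1\<close>
  into the ceiling.\<close>

lemma weil_V_nondegenerate_prime_field:
  assumes nondeg: "\<not> [d = 1] (mod (p - 1))"
  shows "weil_V TYPE('a) n d \<le>
      ereal (1 / (real p - 1) * of_int \<lceil>(real p - 1) / 3\<rceil> * real n) \<or>
    [d = 1 + (p - 1) div 2] (mod (p - 1))"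
proof -
  have p5: "p \<ge> 5" using nondeg by (rule p_ge_5_if_nondegenerate)
  define N where "N = int (p - 1)"
  have "odd p" using p_prime p5 by (intro prime_odd_nat) auto
  hence N: "even N" "N \<ge> 4" using p5 by (auto simp: N_def)
  have cop: "coprime (int d) N" unfolding N_def using coprime_d_sub[of 1] by simp
  have nd: "\<not> [int d = 1] (mod N)"
    using nondeg unfolding N_def by (metis cong_int_iff of_nat_1)
  have N3: "\<not> 3 dvd N + 1"
  proof
    assume "3 dvd N + 1"
    hence "int 3 dvd int p" using p5 by (simp add: N_def of_nat_diff)
    hence "3 dvd p" by (simp only: of_nat_dvd_iff)
    thus False using p_prime p5 by (auto simp: prime_nat_iff)
  qed
  have half: "[int d = 1 + N div 2] (mod N) \<Longrightarrow> [d = 1 + (p - 1) div 2] (mod (p - 1))"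
    unfolding N_def by (simp flip: cong_int_iff add: of_nat_div)
  show ?thesis using short_lattice_vector[OF N cop nd N3]
  proof (elim disjE exE conjE)
    fix a b :: int
    assume ab: "a \<ge> 0" "b \<ge> 0" "0 < a + b" "3 * (a + b) \<le> N + 2" "N dvd int d * a + b"
    define a' b' where "a' = nat a" and "b' = nat b"
    have ab': "a = int a'" "b = int b'" using ab by (simp_all add: a'_def b'_def)
    have "int (p - 1) dvd int (d * a' + b')" using ab(5) by (simp add: ab' N_def)
    hence "p - 1 dvd d * a' + b'" by (simp only: of_nat_dvd_iff)
    moreover have "0 < a' + b'" "a' + b' < p - 1" using ab N by (auto simp: ab' N_def)
    ultimately have "weil_V TYPE('a) n d \<le> ereal (1 / (real p - 1) * real (a' + b') * real n)"
      by (rule weil_V_le_prime_field)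
    also have "\<dots> \<le> ereal (1 / (real p - 1) * of_int \<lceil>(real p - 1) / 3\<rceil> * real n)"
    proof -
      have "3 * int (a' + b') \<le> int p + 1" using ab(4) p5 by (simp add: ab' N_def of_nat_diff)
      hence "3 * real (a' + b') \<le> real p + 1" by linarith
      hence "int (a' + b') \<le> \<lceil>(real p - 1) / 3\<rceil>" by (simp add: le_ceiling_iff)
      hence "real (a' + b') \<le> of_int \<lceil>(real p - 1) / 3\<rceil>" by linarith
      thus ?thesis using p5 by (simp add: mult_right_mono divide_right_mono)
    qed
    finally show ?thesis by blast
  qed (use half in blast)
qed

text \<open>Here \<open>a = 1\<close> and \<open>b = (p - 1) / 2 - 1\<close> make
  \<open>d * a + b\<close> divisible by \<open>p - 1\<close>.\<close>

lemma weil_V_exceptional: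
  assumes d: "[d = 1 + (p - 1) div 2] (mod (p - 1))" and p5: "p \<ge> 5"
  shows "weil_V TYPE('a) n d \<le> ereal (1 / 2 * real n)"
proof -
  have "odd p" using p_prime p5 by (intro prime_odd_nat) auto
  then obtain h where h: "p = 2 * h + 1" by (auto elim: oddE)
  have "[d * 1 + (h - 1) = (1 + h) + (h - 1)] (mod (p - 1))"
    using d by (intro cong_add) (simp_all add: h)
  also have "(1 + h) + (h - 1) = p - 1" using h p5 by simp
  finally have "p - 1 dvd d * 1 + (h - 1)" by (simp add: cong_def mod_eq_0_iff_dvd)
  hence "weil_V TYPE('a) n d \<le> ereal (1 / (real p - 1) * real (1 + (h - 1)) * real n)"
    using p5 h by (intro weil_V_le_prime_field) auto
  also have "1 / (real p - 1) * real (1 + (h - 1)) * real n = 1 / 2 * real n"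
    using p5 h by (simp add: field_simps of_nat_diff)
  finally show ?thesis .
qed

text \<open>\<open>d\<close> is odd, being prime to \<open>p - 1\<close>, so
  \<open>(p - 1) / 2\<close> must be even.\<close>

lemma exceptional_imp_p_cong_1_mod_4:
  assumes d: "[d = 1 + (p - 1) div 2] (mod (p - 1))" and p5: "p \<ge> 5"
  obtains \<nu> where "p = 4 * \<nu> + 1"
proof -
  have "odd p" using p_prime p5 by (intro prime_odd_nat) auto
  then obtain h where h: "p = 2 * h + 1" by (auto elim: oddE)
  have d': "[d = 1 + h] (mod (2 * h))" using d h by simp
  have "odd d" using coprime_d_sub[of 1] h by auto
  moreover have "[d = 1 + h] (mod 2)" using cong_dvd_modulus_nat[OF d', of 2] by simp
  hence "d mod 2 = (1 + h) mod 2" by (simp only: cong_def)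
  ultimately have "even h" by presburger
  then obtain \<nu> where "h = 2 * \<nu>" by (auto elim: evenE)
  thus ?thesis using h that[of \<nu>] by simp
qed

lemma weil_V_exceptional_even:
  assumes d: "[d = 1 + (p - 1) div 2] (mod (p - 1))" and p5: "p \<ge> 5" and n: "even n"
  shows "weil_V TYPE('a) n d \<le> ereal (1 / (real p - 1) * of_int \<lceil>(real p - 1) / 3\<rceil> * real n)"
proof -
  obtain \<nu> where \<nu>: "p = 4 * \<nu> + 1" using exceptional_imp_p_cong_1_mod_4[OF d p5] by blast
  have "\<nu> \<noteq> 2"
  proof
    assume "\<nu> = 2"
    hence "p = 3 * 3" using \<nu> by simp
    thus False using p_prime by (auto simp: prime_nat_iff dest: spec[of _ 3])
  qed
  then consider "\<nu> = 1" | "\<nu> \<ge> 3" using \<nu> p5 by linarith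
  thus ?thesis
  proof cases
    case 1
    \<comment> \<open>For \<open>p = 5\<close> the ceiling equals \<open>(p - 1) / 2\<close>, so the
      bound with 1/2 is enough.\<close>
    hence "\<lceil>(real p - 1) / 3\<rceil> = 2" by (simp add: \<nu> ceiling_eq_iff)
    thus ?thesis using weil_V_exceptional[OF d p5] by (simp add: \<nu> 1)
  next
    case 2
    \<comment> \<open>As \<open>n\<close> is even, \<open>d\<close> is coprime to
      \<open>p ^ 2 - 1\<close>, which \<open>2 * \<nu> + 1 = (p + 1) / 2\<close> divides.\<close>
    have "coprime d (2 * \<nu> + 1)"
    proof -
      have "p ^ 2 - 1 = (2 * \<nu> + 1) * (8 * \<nu>)" by (simp add: \<nu> power2_eq_square algebra_simps)
      moreover have "coprime d (p ^ 2 - 1)" using n by (intro coprime_d_sub)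
      ultimately show ?thesis by (metis coprime_mult_right_iff)
    qed
    then obtain z where z: "psum p d (2 * \<nu>) z" "p ^ 2 - 1 dvd z"
      using ex_psum_exceptional[OF \<nu> 2] d by (auto simp: \<nu>)
    obtain r where r: "n = 2 * r" using n by (auto elim: evenE)
    have "weil_V TYPE('a) n d \<le> ereal (real (r * (2 * \<nu>)) / (real p - 1))"
      using z r 2 \<nu> by (intro weil_V_le_of_psum_subfield[where m = 2]) auto
    also have "\<dots> = ereal (1 / (real p - 1) * real \<nu> * real n)" by (simp add: r)
    also have "\<dots> \<le> ereal (1 / (real p - 1) * of_int \<lceil>(real p - 1) / 3\<rceil> * real n)"
    proof -
      have "int \<nu> \<le> \<lceil>(real p - 1) / 3\<rceil>" by (simp add: le_ceiling_iff \<nu>)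
      hence "real \<nu> \<le> of_int \<lceil>(real p - 1) / 3\<rceil>" by linarith
      thus ?thesis using p5 by (simp add: mult_right_mono divide_right_mono)
    qed
    finally show ?thesis .
  qed
qed

end

theorem theorem1p1:
  fixes p n d :: nat
  assumes "CHAR('a :: finite_field) = p"
    and "CARD('a) = p ^ n"
    and "d > 0"
    and "gcd d (p ^ n - 1) = 1"
  shows "(degenerate_over (UNIV :: 'a set) d \<longrightarrow>
            weil_V TYPE('a) n d = ereal (real n)) \<and>
         (\<not> degenerate_over (UNIV :: 'a set) d \<and> degenerate_over (prime_subfield :: 'a set) d \<longrightarrow>
            ((\<exists>k. n = 2 ^ k) \<longrightarrow> weil_V TYPE('a) n d \<le> ereal (1 / 2 * real n)) \<and>
            (\<not> (\<exists>k. n = 2 ^ k) \<longrightarrow> weil_V TYPE('a) n d \<le> ereal (2 / 3 * real n))) \<and>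
         (\<not> degenerate_over (prime_subfield :: 'a set) d \<longrightarrow>
            p \<ge> 5 \<and>
            ([p = 1] (mod 4) \<and> odd n \<longrightarrow> weil_V TYPE('a) n d \<le> ereal (1 / 2 * real n)) \<and>
            (\<not> ([p = 1] (mod 4) \<and> odd n) \<longrightarrow>
               weil_V TYPE('a) n d \<le>
                 ereal (1 / (real p - 1) * of_int \<lceil>(real p - 1) / 3\<rceil> * real n)))"
proof -
  interpret weil_field "TYPE('a)" p n d
    using assms by unfold_locales (auto simp: coprime_iff_gcd_eq_1)
  have degF: "degenerate_over (UNIV :: 'a set) d \<longleftrightarrow> (\<exists>k. [d = p ^ k] (mod (p ^ n - 1)))"
    by (simp add: degenerate_over_def char card_field)
  have degP: "degenerate_over (prime_subfield :: 'a set) d \<longleftrightarrow> (\<exists>k. [d = p ^ k] (mod (p - 1)))"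
    by (simp add: degenerate_over_def char card_prime_subfield)
  have degP1: "\<not> [d = 1] (mod (p - 1))" if "\<not> degenerate_over (prime_subfield :: 'a set) d"
    using that unfolding degP by (metis power_0)
  \<comment> \<open>The ceiling is at most \<open>(p - 1) / 2\<close>, so the lattice bound also
    implies the bound with 1/2.\<close>
  have ceil: "1 / (real p - 1) * of_int \<lceil>(real p - 1) / 3\<rceil> * real n \<le> 1 / 2 * real n" if "p \<ge> 5"
  proof -
    have "odd p" using p_prime that by (intro prime_odd_nat) auto
    then obtain h where h: "p = 2 * h + 1" by (auto elim: oddE)
    have "\<lceil>(real p - 1) / 3\<rceil> \<le> int h" using that h by (simp add: ceiling_le_iff)
    hence "of_int \<lceil>(real p - 1) / 3\<rceil> \<le> real h" by linarith
    hence "1 / (real p - 1) * of_int \<lceil>(real p - 1) / 3\<rceil> \<le> 1 / (real p - 1) * real h"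
      using that by (intro mult_left_mono) auto
    also have "\<dots> = 1 / 2" using that h by (simp add: field_simps)
    finally show ?thesis by (intro mult_right_mono) auto
  qed
  \<comment> \<open>Outside (iii)(a) the exceptional exponent can therefore occur only with
    \<open>n\<close> even.\<close>
  have exc: "[p = 1] (mod 4)" if d: "[d = 1 + (p - 1) div 2] (mod (p - 1))" and p5: "p \<ge> 5"
  proof -
    obtain \<nu> where "p = 4 * \<nu> + 1" using exceptional_imp_p_cong_1_mod_4[OF d p5] by blast
    thus ?thesis by (simp add: cong_def)
  qed
  show ?thesis
  proof (intro conjI impI)
    assume "degenerate_over (UNIV :: 'a set) d"
    thus "weil_V TYPE('a) n d = ereal (real n)" unfolding degF using weil_V_degenerate by blast
  next
    assume "\<not> degenerate_over (UNIV :: 'a set) d \<and> degenerate_over (prime_subfield :: 'a set) d"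
      and "\<exists>k. n = 2 ^ k"
    thus "weil_V TYPE('a) n d \<le> ereal (1 / 2 * real n)"
      unfolding degF degP using weil_V_le_half by blast
  next
    assume "\<not> degenerate_over (UNIV :: 'a set) d \<and> degenerate_over (prime_subfield :: 'a set) d"
    thus "weil_V TYPE('a) n d \<le> ereal (2 / 3 * real n)"
      unfolding degF using weil_V_le_two_thirds by blast
  next
    assume "\<not> degenerate_over (prime_subfield :: 'a set) d"
    thus "p \<ge> 5" using degP1 p_ge_5_if_nondegenerate by blast
  next
    assume "\<not> degenerate_over (prime_subfield :: 'a set) d"
    hence nd: "\<not> [d = 1] (mod (p - 1))" by (rule degP1)
    hence p5: "p \<ge> 5" by (rule p_ge_5_if_nondegenerate)
    show "weil_V TYPE('a) n d \<le> ereal (1 / 2 * real n)"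
      using weil_V_nondegenerate_prime_field[OF nd] weil_V_exceptional p5 ceil
      by (meson ereal_less_eq(3) order_trans)
  next
    assume "\<not> degenerate_over (prime_subfield :: 'a set) d" and c: "\<not> ([p = 1] (mod 4) \<and> odd n)"
    hence nd: "\<not> [d = 1] (mod (p - 1))" by (intro degP1)
    hence p5: "p \<ge> 5" by (rule p_ge_5_if_nondegenerate)
    show "weil_V TYPE('a) n d \<le>
        ereal (1 / (real p - 1) * of_int \<lceil>(real p - 1) / 3\<rceil> * real n)"
      using weil_V_nondegenerate_prime_field[OF nd] weil_V_exceptional_even exc c p5 by blast
  qed
qed

end
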